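(* Let $G=(V,E)$ be an infinite, connected, locally finite, transitive, unimodular graph, and let $\{U(e)\}_{e\in E}$ be independent uniform $[0,1]$ random edge labels. Let $\mathrm{FMSF}(G)$ and $\mathrm{WMSF}(G)$ be the free and the wired minimal spanning forests of $G$ defined from these labels. If $\mathrm{FMSF}(G)$ is not equal to $\mathrm{WMSF}(G)$ (that is, it is not the case that $\mathrm{FMSF}(G)=\mathrm{WMSF}(G)$ almost surely), then almost surely every tree (connected component) of $\mathrm{FMSF}(G)$ has infinitely many ends.
   Context: A graph $G=(V,E)$ is transitive if its automorphism group $\mathrm{Aut}(G)$ acts transitively on $V$. A transitive, connected, locally finite graph $G$ is unimodular if $|\mathrm{Stab}(x)\,y|=|\mathrm{Stab}(y)\,x|$ for all $x,y\in V$, where $\mathrm{Stab}(x)$ is the stabilizer of $x$ in $\mathrm{Aut}(G)$ and $\mathrm{Stab}(x)\,y$ is the orbit of $y$ under it (equivalently, $\mathrm{Aut}(G)$ is a unimodular locally compact group). Let $\{U(e)\}_{e\in E}$ be i.i.d. uniform $[0,1]$ labels on the edges. The free minimal spanning forest $\mathrm{FMSF}(G)$ is the random set of edges $e$ such that $U$ does not attain its maximum at $e$ for any cycle containing $e$; that is, there is no (simple) cycle $C\ni e$ in $G$ with $U(e)=\max_{f\in C}U(f)$. The wired minimal spanning forest $\mathrm{WMSF}(G)$ is the random set of edges $e$ such that $U$ does not attain its maximum at $e$ for any cycle or any bi-infinite simple path containing $e$; that is, there is no $C\ni e$ which is a (simple) cycle or a bi-infinite simple path in $G$ with $U(e)\ge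 U(f)$ for all $f\in C$. Both are regarded as spanning subgraphs of $G$ with vertex set $V$; almost surely they are forests. The trees of such a forest are its connected components. An end of a tree $T$ is an equivalence class of (one-way infinite, simple) paths in $T$, where two paths are equivalent if and only if their symmetric difference is finite. *)

theory Defs
  imports "HOL-Probability.Probability" "HOL-Combinatorics.Permutations"
begin

section \<open>Graphs\<close>

definition simple_graph :: "'a set \<Rightarrow> 'a set set \<Rightarrow> bool" where
  "simple_graph V E \<longleftrightarrow> (\<forall>e\<in>E. e \<subseteq> V \<and> card e = 2)"

definition reachable :: "'a set set \<Rightarrow> ('a \<times> 'a) set" where
  "reachable E = {(x, y). {x, y} \<in> E}\<^sup>*"

definition connected_graph :: "'a set \<Rightarrow> 'a set set \<Rightarrow> bool" where
  "connected_graph V E \<longleftrightarrow> (\<forall>x\<in>V. \<forall>y\<in>V. (x, y) \<in> reachable E)"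

definition locally_finite_graph :: "'a set \<Rightarrow> 'a set set \<Rightarrow> bool" where
  "locally_finite_graph V E \<longleftrightarrow> (\<forall>x\<in>V. finite {e \<in> E. x \<in> e})"

definition graph_aut :: "'a set \<Rightarrow> 'a set set \<Rightarrow> ('a \<Rightarrow> 'a) set" where
  "graph_aut V E =
     {f. f permutes V \<and> (\<forall>x\<in>V. \<forall>y\<in>V. {f x, f y} \<in> E \<longleftrightarrow> {x, y} \<in> E)}"

definition transitive_graph :: "'a set \<Rightarrow> 'a set set \<Rightarrow> bool" where
  "transitive_graph V E \<longleftrightarrow> (\<forall>x\<in>V. \<forall>y\<in>V. \<exists>f\<in>graph_aut V E. f x = y)"

definition stab :: "'a set \<Rightarrow> 'a set set \<Rightarrow> 'a \<Rightarrow> ('a \<Rightarrow> 'a) set" where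
  "stab V E x = {f \<in> graph_aut V E. f x = x}"

definition stab_orbit :: "'a set \<Rightarrow> 'a set set \<Rightarrow> 'a \<Rightarrow> 'a \<Rightarrow> 'a set" where
  "stab_orbit V E x y = (\<lambda>f. f y) ` stab V E x"

text \<open>
  Intended for connected, locally finite graphs.  There the orbits below are finite (they lie in
  spheres), so that \<^const>\<open>card\<close> is the true cardinality.
\<close>

definition unimodular_graph :: "'a set \<Rightarrow> 'a set set \<Rightarrow> bool" where
  "unimodular_graph V E \<longleftrightarrow>
     (\<forall>x\<in>V. \<forall>y\<in>V. card (stab_orbit V E x y) = card (stab_orbit V E y x))"

section \<open>Cycles and paths, as edge sets\<close>

definition is_cycle :: "'a set set \<Rightarrow> 'a set set \<Rightarrow> bool" where
  "is_cycle E C \<longleftrightarrow> C \<subseteq> E \<and>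
     (\<exists>vs. length vs \<ge> 3 \<and> distinct vs \<and>
        C = {{vs ! i, vs ! (Suc i mod length vs)} | i. i < length vs})"

definition is_biinf_path :: "'a set set \<Rightarrow> 'a set set \<Rightarrow> bool" where
  "is_biinf_path E C \<longleftrightarrow> C \<subseteq> E \<and>
     (\<exists>p :: int \<Rightarrow> 'a. inj p \<and> C = range (\<lambda>i. {p i, p (i + 1)}))"

definition is_ray :: "'a set set \<Rightarrow> 'a set set \<Rightarrow> bool" where
  "is_ray E P \<longleftrightarrow> P \<subseteq> E \<and>
     (\<exists>p :: nat \<Rightarrow> 'a. inj p \<and> P = range (\<lambda>n. {p n, p (Suc n)}))"

section \<open>Components and ends\<close>

text \<open>
  A component of the spanning subgraph with vertex set \<open>V\<close> and edge set \<open>F\<close> is given by its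
  vertex set, so that isolated vertices are components as well.
\<close>

definition graph_components :: "'a set \<Rightarrow> 'a set set \<Rightarrow> 'a set set" where
  "graph_components V F = (\<lambda>x. {y \<in> V. (x, y) \<in> reachable F}) ` V"

definition induced_edges :: "'a set set \<Rightarrow> 'a set \<Rightarrow> 'a set set" where
  "induced_edges F W = {e \<in> F. e \<subseteq> W}"

definition end_rel :: "'a set set \<Rightarrow> ('a set set \<times> 'a set set) set" where
  "end_rel T = {(P, Q). is_ray T P \<and> is_ray T Q \<and> finite (sym_diff P Q)}"

definition tree_ends :: "'a set set \<Rightarrow> 'a set set set set" where
  "tree_ends T = {P. is_ray T P} // end_rel T"

section \<open>Minimal spanning forests\<close>

definition FMSF :: "'a set set \<Rightarrow> ('a set \<Rightarrow> real) \<Rightarrow> 'a set set" where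
  "FMSF E u = {e \<in> E. \<not> (\<exists>C. is_cycle E C \<and> e \<in> C \<and> (\<forall>f\<in>C. u f \<le> u e))}"

definition WMSF :: "'a set set \<Rightarrow> ('a set \<Rightarrow> real) \<Rightarrow> 'a set set" where
  "WMSF E u =
     {e \<in> E. \<not> (\<exists>C. (is_cycle E C \<or> is_biinf_path E C) \<and> e \<in> C \<and> (\<forall>f\<in>C. u f \<le> u e))}"

definition iid_uniform_labels :: "'w measure \<Rightarrow> 'e set \<Rightarrow> ('e \<Rightarrow> 'w \<Rightarrow> real) \<Rightarrow> bool" where
  "iid_uniform_labels M E U \<longleftrightarrow>
     prob_space.indep_vars M (\<lambda>_. borel) U E \<and>
     (\<forall>e\<in>E. distr M borel (U e) = uniform_measure lborel {0..1})"

end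

theory Submission
  imports Defs
begin

text \<open>
  Call an edge of the free forest a bridge if both of its endpoints lie in infinite clusters of the
  edges with smaller labels. For distinct labels the forests can only differ in bridges, so bridges
  exist with positive probability and, by ergodicity, almost surely. By mass transport almost surely
  no finite nonempty set is the set of nearest bridge endpoints of infinitely many vertices.

  Suppose some tree \<open>T\<close> has no bridge. Its vertices invade infinite clusters of every level at which
  these exist, so for some level \<open>s\<close> below the label of a bridge the tree meets an infinite cluster
  of level \<open>s\<close> and there is a different one. Closing a finite connected set between the two clusters
  and then lowering the labels along a path through it, one edge at a time, changes finitely many
  labels to values in open intervals, and creates a tree in which an infinite bridge-free branch
  hangs at a single bridge. All vertices of the branch then have the same nearest bridge endpoint,
  a contradiction.

  So every tree has a bridge, hence infinitely many, again by mass transport. Removing \<open>n\<close> bridges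
  from a tree leaves \<open>n + 1\<close> infinite components: the removed bridge of smallest label at a component
  ends there in an infinite cluster that uses only smaller labels. So the tree has more than \<open>n\<close> ends.
\<close>

section \<open>Reachability\<close>

text \<open>Why a tree must meet the infinite clusters of level \<open>t\<close> when those of a
  level \<open>s < t\<close> exist: suppose the invasion from a vertex avoids them, and call an edge
  from an invaded set to an infinite cluster of level \<open>s\<close> a chance. Moving the label of
  a chance between \<open>s\<close> and \<open>t\<close> makes it the first entry of the invasion
  into level \<open>s\<close>. First entries are unique, so the expected number of chances is at
  most \<open>1 / (t - s)\<close>. But labels away from the set invaded so far are independent of
  it, which almost surely yields a chance outside every finite set. The surgery acts on single
  configurations, and each of these has probability zero. It therefore starts in an almost sure
  event that is closed under moving one label to a suitable point of a given open interval; each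
  intermediate configuration is again \<open>balanced\<close>. Working edge by edge keeps control
  over new bridges: raising a label only shrinks infinite clusters, and a lowered edge can make a
  cluster infinite only by joining it to the branch through that edge. Either way at most the
  exchanged edge becomes a bridge in the branch, and \<open>balanced\<close> then excludes bridges
  in the rest of the tree.\<close>

lemma reachable_refl [simp]: "(x, x) \<in> reachable A"
  by (simp add: reachable_def)

lemma reachable_edge: "{x, y} \<in> A \<Longrightarrow> (x, y) \<in> reachable A"
  by (auto simp: reachable_def)

lemma reachable_trans: "(x, y) \<in> reachable A \<Longrightarrow> (y, z) \<in> reachable A \<Longrightarrow> (x, z) \<in> reachable A"
  by (auto simp: reachable_def)

lemma reachable_sym: "(x, y) \<in> reachable A \<Longrightarrow> (y, x) \<in> reachable A"
proof -
  have "sym {(x, y). {x, y} \<in> A}"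
    by (auto simp: sym_def insert_commute)
  then show "(x, y) \<in> reachable A \<Longrightarrow> (y, x) \<in> reachable A"
    unfolding reachable_def by (meson sym_rtrancl symD)
qed

lemma reachable_mono: "(x, y) \<in> reachable A \<Longrightarrow> A \<subseteq> B \<Longrightarrow> (x, y) \<in> reachable B"
  unfolding reachable_def by (erule rtrancl_mono[THEN subsetD, rotated]) auto

lemma reachable_closed:
  assumes "(x, y) \<in> reachable A" "x \<in> S" "\<And>a b. a \<in> S \<Longrightarrow> {a, b} \<in> A \<Longrightarrow> b \<in> S"
  shows "y \<in> S"
  using assms(1) unfolding reachable_def
  by (induction rule: rtrancl_induct) (use assms in auto)

lemma reachable_exit:
  assumes "(x, y) \<in> reachable A" "x \<in> S" "y \<notin> S"
  shows "\<exists>a\<in>S. \<exists>b. b \<notin> S \<and> {a, b} \<in> A \<and> (x, a) \<in> reachable {e\<in>A. e \<subseteq> S}"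
proof (rule ccontr)
  assume no: "\<not> ?thesis"
  let ?T = "{z\<in>S. (x, z) \<in> reachable {e\<in>A. e \<subseteq> S}}"
  have "y \<in> ?T"
  proof (rule reachable_closed[OF assms(1)])
    show "x \<in> ?T" using assms by simp
    fix a b assume a: "a \<in> ?T" "{a, b} \<in> A"
    then have b: "b \<in> S" using no by blast
    have "(a, b) \<in> reachable {e\<in>A. e \<subseteq> S}"
      using a b by (intro reachable_edge) auto
    then show "b \<in> ?T" using a b reachable_trans by fastforce
  qed
  then show False using assms by simp
qed

text \<open>A shortest path crosses an added edge at most once; the last two alternatives are the
  two directions of crossing.\<close>

lemma reachable_insert:
  assumes "(x, y) \<in> reachable (insert {a, b} A)"
  shows "(x, y) \<in> reachable A \<or> ((x, a) \<in> reachable A \<and> (b, y) \<in> reachable A)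
    \<or> ((x, b) \<in> reachable A \<and> (a, y) \<in> reachable A)"
proof -
  let ?S = "{y. (x, y) \<in> reachable A \<or> ((x, a) \<in> reachable A \<and> (b, y) \<in> reachable A)
    \<or> ((x, b) \<in> reachable A \<and> (a, y) \<in> reachable A)}"
  have "y \<in> ?S"
  proof (rule reachable_closed[OF assms])
    show "x \<in> ?S" by simp
    fix c d assume c: "c \<in> ?S" and "{c, d} \<in> insert {a, b} A"
    then consider "{c, d} \<in> A" | "c = a" "d = b" | "c = b" "d = a"
      by (auto simp: doubleton_eq_iff)
    then show "d \<in> ?S"
    proof cases
      case 1
      then have "(c, d) \<in> reachable A" by (rule reachable_edge)
      with c show ?thesis by (auto intro: reachable_trans)
    next
      case 2
      with c show ?thesis by (auto intro: reachable_trans reachable_sym)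
    next
      case 3
      with c show ?thesis by (auto intro: reachable_trans reachable_sym)
    qed
  qed
  then show ?thesis by simp
qed

lemma reachable_finite_subset:
  assumes "(x, y) \<in> reachable A"
  shows "\<exists>B\<subseteq>A. finite B \<and> (x, y) \<in> reachable B"
  using assms unfolding reachable_def
proof (induction rule: rtrancl_induct)
  case base
  then show ?case by (intro exI[of _ "{}"]) auto
next
  case (step y z)
  then obtain B where B: "B \<subseteq> A" "finite B" "(x, y) \<in> reachable B"
    by (auto simp: reachable_def)
  then have "(x, z) \<in> reachable (insert {y, z} B)"
    by (meson insertI1 reachable_edge reachable_mono reachable_trans subset_insertI)
  then show ?case using B step(2)
    by (intro exI[of _ "insert {y, z} B"]) (auto simp: reachable_def)
qed

lemma reachable_distinct_path:
  assumes "(x, y) \<in> reachable A"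
  shows "\<exists>ps. ps \<noteq> [] \<and> hd ps = x \<and> last ps = y \<and> distinct ps \<and>
    (\<forall>i. Suc i < length ps \<longrightarrow> {ps ! i, ps ! Suc i} \<in> A)"
  using assms unfolding reachable_def
proof (induction rule: rtrancl_induct)
  case base
  then show ?case by (intro exI[of _ "[x]"]) auto
next
  case (step y z)
  then obtain ps where ps: "ps \<noteq> []" "hd ps = x" "last ps = y" "distinct ps"
    "\<And>i. Suc i < length ps \<Longrightarrow> {ps ! i, ps ! Suc i} \<in> A" by blast
  show ?case
  proof (cases "z \<in> set ps")
    case True
    \<comment> \<open>Loop erasure: the walk returns to \<open>z\<close>, so it is cut after its
      earlier visit.\<close>
    then obtain i where i: "i < length ps" "ps ! i = z" by (auto simp: in_set_conv_nth)
    have "last (take (Suc i) ps) = z" using i by (simp add: take_Suc_conv_app_nth)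
    moreover have "hd (take (Suc i) ps) = x" using ps by (simp add: hd_take)
    ultimately show ?thesis using ps i
      by (intro exI[of _ "take (Suc i) ps"]) auto
  next
    case False
    have "{(ps @ [z]) ! i, (ps @ [z]) ! Suc i} \<in> A" if "Suc i < length (ps @ [z])" for i
    proof (cases "Suc i < length ps")
      case True
      then show ?thesis using ps(5)[of i] by (simp add: nth_append)
    next
      case F: False
      then have "i = length ps - 1" using that by simp
      then have "(ps @ [z]) ! i = y" "(ps @ [z]) ! Suc i = z"
        using ps by (auto simp: nth_append last_conv_nth)
      then show ?thesis using step(2) by simp
    qed
    then show ?thesis using ps False by (intro exI[of _ "ps @ [z]"]) auto
  qed
qed

section \<open>Clusters and the deletion of vertices\<close>

definition cluster :: "'a set set \<Rightarrow> 'a \<Rightarrow> 'a set" where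
  "cluster A x = {y. (x, y) \<in> reachable A}"

lemma in_cluster [simp]: "y \<in> cluster A x \<longleftrightarrow> (x, y) \<in> reachable A"
  by (simp add: cluster_def)

lemma cluster_eq: "(x, y) \<in> reachable A \<Longrightarrow> cluster A y = cluster A x"
  unfolding cluster_def using reachable_trans reachable_sym by fast

lemma cluster_mono: "A \<subseteq> B \<Longrightarrow> cluster A x \<subseteq> cluster B x"
  by (auto intro: reachable_mono)

lemma cluster_subset:
  assumes "x \<in> S" "\<And>a b. a \<in> S \<Longrightarrow> {a, b} \<in> A \<Longrightarrow> b \<in> S"
  shows "cluster A x \<subseteq> S"
  using reachable_closed[OF _ assms] by auto

text \<open>Confines a connection to edges inside the cluster; in \<open>lower_pure\<close> these
  are the edges that are known to survive.\<close>

lemma reachable_within: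
  assumes "(x, y) \<in> reachable A"
  shows "(x, y) \<in> reachable {e\<in>A. e \<subseteq> cluster A x}"
proof (rule ccontr)
  let ?S = "{y. (x, y) \<in> reachable {e\<in>A. e \<subseteq> cluster A x}}"
  assume "(x, y) \<notin> reachable {e\<in>A. e \<subseteq> cluster A x}"
  then have "y \<notin> ?S" "x \<in> ?S" by auto
  from reachable_exit[OF assms this(2,1)] obtain a b where
    ab: "a \<in> ?S" "b \<notin> ?S" "{a, b} \<in> A" by auto
  then have a: "(x, a) \<in> reachable A" by (auto intro: reachable_mono)
  moreover have "(a, b) \<in> reachable A" using ab by (intro reachable_edge)
  ultimately have "(x, b) \<in> reachable A" by (rule reachable_trans)
  with a have "(a, b) \<in> reachable {e\<in>A. e \<subseteq> cluster A x}"
    using ab by (intro reachable_edge) auto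
  then show False using ab reachable_trans by fastforce
qed

text \<open>Models the deletion of the vertices \<open>S\<close>: they are kept as isolated points,
  so the cluster of a point of \<open>S\<close> is a singleton.\<close>

definition avoiding :: "'a set set \<Rightarrow> 'a set \<Rightarrow> 'a set set" where
  "avoiding A S = {e\<in>A. e \<inter> S = {}}"

lemma avoiding_subset: "avoiding A S \<subseteq> A"
  by (auto simp: avoiding_def)

lemma avoiding_mono: "A \<subseteq> B \<Longrightarrow> avoiding A S \<subseteq> avoiding B S"
  by (auto simp: avoiding_def)

section \<open>Locally finite graphs\<close>

locale lf_graph =
  fixes V :: "'a set" and E :: "'a set set"
  assumes simple: "simple_graph V E"
    and infinite_V: "infinite V"
    and connected: "connected_graph V E"
    and locally_finite: "locally_finite_graph V E"
begin

lemma edgeE: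
  assumes "e \<in> E"
  obtains x y where "e = {x, y}" "x \<noteq> y" "x \<in> V" "y \<in> V"
  using assms simple unfolding simple_graph_def card_2_iff by (metis insert_subset)

lemma edge_verts: "{x, y} \<in> E \<Longrightarrow> x \<in> V \<and> y \<in> V \<and> x \<noteq> y"
  using simple unfolding simple_graph_def by (cases "x = y") auto

lemma edge_subset: "e \<in> E \<Longrightarrow> e \<subseteq> V"
  using simple unfolding simple_graph_def by auto

lemma finite_edge: "e \<in> E \<Longrightarrow> finite e"
  by (erule edgeE) auto

lemma reachable_V: "(x, y) \<in> reachable E" if "x \<in> V" "y \<in> V"
  using connected that unfolding connected_graph_def by auto

lemma cluster_subset_V: "A \<subseteq> E \<Longrightarrow> x \<in> V \<Longrightarrow> cluster A x \<subseteq> V"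
  using edge_verts by (intro cluster_subset) blast+

lemma finite_touching: "finite S \<Longrightarrow> finite {e\<in>E. e \<inter> S \<noteq> {}}"
proof -
  assume "finite S"
  have "{e\<in>E. e \<inter> S \<noteq> {}} \<subseteq> (\<Union>x\<in>S \<inter> V. {e\<in>E. x \<in> e})"
    using edge_subset by blast
  moreover have "finite (\<Union>x\<in>S \<inter> V. {e\<in>E. x \<in> e})"
    using \<open>finite S\<close> locally_finite by (auto simp: locally_finite_graph_def)
  ultimately show ?thesis by (rule finite_subset)
qed

lemma finite_nbrs: "finite {y. {x, y} \<in> E}"
proof -
  have "{y. {x, y} \<in> E} \<subseteq> \<Union> {e\<in>E. e \<inter> {x} \<noteq> {}}" by auto
  moreover have "finite (\<Union> {e\<in>E. e \<inter> {x} \<noteq> {}})"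
    using finite_touching[of "{x}"] finite_edge by auto
  ultimately show ?thesis by (rule finite_subset)
qed

lemma countable_V: "countable V"
proof -
  obtain o' where o: "o' \<in> V" using infinite_V by (metis ex_in_conv finite.emptyI)
  let ?R = "{(x, y). {x, y} \<in> E}"
  have fin: "finite {y. (o', y) \<in> ?R ^^ n}" for n
  proof (induction n)
    case (Suc n)
    have "{y. (o', y) \<in> ?R ^^ Suc n} = (\<Union>x\<in>{y. (o', y) \<in> ?R ^^ n}. {y. {x, y} \<in> E})"
      by auto
    then show ?case using Suc finite_nbrs by auto
  qed simp
  have "V \<subseteq> (\<Union>n. {y. (o', y) \<in> ?R ^^ n})"
    using reachable_V[OF o] unfolding reachable_def by (auto simp: rtrancl_is_UN_relpow)
  moreover have "countable (\<Union>n. {y. (o', y) \<in> ?R ^^ n})"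
    using fin by (auto intro: countable_finite)
  ultimately show ?thesis using countable_subset by blast
qed

lemma countable_E: "countable E"
proof -
  have "E \<subseteq> {A. finite A \<and> A \<subseteq> V}" using edge_subset finite_edge by auto
  then show ?thesis
    using countable_Collect_finite_subset[OF countable_V] countable_subset by blast
qed

lemma V_nonempty: "V \<noteq> {}" using infinite_V by auto

lemma E_nonempty: "E \<noteq> {}"
proof
  assume e: "E = {}"
  obtain x where x: "x \<in> V" using V_nonempty by auto
  have "V \<subseteq> cluster E x" using reachable_V x by auto
  also have "\<dots> \<subseteq> {x}" using e by (intro cluster_subset) auto
  finally show False using infinite_V by (meson finite.emptyI finite_insert finite_subset)
qed

text \<open>Deleting a finite set from a locally finite graph splits the rest of the cluster of
  \<open>x\<close> into pieces, each containing one of the finitely many neighbours of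
  \<open>S\<close>. If all pieces were finite, so would be the cluster.\<close>

lemma infinite_cluster_avoiding:
  assumes "A \<subseteq> E" "finite S" "x \<in> S" "infinite (cluster A x)"
  shows "\<exists>y z. y \<in> S \<and> z \<notin> S \<and> {y, z} \<in> A \<and> (x, z) \<in> reachable A \<and>
    infinite (cluster (avoiding A S) z)"
proof (rule ccontr)
  assume no: "\<not> ?thesis"
  define N where "N = {z. z \<notin> S \<and> (x, z) \<in> reachable A \<and> (\<exists>y\<in>S. {y, z} \<in> A)}"
  have "N \<subseteq> (\<Union>y\<in>S. {z. {y, z} \<in> E})" using assms N_def by auto
  then have "finite N" using assms(2) finite_nbrs by (auto intro: finite_subset)
  have fin: "finite (cluster (avoiding A S) z)" if "z \<in> N" for z
    using that no unfolding N_def by auto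
  let ?U = "(S \<union> (\<Union>z\<in>N. cluster (avoiding A S) z)) \<inter> cluster A x"
  have "cluster A x \<subseteq> ?U"
  proof (rule cluster_subset)
    show "x \<in> ?U" using assms by auto
    fix a b assume a: "a \<in> ?U" and ab: "{a, b} \<in> A"
    have r: "(x, b) \<in> reachable A"
      using a ab by (auto intro: reachable_trans reachable_edge)
    show "b \<in> ?U"
    proof (cases "b \<in> S")
      case False
      show ?thesis
      proof (cases "a \<in> S")
        case True
        then have "b \<in> N" using False r ab by (auto simp: N_def)
        then show ?thesis using r by fastforce
      next
        case aS: False
        then obtain z where z: "z \<in> N" "(z, a) \<in> reachable (avoiding A S)" using a by auto
        have "{a, b} \<in> avoiding A S" using aS False ab by (auto simp: avoiding_def)
        then have "(z, b) \<in> reachable (avoiding A S)"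
          using z reachable_edge reachable_trans by metis
        then show ?thesis using r z by auto
      qed
    qed (use r in auto)
  qed
  moreover have "finite ?U" using \<open>finite N\<close> fin assms(2) by auto
  ultimately show False using assms(4) finite_subset by blast
qed

end

lemma ex_max_on:
  fixes g :: "'b \<Rightarrow> real"
  assumes "finite S" "S \<noteq> {}"
  obtains m where "m \<in> S" "\<And>f. f \<in> S \<Longrightarrow> g f \<le> g m"
proof -
  have "Max (g ` S) \<in> g ` S" using assms by simp
  then obtain m where "m \<in> S" "g m = Max (g ` S)" by auto
  then show thesis using assms by (intro that[of m]) auto
qed

lemma ex_min_on:
  fixes g :: "'b \<Rightarrow> real"
  assumes "finite S" "S \<noteq> {}"
  obtains m where "m \<in> S" "\<And>f. f \<in> S \<Longrightarrow> g m \<le> g f"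
  using ex_max_on[OF assms, of "\<lambda>x. - g x"] by auto

context lf_graph
begin

section \<open>The free minimal spanning forest\<close>

definition below :: "('a set \<Rightarrow> real) \<Rightarrow> real \<Rightarrow> 'a set set" where
  "below \<xi> t = {e\<in>E. \<xi> e < t}"

definition inf_verts :: "('a set \<Rightarrow> real) \<Rightarrow> real \<Rightarrow> 'a set" where
  "inf_verts \<xi> t = {x\<in>V. infinite (cluster (below \<xi> t) x)}"

text \<open>For distinct labels this is \<open>FMSF\<close>, see \<open>FMSF_eq_forest\<close>.
  Reachability by strictly smaller labels replaces cycles and makes monotonicity arguments
  immediate.\<close>

definition forest :: "('a set \<Rightarrow> real) \<Rightarrow> 'a set set" where
  "forest \<xi> = {e\<in>E. \<forall>x y. e = {x, y} \<longrightarrow> (x, y) \<notin> reachable (below \<xi> (\<xi> e))}"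

text \<open>For distinct labels these contain all edges in which the free and the wired forest differ.\<close>

definition bridges :: "('a set \<Rightarrow> real) \<Rightarrow> 'a set set" where
  "bridges \<xi> = {e\<in>forest \<xi>. e \<subseteq> inf_verts \<xi> (\<xi> e)}"

text \<open>A tree that contains an endpoint of a bridge contains the bridge, because bridges are
  forest edges; so this says that the tree of \<open>x\<close> has no bridge.\<close>

definition pure :: "('a set \<Rightarrow> real) \<Rightarrow> 'a \<Rightarrow> bool" where
  "pure \<xi> x \<longleftrightarrow> cluster (forest \<xi>) x \<inter> \<Union> (bridges \<xi>) = {}"

lemma below_subset: "below \<xi> t \<subseteq> E"
  by (auto simp: below_def)

lemma below_mono: "s \<le> t \<Longrightarrow> below \<xi> s \<subseteq> below \<xi> t"
  by (auto simp: below_def)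

lemma inf_verts_subset: "inf_verts \<xi> t \<subseteq> V"
  by (auto simp: inf_verts_def)

lemma inf_verts_mono: "s \<le> t \<Longrightarrow> inf_verts \<xi> s \<subseteq> inf_verts \<xi> t"
  unfolding inf_verts_def using finite_subset[OF cluster_mono[OF below_mono[of s t \<xi>]]] by auto

lemma inf_verts_reachable:
  "x \<in> inf_verts \<xi> t \<Longrightarrow> (x, y) \<in> reachable (below \<xi> t) \<Longrightarrow> y \<in> inf_verts \<xi> t"
  using cluster_eq[of x y "below \<xi> t"] cluster_subset_V[OF below_subset, of x \<xi> t]
  unfolding inf_verts_def by auto

lemma forest_subset: "forest \<xi> \<subseteq> E"
  by (auto simp: forest_def)

lemma bridges_subset: "bridges \<xi> \<subseteq> forest \<xi>"
  by (auto simp: bridges_def)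

lemma forestD: "{x, y} \<in> forest \<xi> \<Longrightarrow> (x, y) \<notin> reachable (below \<xi> (\<xi> {x, y}))"
  by (auto simp: forest_def)

lemma forestI:
  assumes "{x, y} \<in> E" "(x, y) \<notin> reachable (below \<xi> (\<xi> {x, y}))"
  shows "{x, y} \<in> forest \<xi>"
  using assms unfolding forest_def
  by (auto simp: doubleton_eq_iff insert_commute dest: reachable_sym)

text \<open>Cut property: a path of smaller labels between \<open>a\<close> and \<open>b\<close>
  would have to leave \<open>S\<close> through a boundary edge, and none is smaller.\<close>

lemma min_boundary_edge_in_forest:
  assumes "{a, b} \<in> E" "a \<in> S" "b \<notin> S"
    and min: "\<And>c d. {c, d} \<in> E \<Longrightarrow> c \<in> S \<Longrightarrow> d \<notin> S \<Longrightarrow> \<xi> {a, b} \<le> \<xi> {c, d}"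
  shows "{a, b} \<in> forest \<xi>"
proof (rule forestI[OF assms(1)])
  show "(a, b) \<notin> reachable (below \<xi> (\<xi> {a, b}))"
  proof
    assume "(a, b) \<in> reachable (below \<xi> (\<xi> {a, b}))"
    from reachable_exit[OF this assms(2,3)] obtain c d where
      "c \<in> S" "d \<notin> S" "{c, d} \<in> below \<xi> (\<xi> {a, b})" by auto
    then show False using min[of c d] by (auto simp: below_def)
  qed
qed

text \<open>A finite forest part that is not the whole cluster has a boundary edge of label below
  \<open>t\<close>; the cheapest one is a forest edge by the cut property and would extend the
  part.\<close>

lemma cluster_forest_below:
  assumes "finite (cluster (forest \<xi> \<inter> below \<xi> t) x)"
  shows "cluster (forest \<xi> \<inter> below \<xi> t) x = cluster (below \<xi> t) x"
proof (rule ccontr)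
  let ?W = "cluster (forest \<xi> \<inter> below \<xi> t) x"
  assume "?W \<noteq> cluster (below \<xi> t) x"
  moreover have "?W \<subseteq> cluster (below \<xi> t) x" by (intro cluster_mono) auto
  ultimately have "\<not> cluster (below \<xi> t) x \<subseteq> ?W" by blast
  then obtain y where y: "(x, y) \<in> reachable (below \<xi> t)" "y \<notin> ?W"
    unfolding subset_iff by auto
  define B where "B = {e\<in>below \<xi> t. \<exists>a\<in>?W. \<exists>b. b \<notin> ?W \<and> e = {a, b}}"
  have "B \<noteq> {}" using reachable_exit[OF y(1) _ y(2)] unfolding B_def by auto
  moreover have "finite B"
    by (rule finite_subset[OF _ finite_touching[OF assms]]) (auto simp: B_def below_def)
  ultimately obtain e where e: "e \<in> B" "\<And>f. f \<in> B \<Longrightarrow> \<xi> e \<le> \<xi> f"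
    using ex_min_on by metis
  then obtain a b where ab: "a \<in> ?W" "b \<notin> ?W" "e = {a, b}" "e \<in> below \<xi> t"
    unfolding B_def by auto
  have "{a, b} \<in> forest \<xi>"
  proof (rule min_boundary_edge_in_forest[of a b ?W])
    show "\<xi> {a, b} \<le> \<xi> {c, d}" if "{c, d} \<in> E" "c \<in> ?W" "d \<notin> ?W" for c d
    proof (cases "\<xi> {c, d} < t")
      case True
      then have "{c, d} \<in> B" using that unfolding B_def below_def by auto
      then show ?thesis using e ab by auto
    next
      case False
      then show ?thesis using ab by (auto simp: below_def)
    qed
  qed (use ab in \<open>auto simp: below_def\<close>)
  then have "(a, b) \<in> reachable (forest \<xi> \<inter> below \<xi> t)"
    using ab by (intro reachable_edge) auto
  then show False using ab(1,2) reachable_trans by fastforce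
qed

text \<open>An infinite cluster may fall into several forest pieces, but none of them is finite: a
  finite piece would be the whole cluster.\<close>

lemma infinite_cluster_forest_below:
  "infinite (cluster (below \<xi> t) x) \<Longrightarrow> infinite (cluster (forest \<xi> \<inter> below \<xi> t) x)"
  using cluster_forest_below by metis

lemma finite_cluster_forest_below:
  assumes "finite (cluster (below \<xi> t) x)"
  shows "cluster (forest \<xi> \<inter> below \<xi> t) x = cluster (below \<xi> t) x"
  using assms cluster_mono[of "forest \<xi> \<inter> below \<xi> t" "below \<xi> t" x]
  by (intro cluster_forest_below) (auto intro: finite_subset)

text \<open>The heaviest edge of a cycle has its ends joined by the rest of the cycle, hence by
  smaller labels. In place of a cycle, a smallest edge set joining \<open>a\<close> to
  \<open>b\<close> is used together with \<open>{a, b}\<close>.\<close>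

lemma forest_acyclic:
  assumes inj: "inj_on \<xi> E" and e: "{a, b} \<in> forest \<xi>"
  shows "(a, b) \<notin> reachable (forest \<xi> - {{a, b}})"
proof
  assume r: "(a, b) \<in> reachable (forest \<xi> - {{a, b}})"
  define P where "P B \<longleftrightarrow> finite B \<and> B \<subseteq> forest \<xi> - {{a, b}} \<and> (a, b) \<in> reachable B" for B
  obtain B0 where "P B0"
    using reachable_finite_subset[OF r] by (auto simp: P_def)
  then obtain B where B: "P B" "\<And>B'. P B' \<Longrightarrow> card B \<le> card B'"
    using ex_has_least_nat[of P B0 card] by auto
  let ?C = "insert {a, b} B"
  have fin: "finite ?C" using B by (auto simp: P_def)
  obtain m where m: "m \<in> ?C" "\<And>f. f \<in> ?C \<Longrightarrow> \<xi> f \<le> \<xi> m"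
    using ex_max_on[OF fin] by blast
  have sub: "?C \<subseteq> forest \<xi>" using B e by (auto simp: P_def)
  have less: "f \<in> below \<xi> (\<xi> m)" if "f \<in> ?C" "f \<noteq> m" for f
  proof -
    have "f \<in> E" "m \<in> E" using m that sub forest_subset by blast+
    then have "\<xi> f \<noteq> \<xi> m" using that inj unfolding inj_on_def by blast
    then show ?thesis using m(2)[OF that(1)] \<open>f \<in> E\<close> by (simp add: below_def)
  qed
  show False
  proof (cases "m = {a, b}")
    case True
    have "B \<subseteq> below \<xi> (\<xi> {a, b})"
    proof
      fix f assume f: "f \<in> B"
      then have "f \<noteq> m" using B(1) True unfolding P_def by blast
      then show "f \<in> below \<xi> (\<xi> {a, b})" using less f True by blast
    qed
    moreover have "(a, b) \<in> reachable B" using B(1) by (simp add: P_def)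
    ultimately have "(a, b) \<in> reachable (below \<xi> (\<xi> {a, b}))" by (rule reachable_mono[rotated])
    then show False using forestD[OF e] by simp
  next
    case False
    then have mB: "m \<in> B" using m by auto
    then have "m \<in> E" using sub forest_subset by blast
    then obtain c d where cd: "m = {c, d}" by (rule edgeE)
    have "card (B - {m}) < card B"
      using B(1) mB by (intro card_Diff1_less) (auto simp: P_def)
    \<comment> \<open>By minimality every connection in \<open>B\<close> crosses \<open>m\<close>,
      so the ends of \<open>m\<close> are linked to \<open>a\<close> and \<open>b\<close>, and the
      edge \<open>{a, b}\<close> joins them.\<close>
    then have "\<not> P (B - {m})" using B(2)[of "B - {m}"] by auto
    then have nr: "(a, b) \<notin> reachable (B - {m})" using B(1) by (auto simp: P_def)
    have "(a, b) \<in> reachable (insert {c, d} (B - {m}))"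
      using B(1) mB cd by (simp add: P_def insert_absorb)
    from reachable_insert[OF this] nr have
      "((a, c) \<in> reachable (B - {m}) \<and> (d, b) \<in> reachable (B - {m})) \<or>
       ((a, d) \<in> reachable (B - {m}) \<and> (c, b) \<in> reachable (B - {m}))" by simp
    moreover have "B - {m} \<subseteq> ?C - {m}" by auto
    moreover have "(a, b) \<in> reachable (?C - {m})" using False by (intro reachable_edge) auto
    ultimately have "((a, c) \<in> reachable (?C - {m}) \<and> (d, b) \<in> reachable (?C - {m})) \<or>
       ((a, d) \<in> reachable (?C - {m}) \<and> (c, b) \<in> reachable (?C - {m}))"
       "(a, b) \<in> reachable (?C - {m})"
      using reachable_mono[where A = "B - {m}" and B = "?C - {m}"] by blast+
    then have "(c, d) \<in> reachable (?C - {m})"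
      by (elim disjE conjE) (meson reachable_sym reachable_trans)+
    moreover have "?C - {m} \<subseteq> below \<xi> (\<xi> m)" using less by blast
    ultimately have "(c, d) \<in> reachable (below \<xi> (\<xi> m))" by (rule reachable_mono)
    then show False using forestD[of c d \<xi>] mB sub cd by blast
  qed
qed

text \<open>A path of smaller labels between the ends of \<open>e\<close> closes up with
  \<open>e\<close> to a cycle with its maximum at \<open>e\<close>, and going once around such a
  cycle gives a path of smaller labels. Distinct labels make the weak inequalities of
  \<open>FMSF\<close> strict.\<close>

lemma FMSF_eq_forest:
  assumes inj: "inj_on \<xi> E"
  shows "FMSF E \<xi> = forest \<xi>"
proof (intro set_eqI iffI)
  fix e assume e: "e \<in> FMSF E \<xi>"
  then have eE: "e \<in> E" by (auto simp: FMSF_def)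
  then obtain x y where xy: "e = {x, y}" "x \<noteq> y" by (rule edgeE)
  have "(x, y) \<notin> reachable (below \<xi> (\<xi> e))"
  proof
    assume "(x, y) \<in> reachable (below \<xi> (\<xi> e))"
    then obtain ps where ps: "ps \<noteq> []" "hd ps = x" "last ps = y" "distinct ps"
      "\<And>i. Suc i < length ps \<Longrightarrow> {ps ! i, ps ! Suc i} \<in> below \<xi> (\<xi> e)"
      using reachable_distinct_path by metis
    have first: "ps ! 0 = x" and lst: "ps ! (length ps - 1) = y"
      using ps by (auto simp: hd_conv_nth last_conv_nth)
    have "length ps \<noteq> 0" using ps by simp
    moreover have "length ps \<noteq> 1" using first lst xy by auto
    \<comment> \<open>With two vertices the path would be \<open>e\<close> itself, whose label is
      not below its own label.\<close>
    moreover have "length ps \<noteq> 2"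
    proof
      assume "length ps = 2"
      then have "{x, y} \<in> below \<xi> (\<xi> e)" using ps(5)[of 0] first lst by (simp add: numeral_2_eq_2)
      then show False using xy by (auto simp: below_def)
    qed
    ultimately have len: "length ps \<ge> 3" by linarith
    let ?C = "{{ps ! i, ps ! (Suc i mod length ps)} | i. i < length ps}"
    have edge: "{ps ! i, ps ! (Suc i mod length ps)} = e \<or>
        {ps ! i, ps ! (Suc i mod length ps)} \<in> below \<xi> (\<xi> e)" if "i < length ps" for i
    proof (cases "Suc i < length ps")
      case True
      then show ?thesis using ps(5)[of i] by simp
    next
      case False
      then have "Suc i = length ps" using that by simp
      then show ?thesis using first lst xy that
        by (metis diff_Suc_1 insert_commute mod_self)
    qed
    have "is_cycle E ?C"
      unfolding is_cycle_def using edge eE len ps(4) by (auto simp: below_def)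
    moreover have "e \<in> ?C"
    proof -
      have "Suc (length ps - 1) = length ps" using len by linarith
      then have "Suc (length ps - 1) mod length ps = 0" by simp
      then have "e = {ps ! (length ps - 1), ps ! (Suc (length ps - 1) mod length ps)}"
        unfolding first lst xy(1) \<open>Suc (length ps - 1) mod length ps = 0\<close> by (simp add: insert_commute)
      moreover have "length ps - 1 < length ps" using len by linarith
      ultimately show ?thesis by blast
    qed
    moreover have "\<forall>f\<in>?C. \<xi> f \<le> \<xi> e" using edge by (force simp: below_def)
    ultimately have "\<exists>C. is_cycle E C \<and> e \<in> C \<and> (\<forall>f\<in>C. \<xi> f \<le> \<xi> e)" by (intro exI[of _ ?C] conjI)
    then show False using e unfolding FMSF_def by blast
  qed
  then show "e \<in> forest \<xi>" using forestI eE xy by auto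
next
  fix e assume e: "e \<in> forest \<xi>"
  have "\<not> (is_cycle E C \<and> e \<in> C \<and> (\<forall>f\<in>C. \<xi> f \<le> \<xi> e))" for C
  proof
    assume C: "is_cycle E C \<and> e \<in> C \<and> (\<forall>f\<in>C. \<xi> f \<le> \<xi> e)"
    then obtain vs where vs: "length vs \<ge> 3" "distinct vs" "C \<subseteq> E"
      "C = {{vs ! i, vs ! (Suc i mod length vs)} | i. i < length vs}"
      unfolding is_cycle_def by blast
    define n where "n = length vs"
    \<comment> \<open>Indices are read cyclically, so the walk from one end of \<open>e\<close>
      around to the other needs no wrap-around case.\<close>
    define v where "v k = vs ! (k mod n)" for k
    have n: "n \<ge> 3" using vs n_def by simp
    have v_eq: "v i = v j \<longleftrightarrow> i mod n = j mod n" for i j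
    proof -
      have "i mod n < length vs" "j mod n < length vs"
        using n unfolding n_def[symmetric] by auto
      then show ?thesis unfolding v_def using vs(2) by (simp add: nth_eq_iff_index_eq)
    qed
    have vC: "{v k, v (Suc k)} \<in> C" for k
      unfolding vs(4) v_def n_def[symmetric] using n
      by (auto intro!: exI[of _ "k mod n"] simp: mod_Suc_eq)
    obtain i where i: "i < n" "e = {v i, v (Suc i)}"
      using C unfolding vs(4) v_def n_def by auto
    \<comment> \<open>In a cycle of length 2 the next step would return along \<open>e\<close>;
      \<open>3 \<le> n\<close> rules this out.\<close>
    have ne: "{v (Suc i + k), v (Suc i + Suc k)} \<noteq> e" if "Suc k < n" for k
    proof
      assume "{v (Suc i + k), v (Suc i + Suc k)} = e"
      then have "v i = v (Suc i + k) \<or> v i = v (Suc i + Suc k) \<and> v (Suc i) = v (Suc i + k)"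
        unfolding i(2) by (auto simp: doubleton_eq_iff)
      then have "(i + (Suc k)) mod n = (i + 0) mod n \<or>
          ((i + Suc (Suc k)) mod n = (i + 0) mod n \<and> (Suc i + k) mod n = (Suc i + 0) mod n)"
        unfolding v_eq by auto
      then have "n dvd Suc k \<or> (n dvd Suc (Suc k) \<and> n dvd k)"
        by (metis add_diff_cancel_left' diff_add_inverse mod_eq_dvd_iff_nat le_add1 add_0_right)
      then show False
      proof
        assume "n dvd Suc k" then show False using that by (auto dest: dvd_imp_le)
      next
        assume "n dvd Suc (Suc k) \<and> n dvd k"
        then have "n dvd 2" by (metis Suc_1 add_2_eq_Suc dvd_add_left_iff add.commute)
        then show False using n by (auto dest: dvd_imp_le)
      qed
    qed
    have inb: "{v (Suc i + k), v (Suc i + Suc k)} \<in> below \<xi> (\<xi> e)" if "Suc k < n" for k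
    proof -
      let ?f = "{v (Suc i + k), v (Suc i + Suc k)}"
      have f: "?f \<in> C" using vC[of "Suc i + k"] by simp
      have "\<xi> ?f \<noteq> \<xi> e" using inj ne[OF that] f C vs(3) unfolding inj_on_def by blast
      then have "\<xi> ?f < \<xi> e" using C f by (meson le_neq_trans)
      then show ?thesis unfolding below_def using f vs(3) by blast
    qed
    have "k < n \<Longrightarrow> (v (Suc i), v (Suc i + k)) \<in> reachable (below \<xi> (\<xi> e))" for k
    proof (induction k)
      case (Suc k)
      then have "(v (Suc i), v (Suc i + k)) \<in> reachable (below \<xi> (\<xi> e))" by simp
      moreover have "(v (Suc i + k), v (Suc i + Suc k)) \<in> reachable (below \<xi> (\<xi> e))"
        using inb[of k] Suc.prems by (intro reachable_edge) auto
      ultimately show ?case by (rule reachable_trans)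
    qed simp
    from this[of "n - 1"] n have "(v (Suc i), v (i + n)) \<in> reachable (below \<xi> (\<xi> e))" by simp
    moreover have "v (i + n) = v i" by (simp add: v_def)
    ultimately show False using forestD[of "v (Suc i)" "v i" \<xi>] e i by (auto simp: insert_commute)
  qed
  then show "e \<in> FMSF E \<xi>" using e forest_subset by (auto simp: FMSF_def)
qed

text \<open>On a bi-infinite path with its maximum at \<open>e\<close>, the two half-lines starting
  at the ends of \<open>e\<close> use smaller labels only, so \<open>e\<close> is a bridge.\<close>

lemma FMSF_eq_WMSF:
  assumes inj: "inj_on \<xi> E" and "bridges \<xi> = {}"
  shows "FMSF E \<xi> = WMSF E \<xi>"
proof
  show "WMSF E \<xi> \<subseteq> FMSF E \<xi>" unfolding WMSF_def FMSF_def by blast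
  show "FMSF E \<xi> \<subseteq> WMSF E \<xi>"
  proof
    fix e assume e: "e \<in> FMSF E \<xi>"
    show "e \<in> WMSF E \<xi>"
    proof (rule ccontr)
      assume "e \<notin> WMSF E \<xi>"
      then obtain C where C: "is_biinf_path E C" "e \<in> C" "\<forall>f\<in>C. \<xi> f \<le> \<xi> e"
        using e unfolding WMSF_def FMSF_def by blast
      then obtain p :: "int \<Rightarrow> 'a" where p: "inj p" "C = range (\<lambda>i. {p i, p (i + 1)})" "C \<subseteq> E"
        unfolding is_biinf_path_def by blast
      obtain i where i: "e = {p i, p (i + 1)}" using C p by auto
      have inb: "{p j, p (j + 1)} \<in> below \<xi> (\<xi> e)" if "j \<noteq> i" for j
      proof -
        have "{p j, p (j + 1)} \<noteq> e" using that i p(1) by (auto simp: doubleton_eq_iff inj_eq)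
        moreover have jC: "{p j, p (j + 1)} \<in> C" using p by auto
        ultimately have "\<xi> {p j, p (j + 1)} \<noteq> \<xi> e"
          using inj C(2) p(3) unfolding inj_on_def by blast
        moreover have "\<xi> {p j, p (j + 1)} \<le> \<xi> e" using C(3) jC by blast
        ultimately show ?thesis using jC p(3) by (auto simp: below_def)
      qed
      have 1: "(p (i + 1), p (i + 1 + int k)) \<in> reachable (below \<xi> (\<xi> e))" for k
      proof (induction k)
        case (Suc k)
        have "{p (i + 1 + int k), p (i + 1 + int k + 1)} \<in> below \<xi> (\<xi> e)" by (rule inb) simp
        then have "(p (i + 1 + int k), p (i + 1 + int (Suc k))) \<in> reachable (below \<xi> (\<xi> e))"
          by (intro reachable_edge) (simp add: ac_simps)
        with Suc show ?case by (rule reachable_trans)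
      qed simp
      have 2: "(p i, p (i - int k)) \<in> reachable (below \<xi> (\<xi> e))" for k
      proof (induction k)
        case (Suc k)
        have "{p (i - int k - 1), p (i - int k - 1 + 1)} \<in> below \<xi> (\<xi> e)" by (rule inb) simp
        then have "(p (i - int k), p (i - int (Suc k))) \<in> reachable (below \<xi> (\<xi> e))"
          by (intro reachable_edge) (simp add: algebra_simps insert_commute)
        with Suc show ?case by (rule reachable_trans)
      qed simp
      have "infinite (range (\<lambda>k::nat. p (i + 1 + int k)))"
        by (intro range_inj_infinite injI) (auto dest: injD[OF p(1)])
      moreover have "range (\<lambda>k::nat. p (i + 1 + int k)) \<subseteq> cluster (below \<xi> (\<xi> e)) (p (i + 1))"
        using 1 by auto
      ultimately have i1: "infinite (cluster (below \<xi> (\<xi> e)) (p (i + 1)))" using finite_subset by blast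
      have "infinite (range (\<lambda>k::nat. p (i - int k)))"
        by (intro range_inj_infinite injI) (auto dest: injD[OF p(1)])
      moreover have "range (\<lambda>k::nat. p (i - int k)) \<subseteq> cluster (below \<xi> (\<xi> e)) (p i)"
        using 2 by auto
      ultimately have i2: "infinite (cluster (below \<xi> (\<xi> e)) (p i))" using finite_subset by blast
      have "e \<in> forest \<xi>" using e FMSF_eq_forest[OF inj] by simp
      moreover from this have "{p i, p (i + 1)} \<subseteq> V" using forest_subset edge_subset i by blast
      ultimately have "e \<in> bridges \<xi>"
        using i1 i2 unfolding bridges_def inf_verts_def i by auto
      then show False using assms by simp
    qed
  qed
qed

section \<open>Changing one label\<close>

lemma below_upd_subset: "below \<xi> t \<subseteq> insert e (below (\<xi>(e := u)) t)"
  by (auto simp: below_def)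

lemma below_raise: "\<xi> e \<le> u \<Longrightarrow> below (\<xi>(e := u)) t \<subseteq> below \<xi> t"
  by (auto simp: below_def split: if_splits)

lemma forest_raise_mono:
  assumes "\<xi> e \<le> u" "f \<in> forest \<xi>" "f \<noteq> e"
  shows "f \<in> forest (\<xi>(e := u))"
proof -
  have "(x, y) \<notin> reachable (below (\<xi>(e := u)) (\<xi> f))" if "f = {x, y}" for x y
    using assms(2) that reachable_mono[OF _ below_raise[of \<xi> e u "\<xi> f"]] assms(1)
    unfolding forest_def by blast
  then show ?thesis using assms(2,3) by (simp add: forest_def)
qed

lemma inf_verts_raise_mono: "\<xi> e \<le> u \<Longrightarrow> inf_verts (\<xi>(e := u)) t \<subseteq> inf_verts \<xi> t"
  unfolding inf_verts_def using finite_subset[OF cluster_mono[OF below_raise]] by blast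

text \<open>The connection that bypassed \<open>f\<close> before must have used the edge
  \<open>{a, b}\<close>; what remains of it joins the ends of \<open>f\<close> to \<open>a\<close>
  and \<open>b\<close>.\<close>

lemma forest_raise_new:
  assumes "{a, b} \<in> E" and \<xi>': "\<xi>' = \<xi>({a, b} := u)"
    and f: "f \<in> forest \<xi>'" "f \<notin> forest \<xi>" "f \<noteq> {a, b}"
  shows "\<exists>c d. f = {c, d} \<and> (a, c) \<in> reachable (below \<xi>' (\<xi> f)) \<and>
    (d, b) \<in> reachable (below \<xi>' (\<xi> f)) \<and> u \<ge> \<xi> f"
proof -
  have fE: "f \<in> E" using f forest_subset by blast
  then obtain c d where cd: "f = {c, d}" by (rule edgeE)
  have lab: "\<xi>' f = \<xi> f" using f \<xi>' by simp
  let ?B = "below \<xi>' (\<xi> f)"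
  have "(c, d) \<in> reachable (below \<xi> (\<xi> f))"
    using f(2) fE forestI unfolding cd by blast
  then have "(c, d) \<in> reachable (insert {a, b} ?B)"
    unfolding \<xi>' by (rule reachable_mono[OF _ below_upd_subset])
  moreover have n: "(c, d) \<notin> reachable ?B"
    using forestD[of c d \<xi>'] f(1) lab cd by simp
  ultimately have c: "((c, a) \<in> reachable ?B \<and> (b, d) \<in> reachable ?B) \<or>
      ((c, b) \<in> reachable ?B \<and> (a, d) \<in> reachable ?B)"
    using reachable_insert[of c d a b ?B] by blast
  \<comment> \<open>Otherwise the raised edge would still bypass \<open>f\<close>.\<close>
  have "{a, b} \<notin> ?B"
  proof
    assume "{a, b} \<in> ?B"
    then have "(a, b) \<in> reachable ?B" by (rule reachable_edge)
    then have "(c, d) \<in> reachable ?B"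
      using c reachable_trans[OF reachable_trans, of c a ?B b d]
        reachable_trans[OF reachable_trans, of c b ?B a d] reachable_sym[of a b ?B] by blast
    with n show False by simp
  qed
  then have "u \<ge> \<xi> f" using assms(1) \<xi>' by (auto simp: below_def)
  from c have "\<exists>c' d'. {c, d} = {c', d'} \<and> (a, c') \<in> reachable ?B \<and> (d', b) \<in> reachable ?B"
  proof
    assume "(c, a) \<in> reachable ?B \<and> (b, d) \<in> reachable ?B"
    then show ?thesis
      by (intro exI[of _ c] exI[of _ d] conjI refl) (simp_all add: reachable_sym)
  next
    assume "(c, b) \<in> reachable ?B \<and> (a, d) \<in> reachable ?B"
    then show ?thesis
      by (intro exI[of _ d] exI[of _ c] conjI insert_commute) simp_all
  qed
  then show ?thesis using cd \<open>u \<ge> \<xi> f\<close> by simp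
qed

text \<open>The exchange property of minimal spanning trees: \<open>g\<close> is \<open>e\<close>
  itself if no other edge enters, and otherwise the single edge that replaces
  \<open>e\<close>.\<close>

lemma forest_raise:
  assumes e: "e \<in> E" "\<xi> e < u" and \<xi>': "\<xi>' = \<xi>(e := u)"
    and inj: "inj_on \<xi> E" "inj_on \<xi>' E"
  obtains g where "forest \<xi>' - {g} = forest \<xi> - {e}" "g = e \<or> g \<notin> forest \<xi>"
proof -
  obtain a b where ab: "e = {a, b}" using e(1) by (rule edgeE)
  have sub: "forest \<xi> - {e} \<subseteq> forest \<xi>'"
    using forest_raise_mono[of \<xi> e u] e(2) \<xi>' by auto
  show thesis
  proof (cases "e \<in> forest \<xi>'")
    case True
    \<comment> \<open>A new edge \<open>f\<close> would join \<open>a\<close> to \<open>b\<close> by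
      labels below \<open>u\<close>, so \<open>e\<close> could not stay.\<close>
    have "f \<in> forest \<xi>" if f: "f \<in> forest \<xi>'" "f \<noteq> e" for f
    proof (rule ccontr)
      assume "f \<notin> forest \<xi>"
      from forest_raise_new[of a b, OF _ _ f(1) this] obtain c d where
        cd: "f = {c, d}" "(a, c) \<in> reachable (below \<xi>' (\<xi> f))"
        "(d, b) \<in> reachable (below \<xi>' (\<xi> f))" "u \<ge> \<xi> f"
        using e ab \<xi>' f by blast
      have fE: "f \<in> E" using f forest_subset by blast
      have "\<xi>' e = u" "\<xi>' f = \<xi> f" using \<xi>' f by auto
      moreover have "\<xi>' e \<noteq> \<xi>' f" using inj(2) e fE f unfolding inj_on_def by blast
      ultimately have lt: "\<xi>' f < \<xi>' e" "\<xi> f \<le> \<xi>' e" using cd by auto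
      have "(a, c) \<in> reachable (below \<xi>' (\<xi>' e))" "(d, b) \<in> reachable (below \<xi>' (\<xi>' e))"
        using cd reachable_mono[OF _ below_mono[OF lt(2)]] by blast+
      moreover have "(c, d) \<in> reachable (below \<xi>' (\<xi>' e))"
        using lt fE cd(1) by (intro reachable_edge) (auto simp: below_def)
      ultimately have "(a, b) \<in> reachable (below \<xi>' (\<xi>' e))" by (meson reachable_trans)
      then show False using forestD[of a b \<xi>'] True ab by simp
    qed
    then have "forest \<xi>' - {e} = forest \<xi> - {e}" using sub by blast
    then show thesis using that by blast
  next
    case False
    show thesis
    proof (cases "\<exists>f\<in>forest \<xi>'. f \<notin> forest \<xi>")
      case nonew: False
      then have "forest \<xi>' - {e} = forest \<xi> - {e}" using sub by blast
      then show thesis using that by blast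
    next
      case True
      define N where "N = forest \<xi>' - forest \<xi>"
      have Ne: "f \<noteq> e" if "f \<in> N" for f using that False by (auto simp: N_def)
      have lab: "\<xi>' f = \<xi> f" if "f \<in> N" for f using Ne[OF that] \<xi>' by simp
      \<comment> \<open>Of two new edges the heavier one would be bypassed through \<open>a\<close>,
        the lighter one and \<open>b\<close>.\<close>
      have less: False if f: "f1 \<in> N" "f2 \<in> N" "\<xi> f1 < \<xi> f2" for f1 f2
      proof -
        have "f1 \<in> forest \<xi>'" "f1 \<notin> forest \<xi>" "f2 \<in> forest \<xi>'" "f2 \<notin> forest \<xi>"
          using f by (auto simp: N_def)
        with forest_raise_new[of a b \<xi>' \<xi> u f1] forest_raise_new[of a b \<xi>' \<xi> u f2]
          e ab \<xi>' Ne f obtain c d c' d' where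
          1: "f1 = {c, d}" "(a, c) \<in> reachable (below \<xi>' (\<xi> f1))" "(d, b) \<in> reachable (below \<xi>' (\<xi> f1))" and
          2: "f2 = {c', d'}" "(a, c') \<in> reachable (below \<xi>' (\<xi> f2))" "(d', b) \<in> reachable (below \<xi>' (\<xi> f2))"
          by metis
        have 3: "(a, c) \<in> reachable (below \<xi>' (\<xi> f2))" "(d, b) \<in> reachable (below \<xi>' (\<xi> f2))"
          using 1 reachable_mono[OF _ below_mono[of "\<xi> f1" "\<xi> f2"]] f(3) by auto
        have "f1 \<in> E" using \<open>f1 \<in> forest \<xi>'\<close> forest_subset by blast
        then have "(c, d) \<in> reachable (below \<xi>' (\<xi> f2))"
          using lab[OF f(1)] f(3) 1(1) by (intro reachable_edge) (auto simp: below_def)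
        with 2 3 have "(c', d') \<in> reachable (below \<xi>' (\<xi> f2))"
          by (meson reachable_sym reachable_trans)
        then show False
          using forestD[of c' d' \<xi>'] \<open>f2 \<in> forest \<xi>'\<close> lab[OF f(2)] 2(1) by simp
      qed
      obtain f where fN: "f \<in> N" using True by (auto simp: N_def)
      have "N = {f}"
      proof (rule ccontr)
        assume "N \<noteq> {f}"
        then obtain h where h: "h \<in> N" "h \<noteq> f" using fN by auto
        have "h \<in> E" "f \<in> E" using h fN forest_subset by (auto simp: N_def)
        then have "\<xi> h \<noteq> \<xi> f" using inj(1) h unfolding inj_on_def by blast
        then show False using less[of h f] less[of f h] h fN by linarith
      qed
      then have "forest \<xi>' - {f} = forest \<xi> - {e}" using sub False by (auto simp: N_def)
      then show thesis using that fN by (auto simp: N_def)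
    qed
  qed
qed

section \<open>Nearest bridges\<close>

definition adj :: "'a set set \<Rightarrow> ('a \<times> 'a) set" where
  "adj A = {(x, y). {x, y} \<in> A}"

text \<open>All minimisers of the tree distance are kept, since choosing one of them would break the
  equivariance that mass transport needs. The set is empty exactly in trees without bridges.\<close>

definition nearest :: "('a set \<Rightarrow> real) \<Rightarrow> 'a \<Rightarrow> 'a set" where
  "nearest \<xi> v = {y\<in>\<Union> (bridges \<xi>). \<exists>n. (v, y) \<in> adj (forest \<xi>) ^^ n \<and>
     (\<forall>m<n. \<forall>z\<in>\<Union> (bridges \<xi>). (v, z) \<notin> adj (forest \<xi>) ^^ m)}"

definition balanced :: "('a set \<Rightarrow> real) \<Rightarrow> bool" where
  "balanced \<xi> \<longleftrightarrow> \<not> (\<exists>A. finite A \<and> A \<noteq> {} \<and> infinite {v\<in>V. nearest \<xi> v = A})"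

lemma reachable_iff_adj: "(x, y) \<in> reachable A \<longleftrightarrow> (\<exists>n. (x, y) \<in> adj A ^^ n)"
  by (simp add: reachable_def adj_def rtrancl_is_UN_relpow)

lemma finite_adj_ball: "A \<subseteq> E \<Longrightarrow> finite {y. (x, y) \<in> adj A ^^ n}"
proof (induction n)
  case (Suc n)
  have "{y. (x, y) \<in> adj A ^^ Suc n} \<subseteq> (\<Union>z\<in>{y. (x, y) \<in> adj A ^^ n}. {y. {z, y} \<in> E})"
    using Suc.prems by (auto simp: adj_def)
  then show ?case using Suc finite_nbrs by (meson finite_UN finite_subset)
qed simp

lemma nearest_finite_nonempty:
  assumes "\<not> pure \<xi> v"
  shows "finite (nearest \<xi> v)" "nearest \<xi> v \<noteq> {}"
proof -
  define P where "P n \<longleftrightarrow> (\<exists>z\<in>\<Union> (bridges \<xi>). (v, z) \<in> adj (forest \<xi>) ^^ n)" for n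
  obtain z n0 where "z \<in> \<Union> (bridges \<xi>)" "(v, z) \<in> adj (forest \<xi>) ^^ n0"
    using assms unfolding pure_def disjoint_iff in_cluster reachable_iff_adj by blast
  then have "P n0" unfolding P_def by blast
  then obtain k where L: "P k" and min: "\<And>m. m < k \<Longrightarrow> \<not> P m"
    using exists_least_iff[of P] by blast
  have eq: "nearest \<xi> v = {z\<in>\<Union> (bridges \<xi>). (v, z) \<in> adj (forest \<xi>) ^^ k}"
  proof (intro set_eqI iffI)
    fix y assume "y \<in> nearest \<xi> v"
    then obtain n where n: "y \<in> \<Union> (bridges \<xi>)" "(v, y) \<in> adj (forest \<xi>) ^^ n" "\<And>m. m < n \<Longrightarrow> \<not> P m"
      unfolding nearest_def P_def by blast
    have "P n" using n P_def by blast
    then have "n = k" using n(3) L min by (metis linorder_neqE_nat)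
    then show "y \<in> {z\<in>\<Union> (bridges \<xi>). (v, z) \<in> adj (forest \<xi>) ^^ k}"
      using n by simp
  next
    fix y assume "y \<in> {z\<in>\<Union> (bridges \<xi>). (v, z) \<in> adj (forest \<xi>) ^^ k}"
    moreover have "\<forall>m<k. \<forall>z\<in>\<Union> (bridges \<xi>). (v, z) \<notin> adj (forest \<xi>) ^^ m"
      using min unfolding P_def by blast
    ultimately show "y \<in> nearest \<xi> v" unfolding nearest_def by blast
  qed
  show "finite (nearest \<xi> v)"
    unfolding eq by (rule finite_subset[OF _ finite_adj_ball[OF forest_subset]]) auto
  show "nearest \<xi> v \<noteq> {}" using L unfolding eq P_def by blast
qed

lemma nearest_subset: "nearest \<xi> v \<subseteq> cluster (forest \<xi>) v \<inter> \<Union> (bridges \<xi>)"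
  unfolding nearest_def by (auto simp: reachable_iff_adj)

text \<open>Every walk from \<open>P\<close> to a bridge endpoint passes through the gate
  \<open>x\<close>, so distances from \<open>v\<close> to bridge endpoints exceed those from
  \<open>x\<close> by the distance from \<open>v\<close> to \<open>x\<close>, and the minimisers
  agree.\<close>

lemma nearest_gate:
  assumes x: "x \<in> P" and gate: "\<And>a b. a \<in> P \<Longrightarrow> {a, b} \<in> forest \<xi> \<Longrightarrow> b \<in> P \<or> a = x"
    and S: "P \<inter> \<Union> (bridges \<xi>) \<subseteq> {x}"
    and v: "v \<in> P" "(v, x) \<in> reachable (forest \<xi>)"
  shows "nearest \<xi> v = nearest \<xi> x"
proof -
  let ?R = "adj (forest \<xi>)" and ?S = "\<Union> (bridges \<xi>)"
  have thru: "\<exists>i\<le>n. (v, x) \<in> ?R ^^ i \<and> (x, y) \<in> ?R ^^ (n - i)"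
    if "v \<in> P" "y \<in> ?S" "(v, y) \<in> ?R ^^ n" for n v y
    using that
  proof (induction n arbitrary: v)
    case 0
    then show ?case using S by auto
  next
    case (Suc n)
    show ?case
    proof (cases "v = x")
      case True
      then show ?thesis using Suc.prems by (intro exI[of _ 0]) simp
    next
      case False
      obtain w where w: "(v, w) \<in> ?R" "(w, y) \<in> ?R ^^ n"
        using Suc.prems(3) by (meson relpow_Suc_E2)
      then have "w \<in> P" using gate[OF Suc.prems(1)] False by (auto simp: adj_def)
      then obtain i where "i \<le> n" "(w, x) \<in> ?R ^^ i" "(x, y) \<in> ?R ^^ (n - i)"
        using Suc.IH Suc.prems w by blast
      moreover from this have "(v, x) \<in> ?R ^^ Suc i" using w(1) by (intro relpow_Suc_I2)
      ultimately show ?thesis by (intro exI[of _ "Suc i"]) simp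
    qed
  qed
  show ?thesis
  proof (intro set_eqI iffI)
    fix y assume "y \<in> nearest \<xi> v"
    then obtain n where n: "y \<in> ?S" "(v, y) \<in> ?R ^^ n" "\<And>m z. m < n \<Longrightarrow> z \<in> ?S \<Longrightarrow> (v, z) \<notin> ?R ^^ m"
      unfolding nearest_def by blast
    obtain i where i: "i \<le> n" "(v, x) \<in> ?R ^^ i" "(x, y) \<in> ?R ^^ (n - i)"
      using thru[OF v(1) n(1,2)] by blast
    have "(x, z) \<notin> ?R ^^ m" if "m < n - i" "z \<in> ?S" for m z
    proof
      assume "(x, z) \<in> ?R ^^ m"
      then have "(v, z) \<in> ?R ^^ (i + m)" using i(2) by (auto simp: relpow_add)
      then show False using n(3)[of "i + m" z] that less_diff_conv[of m n i] by (simp add: add.commute)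
    qed
    then show "y \<in> nearest \<xi> x" using n(1) i(3) unfolding nearest_def by blast
  next
    fix y assume "y \<in> nearest \<xi> x"
    then obtain m where m: "y \<in> ?S" "(x, y) \<in> ?R ^^ m" "\<And>k z. k < m \<Longrightarrow> z \<in> ?S \<Longrightarrow> (x, z) \<notin> ?R ^^ k"
      unfolding nearest_def by blast
    define i where "i = (LEAST i. (v, x) \<in> ?R ^^ i)"
    have i: "(v, x) \<in> ?R ^^ i" "\<And>j. (v, x) \<in> ?R ^^ j \<Longrightarrow> i \<le> j"
      unfolding i_def using v(2) by (auto simp: reachable_iff_adj intro: LeastI Least_le)
    have "(v, y) \<in> ?R ^^ (i + m)" using i(1) m(2) by (auto simp: relpow_add)
    moreover have "(v, z) \<notin> ?R ^^ k" if "k < i + m" "z \<in> ?S" for k z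
    proof
      assume "(v, z) \<in> ?R ^^ k"
      from thru[OF v(1) that(2) this] obtain j where
        "j \<le> k" "(v, x) \<in> ?R ^^ j" "(x, z) \<in> ?R ^^ (k - j)" by blast
      moreover from this have "k - j < m" using i(2)[of j] that(1) by linarith
      ultimately show False using m(3)[of "k - j" z] that(2) by blast
    qed
    ultimately show "y \<in> nearest \<xi> v" using m(1) unfolding nearest_def by blast
  qed
qed

text \<open>
  Were there a bridge elsewhere in the tree, all vertices of the infinite branch would share their
  nearest bridge endpoints.
\<close>

lemma pure_of_branch:
  assumes bal: "balanced \<xi>" and inj: "inj_on \<xi> E" and p: "p \<in> V"
    and inf: "infinite (cluster (forest \<xi> - {g}) p)"
    and none: "\<And>h. h \<in> bridges \<xi> \<Longrightarrow> h \<noteq> g \<Longrightarrow> h \<inter> cluster (forest \<xi> - {g}) p = {}"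
  shows "pure \<xi> p"
proof (rule ccontr)
  assume imp: "\<not> pure \<xi> p"
  let ?P = "cluster (forest \<xi> - {g}) p"
  have PV: "?P \<subseteq> V" using p by (intro cluster_subset_V) (use forest_subset in auto)
  have step: "b \<in> ?P" if "a \<in> ?P" "{a, b} \<in> forest \<xi>" "{a, b} \<noteq> g" for a b
  proof -
    have "(a, b) \<in> reachable (forest \<xi> - {g})" using that by (intro reachable_edge) auto
    then show ?thesis using that(1) by (auto intro: reachable_trans)
  qed
  have conn: "(v, w) \<in> reachable (forest \<xi>)" if "v \<in> ?P" "w \<in> ?P" for v w
  proof -
    have "(v, w) \<in> reachable (forest \<xi> - {g})" using that by (auto intro: reachable_trans reachable_sym)
    then show ?thesis by (rule reachable_mono) auto
  qed
  \<comment> \<open>The gate is the end of \<open>g\<close> inside the branch, or \<open>p\<close>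
    if no forest edge leaves the branch.\<close>
  have "\<exists>x\<in>?P. (\<forall>a b. a \<in> ?P \<longrightarrow> {a, b} \<in> forest \<xi> \<longrightarrow> b \<in> ?P \<or> a = x) \<and> ?P \<inter> \<Union> (bridges \<xi>) \<subseteq> {x}"
  proof (cases "g \<in> forest \<xi> \<and> g \<inter> ?P \<noteq> {}")
    case False
    then have "b \<in> ?P" if "a \<in> ?P" "{a, b} \<in> forest \<xi>" for a b
      using step[OF that] that by blast
    moreover have "?P \<inter> \<Union> (bridges \<xi>) \<subseteq> {p}"
      using none False bridges_subset by blast
    ultimately show ?thesis by (intro bexI[of _ p]) auto
  next
    case True
    then have "g \<in> E" using forest_subset by blast
    then obtain c d where cd: "g = {c, d}" by (rule edgeE)
    have "\<exists>x y. g = {x, y} \<and> x \<in> ?P"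
    proof (cases "c \<in> ?P")
      case F: False
      then have "d \<in> ?P" using True cd by blast
      then show ?thesis using cd insert_commute by blast
    qed (use cd in blast)
    then obtain x y where xy: "g = {x, y}" "x \<in> ?P" by blast
    have "y \<notin> ?P"
    proof
      assume "y \<in> ?P"
      then have "(x, y) \<in> reachable (forest \<xi> - {g})"
        using xy by (auto intro: reachable_trans reachable_sym)
      then show False using forest_acyclic[OF inj, of x y] True xy by simp
    qed
    have "b \<in> ?P \<or> a = x" if "a \<in> ?P" "{a, b} \<in> forest \<xi>" for a b
      using step[OF that] xy \<open>y \<notin> ?P\<close> that by (auto simp: doubleton_eq_iff)
    moreover have "?P \<inter> \<Union> (bridges \<xi>) \<subseteq> {x}"
      using none xy \<open>y \<notin> ?P\<close> by blast
    ultimately show ?thesis using xy by blast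
  qed
  then obtain x where x: "x \<in> ?P" "\<And>a b. a \<in> ?P \<Longrightarrow> {a, b} \<in> forest \<xi> \<Longrightarrow> b \<in> ?P \<or> a = x"
    "?P \<inter> \<Union> (bridges \<xi>) \<subseteq> {x}" by blast
  have "nearest \<xi> v = nearest \<xi> x" if "v \<in> ?P" for v
    using nearest_gate[OF x that conn[OF that x(1)]] .
  then have "?P \<subseteq> {v\<in>V. nearest \<xi> v = nearest \<xi> x}" using PV by blast
  then have "infinite {v\<in>V. nearest \<xi> v = nearest \<xi> x}" using inf finite_subset by blast
  moreover have "\<not> pure \<xi> x"
    using imp cluster_eq[OF conn[OF _ x(1)], of p] unfolding pure_def by simp
  ultimately show False
    using bal nearest_finite_nonempty[of \<xi> x] unfolding balanced_def by blast
qed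

text \<open>With finitely many bridges in an infinite tree, the nearest sets take finitely many
  values, so one of them is shared by infinitely many vertices, which \<open>balanced\<close>
  forbids.\<close>

lemma infinite_bridges:
  assumes bal: "balanced \<xi>" and v: "v \<in> V" and imp: "\<not> pure \<xi> v"
  shows "infinite {h\<in>bridges \<xi>. h \<subseteq> cluster (forest \<xi>) v}"
proof
  let ?T = "cluster (forest \<xi>) v"
  assume fin: "finite {h\<in>bridges \<xi>. h \<subseteq> ?T}"
  let ?S = "\<Union> {h\<in>bridges \<xi>. h \<subseteq> ?T}"
  have finS: "finite ?S"
    using fin finite_edge forest_subset bridges_subset by (intro finite_Union) blast+
  have sub: "?T \<inter> \<Union> (bridges \<xi>) \<subseteq> ?S"
  proof
    fix x assume "x \<in> ?T \<inter> \<Union> (bridges \<xi>)"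
    then obtain h where h: "x \<in> ?T" "h \<in> bridges \<xi>" "x \<in> h" by blast
    have hF: "h \<in> forest \<xi>" using h bridges_subset by blast
    then have "h \<in> E" using forest_subset by blast
    then obtain c d where "h = {c, d}" by (rule edgeE)
    then have "h \<subseteq> ?T" using h hF reachable_edge[of c d "forest \<xi>"] reachable_edge[of d c "forest \<xi>"]
      by (auto intro: reachable_trans simp: insert_commute)
    then show "x \<in> ?S" using h by blast
  qed
  \<comment> \<open>The tree is infinite: a bridge endpoint lies in an infinite cluster of smaller
    labels, whose forest part stays in the tree.\<close>
  obtain x h where x: "x \<in> ?T" "h \<in> bridges \<xi>" "x \<in> h" using imp unfolding pure_def by blast
  then have "infinite (cluster (below \<xi> (\<xi> h)) x)" unfolding bridges_def inf_verts_def by blast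
  then have "infinite (cluster (forest \<xi> \<inter> below \<xi> (\<xi> h)) x)" by (rule infinite_cluster_forest_below)
  moreover have "cluster (forest \<xi> \<inter> below \<xi> (\<xi> h)) x \<subseteq> cluster (forest \<xi>) x"
    by (intro cluster_mono) auto
  moreover have "cluster (forest \<xi>) x = ?T" using x by (intro cluster_eq) auto
  ultimately have infT: "infinite ?T" using finite_subset by metis
  have imp': "\<not> pure \<xi> w" if "w \<in> ?T" for w
    using imp cluster_eq[of v w "forest \<xi>"] that unfolding pure_def by simp
  have near: "nearest \<xi> ` ?T \<subseteq> Pow ?S"
  proof (intro image_subsetI PowI)
    fix w assume w: "w \<in> ?T"
    then have "cluster (forest \<xi>) w = ?T" by (intro cluster_eq) auto
    then show "nearest \<xi> w \<subseteq> ?S" using nearest_subset[of \<xi> w] sub by (metis subset_trans)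
  qed
  then have "finite (nearest \<xi> ` ?T)" using finS by (meson finite_Pow_iff finite_subset)
  from pigeonhole_infinite[OF infT this] obtain w where
    w: "w \<in> ?T" "infinite {a\<in>?T. nearest \<xi> a = nearest \<xi> w}" by blast
  have "?T \<subseteq> V" using v by (intro cluster_subset_V forest_subset)
  then have "{a\<in>?T. nearest \<xi> a = nearest \<xi> w} \<subseteq> {a\<in>V. nearest \<xi> a = nearest \<xi> w}" by blast
  then have "infinite {a\<in>V. nearest \<xi> a = nearest \<xi> w}" using w finite_subset by blast
  then show False
    using bal nearest_finite_nonempty[OF imp'[OF w(1)]] unfolding balanced_def by blast
qed

section \<open>Persistence of bridge-free trees\<close>

text \<open>Raising shrinks infinite clusters and lets at most the edge \<open>g\<close> enter the
  forest, so every bridge at the branch other than \<open>g\<close> was a bridge before. Bridges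
  elsewhere in the new tree are excluded by \<open>pure_of_branch\<close>.\<close>

lemma raise_pure:
  assumes e: "e \<in> E" "\<xi> e < u" and \<xi>': "\<xi>' = \<xi>(e := u)"
    and inj: "inj_on \<xi> E" "inj_on \<xi>' E" and bal: "balanced \<xi>'" and p: "p \<in> V"
    and inf: "infinite (cluster (forest \<xi> - {e}) p)" and pure: "pure \<xi> p"
  shows "pure \<xi>' p"
proof -
  obtain g where g: "forest \<xi>' - {g} = forest \<xi> - {e}"
    by (rule forest_raise[OF e \<xi>' inj])
  show ?thesis
  proof (rule pure_of_branch[OF bal inj(2) p, of g])
    show "infinite (cluster (forest \<xi>' - {g}) p)" using inf g by simp
    fix h assume h: "h \<in> bridges \<xi>'" "h \<noteq> g"
    then have hF: "h \<in> forest \<xi>" "h \<noteq> e" using g bridges_subset by blast+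
    have "inf_verts \<xi>' (\<xi> h) \<subseteq> inf_verts \<xi> (\<xi> h)"
      unfolding \<xi>' using e(2) by (intro inf_verts_raise_mono) simp
    then have "h \<in> bridges \<xi>" using h(1) hF unfolding bridges_def \<xi>' by auto
    moreover have "cluster (forest \<xi> - {e}) p \<subseteq> cluster (forest \<xi>) p" by (intro cluster_mono) auto
    ultimately show "h \<inter> cluster (forest \<xi>' - {g}) p = {}"
      using pure g unfolding pure_def by auto
  qed
qed

text \<open>Lowering can make clusters infinite and so create bridges. A finite cluster at an end of
  a forest edge \<open>h\<close> of the branch becomes infinite only by being joined to
  \<open>x\<close> through \<open>{x, y}\<close>, so it contains \<open>y\<close>; following it to
  \<open>y\<close> would close a cycle with \<open>{x, y}\<close> in the new forest.\<close>

lemma lower_pure: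
  assumes xy: "{x, y} \<in> E" and lev: "s' < u" "u < s"
    and disc: "(x, y) \<notin> reachable (below \<xi> s)"
    and x: "x \<in> inf_verts \<xi> s'" and pure: "pure \<xi> x"
    and \<xi>': "\<xi>' = \<xi>({x, y} := u)"
    and inj: "inj_on \<xi> E" "inj_on \<xi>' E" and bal: "balanced \<xi>'"
  shows "{x, y} \<in> forest \<xi>'" "pure \<xi>' x"
proof -
  let ?g = "{x, y}"
  have g_s: "\<xi> ?g \<ge> s"
  proof (rule ccontr)
    assume "\<not> \<xi> ?g \<ge> s"
    then have "(x, y) \<in> reachable (below \<xi> s)"
      using xy by (intro reachable_edge) (auto simp: below_def)
    then show False using disc by simp
  qed
  \<comment> \<open>Lowering is undone by raising, so the exchange lemma applies from
    \<open>\<xi>'\<close> to \<open>\<xi>\<close>.\<close>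
  have undo: "\<xi> = \<xi>'(?g := \<xi> ?g)" unfolding \<xi>' by simp
  have "\<xi>' ?g < \<xi> ?g" using g_s lev \<xi>' by simp
  then obtain f where f: "forest \<xi> - {f} = forest \<xi>' - {?g}"
    by (rule forest_raise[OF xy _ undo inj(2,1)])
  have below_eq: "below \<xi>' t = below \<xi> t" if "t \<le> u" for t
    using that g_s lev \<xi>' by (auto simp: below_def)
  have below_ins: "below \<xi>' t \<subseteq> insert ?g (below \<xi> t)" for t
    unfolding \<xi>' by (auto simp: below_def split: if_splits)
  have "(x, y) \<notin> reachable (below \<xi>' u)"
    using disc reachable_mono[of x y "below \<xi> u" "below \<xi> s"] below_mono[of u s \<xi>] lev
      below_eq[of u] by auto
  then have gF: "?g \<in> forest \<xi>'" using xy \<xi>' by (intro forestI) auto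
  then show "?g \<in> forest \<xi>'" .
  show "pure \<xi>' x"
  proof (rule pure_of_branch[OF bal inj(2), of x ?g])
    show xV: "x \<in> V" using x inf_verts_subset by blast
    let ?P = "cluster (forest \<xi>' - {?g}) x"
    have "infinite (cluster (below \<xi>' s') x)"
      using x below_eq[of s'] lev by (simp add: inf_verts_def)
    then have "infinite (cluster (forest \<xi>' \<inter> below \<xi>' s') x)" by (rule infinite_cluster_forest_below)
    moreover have "?g \<notin> below \<xi>' s'" using lev \<xi>' by (auto simp: below_def)
    then have "cluster (forest \<xi>' \<inter> below \<xi>' s') x \<subseteq> ?P" by (intro cluster_mono) auto
    ultimately show "infinite ?P" using finite_subset by blast
    fix h assume h: "h \<in> bridges \<xi>'" "h \<noteq> ?g"
    show "h \<inter> ?P = {}"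
    proof (rule ccontr)
      assume "h \<inter> ?P \<noteq> {}"
      then obtain z where z: "z \<in> h" "z \<in> ?P" by blast
      have hF: "h \<in> forest \<xi>' - {?g}" "h \<in> forest \<xi>" "h \<in> E"
        using h bridges_subset f forest_subset by blast+
      define t where "t = \<xi> h"
      have t: "\<xi>' h = t" using h \<xi>' t_def by simp
      have "?P \<subseteq> cluster (forest \<xi>) x" using f by (intro cluster_mono) auto
      then have "h \<notin> bridges \<xi>" using z pure unfolding pure_def by blast
      \<comment> \<open>\<open>h\<close> was in the forest but not a bridge, so one of its ends had
        a finite cluster at level \<open>t\<close>.\<close>
      then obtain c where c: "c \<in> h" "c \<notin> inf_verts \<xi> t" using hF(2) t_def unfolding bridges_def by blast
      have c': "c \<in> inf_verts \<xi>' t" using c(1) h(1) t unfolding bridges_def by auto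
      then have cV: "c \<in> V" using inf_verts_subset by blast
      let ?W = "cluster (below \<xi> t) c"
      have finW: "finite ?W" using c(2) cV by (simp add: inf_verts_def)
      have "t > u"
      proof (rule ccontr)
        assume "\<not> t > u"
        then show False using below_eq[of t] c(2) c' by (simp add: inf_verts_def)
      qed
      have xW: "x \<notin> ?W"
      proof
        assume "x \<in> ?W"
        moreover have "x \<in> inf_verts \<xi> t" using x inf_verts_mono[of s' t \<xi>] lev \<open>t > u\<close> by auto
        ultimately show False using c(2) inf_verts_reachable reachable_sym by (metis in_cluster)
      qed
      \<comment> \<open>Without \<open>y\<close> the finite cluster \<open>?W\<close> would not
        touch the lowered edge and could not grow.\<close>
      have yW: "y \<in> ?W"
      proof (rule ccontr)
        assume yW: "y \<notin> ?W"
        have "cluster (below \<xi>' t) c \<subseteq> ?W"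
        proof (rule cluster_subset)
          fix a b assume a: "a \<in> ?W" "{a, b} \<in> below \<xi>' t"
          then have "{a, b} \<noteq> ?g" using xW yW by (auto simp: doubleton_eq_iff)
          then have "{a, b} \<in> below \<xi> t" using a below_ins[of t] by auto
          then show "b \<in> ?W" using a(1) reachable_trans[OF _ reachable_edge] by (metis in_cluster)
        qed simp
        then show False using finW c' finite_subset by (auto simp: inf_verts_def)
      qed
      have "(c, y) \<in> reachable (forest \<xi> \<inter> below \<xi> t)"
        using finite_cluster_forest_below[OF finW] yW by auto
      then have "(c, y) \<in> reachable {e \<in> forest \<xi> \<inter> below \<xi> t. e \<subseteq> cluster (forest \<xi> \<inter> below \<xi> t) c}"
        by (rule reachable_within)
      moreover have "e \<in> forest \<xi>' - {?g}"
        if e: "e \<in> forest \<xi> \<inter> below \<xi> t" "e \<subseteq> cluster (forest \<xi> \<inter> below \<xi> t) c" for e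
      proof -
        have eW: "e \<subseteq> ?W" using e(2) finite_cluster_forest_below[OF finW] by simp
        then have eg: "e \<noteq> ?g" using xW by auto
        have "e \<in> E" using e forest_subset by blast
        then obtain a b where ab: "e = {a, b}" by (rule edgeE)
        \<comment> \<open>A forest edge inside \<open>?W\<close> could only be bypassed through
          \<open>x\<close>, and \<open>x\<close> is not in \<open>?W\<close>.\<close>
        have "e \<in> forest \<xi>'"
        proof (rule ccontr)
          assume "e \<notin> forest \<xi>'"
          then have "(a, b) \<in> reachable (below \<xi>' (\<xi> e))"
            using forestI[of a b \<xi>'] \<open>e \<in> E\<close> ab eg \<xi>' by auto
          then have "(a, b) \<in> reachable (insert {x, y} (below \<xi> (\<xi> e)))"
            by (rule reachable_mono[OF _ below_ins])
          from reachable_insert[OF this] have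
            "(a, b) \<in> reachable (below \<xi> (\<xi> e)) \<or> (a, x) \<in> reachable (below \<xi> (\<xi> e)) \<or>
             (x, b) \<in> reachable (below \<xi> (\<xi> e))" by blast
          moreover have "(a, b) \<notin> reachable (below \<xi> (\<xi> e))" using forestD e(1) ab by blast
          moreover have "\<xi> e \<le> t" using e(1) by (auto simp: below_def)
          ultimately have "(a, x) \<in> reachable (below \<xi> t) \<or> (x, b) \<in> reachable (below \<xi> t)"
            using reachable_mono[OF _ below_mono] by blast
          moreover have "a \<in> ?W" "b \<in> ?W" using eW ab by auto
          ultimately have "x \<in> ?W" by (metis in_cluster reachable_sym reachable_trans)
          then show False using xW by simp
        qed
        then show ?thesis using eg by simp
      qed
      then have "{e \<in> forest \<xi> \<inter> below \<xi> t. e \<subseteq> cluster (forest \<xi> \<inter> below \<xi> t) c} \<subseteq> forest \<xi>' - {?g}"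
        by blast
      ultimately have cy: "(c, y) \<in> reachable (forest \<xi>' - {?g})" by (rule reachable_mono)
      have "(z, c) \<in> reachable (forest \<xi>' - {?g})"
      proof (cases "z = c")
        case False
        then have "h = {z, c}" using z(1) c(1) hF(3) by (elim edgeE) auto
        then show ?thesis using hF by (intro reachable_edge) auto
      qed simp
      then have "(x, y) \<in> reachable (forest \<xi>' - {?g})"
        using z(2) cy by (metis in_cluster reachable_trans)
      then show False using forest_acyclic[OF inj(2) gF] by simp
    qed
  qed
qed

end

text \<open>\<open>Q\<close> stands for an almost sure event closed under resampling of one label.
  Asking only for one good label in each subinterval turns the surgery into reasoning about single
  configurations.\<close>

locale resampling = lf_graph +
  fixes Q :: "('a set \<Rightarrow> real) \<Rightarrow> bool"
  assumes Q_inj: "Q \<xi> \<Longrightarrow> inj_on \<xi> E"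
    and Q_balanced: "Q \<xi> \<Longrightarrow> balanced \<xi>"
    and Q_resample: "Q \<xi> \<Longrightarrow> e \<in> E \<Longrightarrow> 0 \<le> a \<Longrightarrow> a < b \<Longrightarrow> b \<le> 1 \<Longrightarrow> \<exists>u. a < u \<and> u < b \<and> Q (\<xi>(e := u))"
begin

text \<open>
  If a bridge-free tree could be linked to another infinite cluster of the same level, lowering the
  labels along a path through otherwise isolated vertices would attach one bridge to it.
\<close>

lemma no_link:
  assumes "Q \<xi>" "x \<in> inf_verts \<xi> s'" "pure \<xi> x" "0 \<le> s'" "s' < s" "s \<le> 1"
    "qs \<noteq> []" "distinct (x # qs)" "successively (\<lambda>a b. {a, b} \<in> E) (x # qs)"
    "\<And>q. q \<in> set qs \<Longrightarrow> (x, q) \<notin> reachable (below \<xi> s)"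
    "\<And>q b. q \<in> set (butlast qs) \<Longrightarrow> {q, b} \<notin> below \<xi> s"
    "last qs \<in> inf_verts \<xi> s'"
  shows False
  using assms
proof (induction qs arbitrary: \<xi> x s')
  case (Cons y ys)
  have xy: "{x, y} \<in> E" using Cons.prems(9) by simp
  \<comment> \<open>The level \<open>s'\<close> rises along the induction while \<open>s\<close>
    stays fixed, so \<open>u\<close> lies above all labels lowered before and below
    \<open>s\<close>.\<close>
  obtain u where u: "s' < u" "u < s" "Q (\<xi>({x, y} := u))"
    using Q_resample[OF Cons.prems(1) xy, of s' s] Cons.prems by auto
  define \<xi>' where "\<xi>' = \<xi>({x, y} := u)"
  have Q': "Q \<xi>'" using u \<xi>'_def by simp
  have disc: "(x, y) \<notin> reachable (below \<xi> s)" using Cons.prems(10) by simp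
  note L = lower_pure[OF xy u(1,2) disc Cons.prems(2,3) \<xi>'_def Q_inj[OF Cons.prems(1)] Q_inj[OF Q'] Q_balanced[OF Q']]
  have g_s: "\<xi> {x, y} \<ge> s"
  proof (rule ccontr)
    assume "\<not> \<xi> {x, y} \<ge> s"
    then have "(x, y) \<in> reachable (below \<xi> s)"
      using xy by (intro reachable_edge) (auto simp: below_def)
    then show False using disc by simp
  qed
  have sub: "below \<xi> s' \<subseteq> below \<xi>' t" if "t \<ge> s'" for t
    using that g_s Cons.prems(5) unfolding \<xi>'_def by (auto simp: below_def)
  have inf': "inf_verts \<xi> s' \<subseteq> inf_verts \<xi>' t" if "t \<ge> s'" for t
    unfolding inf_verts_def using finite_subset[OF cluster_mono[OF sub[OF that]]] by blast
  show False
  proof (cases "ys = []")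
    case True
    \<comment> \<open>At the last step both ends lie in infinite clusters below \<open>u\<close>, so
      the lowered edge is a bridge in a tree without bridges.\<close>
    then have "y \<in> inf_verts \<xi>' u" "x \<in> inf_verts \<xi>' u" using Cons.prems inf'[of u] u(1) by auto
    then have "{x, y} \<in> bridges \<xi>'" using L(1) by (simp add: bridges_def \<xi>'_def)
    moreover have "x \<in> cluster (forest \<xi>') x" by simp
    ultimately show False using L(2) unfolding pure_def by blast
  next
    case False
    \<comment> \<open>Any level strictly between \<open>u\<close> and \<open>s\<close> serves: the
      lowered edge must lie below it, and room below \<open>s\<close> must remain.\<close>
    define s'' where "s'' = (u + s) / 2"
    have s'': "u < s''" "s'' < s" using u s''_def by auto
    have edge: "{x, y} \<in> below \<xi>' s''" using xy s'' by (simp add: below_def \<xi>'_def)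
    have sub_s: "below \<xi>' s \<subseteq> insert {x, y} (below \<xi> s)" by (auto simp: below_def \<xi>'_def split: if_splits)
    have iso: "{y, b} \<notin> below \<xi> s" for b using Cons.prems(11) False by simp
    \<comment> \<open>\<open>y\<close> was isolated at level \<open>s\<close>, so its new cluster
      adds only the cluster of \<open>x\<close>, and the remaining path stays separate from
      it.\<close>
    have cl: "cluster (below \<xi>' s) y \<subseteq> insert y (cluster (below \<xi> s) x)"
    proof (rule cluster_subset)
      fix a b assume a: "a \<in> insert y (cluster (below \<xi> s) x)" "{a, b} \<in> below \<xi>' s"
      then consider "{a, b} = {x, y}" | "{a, b} \<in> below \<xi> s" using sub_s by blast
      then show "b \<in> insert y (cluster (below \<xi> s) x)"
      proof cases
        case 1
        then show ?thesis by (auto simp: doubleton_eq_iff)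
      next
        case 2
        then have "a \<noteq> y" using iso by blast
        then show ?thesis using a(1) reachable_trans[OF _ reachable_edge[OF 2]] by simp
      qed
    qed simp
    show False
    proof (rule Cons.IH[OF Q', of y s''])
      have "x \<in> inf_verts \<xi>' s''" using inf'[of s''] Cons.prems(2) u s'' by auto
      then show "y \<in> inf_verts \<xi>' s''" by (rule inf_verts_reachable[OF _ reachable_edge[OF edge]])
      have "cluster (forest \<xi>') y = cluster (forest \<xi>') x" using L(1) by (intro cluster_eq reachable_edge)
      then show "pure \<xi>' y" using L(2) by (simp add: pure_def)
      show "0 \<le> s''" "s'' < s" "s \<le> 1" using s'' u Cons.prems by auto
      show "ys \<noteq> []" by fact
      show "distinct (y # ys)" "successively (\<lambda>a b. {a, b} \<in> E) (y # ys)"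
        using Cons.prems(8,9) by auto
      show "(y, q) \<notin> reachable (below \<xi>' s)" if q: "q \<in> set ys" for q
        using cl q Cons.prems(8) Cons.prems(10)[of q] by auto
      show "{q, b} \<notin> below \<xi>' s" if q: "q \<in> set (butlast ys)" for q b
      proof -
        have "q \<in> set ys" using q by (rule in_set_butlastD)
        then have "{q, b} \<noteq> {x, y}" using Cons.prems(8) by (auto simp: doubleton_eq_iff)
        moreover have "{q, b} \<notin> below \<xi> s" using Cons.prems(11) q False by simp
        ultimately show ?thesis using sub_s by blast
      qed
      show "last ys \<in> inf_verts \<xi>' s''" using Cons.prems(12) False inf'[of s''] u s'' by auto
    qed
  qed
qed simp

text \<open>\<open>A\<close> is a part of the forest that no raise touches; its infinite cluster at
  \<open>p\<close> provides the infinite branch which \<open>raise_pure\<close> asks for at every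
  step.\<close>

lemma raise_many:
  assumes "finite D" "D \<subseteq> E" "Q \<xi>" "A \<subseteq> forest \<xi>" "A \<inter> D = {}" "p \<in> V" "infinite (cluster A p)" "pure \<xi> p"
    and "\<And>e. e \<in> D \<Longrightarrow> \<xi> e < s" "0 \<le> s" "s < 1"
  shows "\<exists>\<xi>'. Q \<xi>' \<and> pure \<xi>' p \<and> A \<subseteq> forest \<xi>' \<and> (\<forall>e. e \<notin> D \<longrightarrow> \<xi>' e = \<xi> e) \<and> (\<forall>e\<in>D. \<xi>' e > s)"
  using assms
proof (induction D rule: finite_induct)
  case empty
  then show ?case by blast
next
  case (insert e D)
  then obtain \<xi>1 where 1: "Q \<xi>1" "pure \<xi>1 p" "A \<subseteq> forest \<xi>1" "\<And>e. e \<notin> D \<Longrightarrow> \<xi>1 e = \<xi> e"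
    "\<And>e. e \<in> D \<Longrightarrow> \<xi>1 e > s" by auto
  obtain u where u: "s < u" "u < 1" "Q (\<xi>1(e := u))"
    using Q_resample[OF 1(1), of e s 1] insert.prems by auto
  have lt: "\<xi>1 e < u" using 1(4)[of e] insert.hyps insert.prems(8)[of e] u by simp
  have "cluster A p \<subseteq> cluster (forest \<xi>1 - {e}) p" using 1(3) insert.prems by (intro cluster_mono) auto
  then have "infinite (cluster (forest \<xi>1 - {e}) p)" using insert.prems finite_subset by blast
  then have "pure (\<xi>1(e := u)) p"
    using raise_pure[OF _ lt refl Q_inj[OF 1(1)] Q_inj[OF u(3)] Q_balanced[OF u(3)] _ _ 1(2)]
      insert.prems(1,5) by blast
  moreover have "A \<subseteq> forest (\<xi>1(e := u))"
    using 1(3) insert.prems lt by (auto intro!: forest_raise_mono)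
  moreover have "\<forall>f. f \<notin> insert e D \<longrightarrow> (\<xi>1(e := u)) f = \<xi> f" "\<forall>f\<in>insert e D. (\<xi>1(e := u)) f > s"
    using 1(4,5) u(1) by auto
  ultimately show ?case using u(3) by blast
qed

lemma connected_finite_set:
  assumes "(v, z) \<in> reachable E"
  shows "\<exists>Y. finite Y \<and> v \<in> Y \<and> z \<in> Y \<and> (\<forall>y\<in>Y. (v, y) \<in> reachable {e\<in>E. e \<subseteq> Y})"
  using assms unfolding reachable_def
proof (induction rule: rtrancl_induct)
  case base
  then show ?case by (intro exI[of _ "{v}"]) auto
next
  case (step y z)
  then obtain Y where Y: "finite Y" "v \<in> Y" "y \<in> Y" "\<And>y. y \<in> Y \<Longrightarrow> (v, y) \<in> reachable {e\<in>E. e \<subseteq> Y}"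
    by (auto simp: reachable_def)
  let ?Y = "insert z Y"
  have old: "(v, w) \<in> reachable {e\<in>E. e \<subseteq> ?Y}" if "w \<in> Y" for w
    using Y(4)[OF that] by (rule reachable_mono) auto
  have "(y, z) \<in> reachable {e\<in>E. e \<subseteq> ?Y}" using step(2) Y(3) by (intro reachable_edge) auto
  then have "(v, z) \<in> reachable {e\<in>E. e \<subseteq> ?Y}" by (rule reachable_trans[OF old[OF Y(3)]])
  with old show ?case using Y(1,2) unfolding reachable_def[symmetric]
    by (intro exI[of _ ?Y]) auto
qed

text \<open>Just outside the closed set \<open>Y\<close> there are points \<open>x0\<close> in the
  tree of \<open>v\<close> and \<open>z0\<close> whose infinite clusters survive the closing. A path
  from \<open>x0\<close> to \<open>z0\<close> then runs through isolated points of \<open>Y\<close>,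
  which is the situation of \<open>no_link\<close>.\<close>

lemma no_separate_pure:
  assumes Q: "Q \<xi>" and v: "v \<in> inf_verts \<xi> s'" "pure \<xi> v" and z: "z \<in> inf_verts \<xi> s'"
    and disc: "(v, z) \<notin> reachable (below \<xi> s)" and lev: "0 \<le> s'" "s' < s" "s < 1"
  shows False
proof -
  have VV: "v \<in> V" "z \<in> V" using v z inf_verts_subset by blast+
  obtain Y where Y: "finite Y" "v \<in> Y" "z \<in> Y" "\<And>y. y \<in> Y \<Longrightarrow> (v, y) \<in> reachable {e\<in>E. e \<subseteq> Y}"
    using connected_finite_set[OF reachable_V[OF VV]] by blast
  \<comment> \<open>Only the edges of label below \<open>s\<close> have to be raised; the others at
    \<open>Y\<close> are closed already.\<close>
  define D where "D = {e\<in>E. e \<inter> Y \<noteq> {} \<and> \<xi> e < s}"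
  have finD: "finite D" using finite_touching[OF Y(1)] by (rule finite_subset[rotated]) (auto simp: D_def)
  let ?A = "forest \<xi> \<inter> below \<xi> s'"
  have "infinite (cluster ?A v)"
    using v(1) by (intro infinite_cluster_forest_below) (simp add: inf_verts_def)
  with infinite_cluster_avoiding[OF _ Y(1,2), of ?A] forest_subset obtain y1 x0 where
    x0: "y1 \<in> Y" "x0 \<notin> Y" "{y1, x0} \<in> ?A" "(v, x0) \<in> reachable ?A" "infinite (cluster (avoiding ?A Y) x0)"
    by (metis inf.coboundedI1)
  have "infinite (cluster (below \<xi> s') z)" using z by (simp add: inf_verts_def)
  with infinite_cluster_avoiding[OF below_subset Y(1,3)] obtain y2 z0 where
    z0: "y2 \<in> Y" "z0 \<notin> Y" "{y2, z0} \<in> below \<xi> s'" "(z, z0) \<in> reachable (below \<xi> s')"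
      "infinite (cluster (avoiding (below \<xi> s') Y) z0)" by metis
  have "{y1, x0} \<in> E" "{y2, z0} \<in> E" using x0(3) z0(3) by (auto simp: below_def)
  then have x0V: "x0 \<in> V" and z0V: "z0 \<in> V" using edge_verts by blast+
  have "(v, x0) \<in> reachable (forest \<xi>)" using x0(4) by (rule reachable_mono) auto
  then have "pure \<xi> x0" using v(2) cluster_eq[of v x0 "forest \<xi>"] by (simp add: pure_def)
  have "avoiding ?A Y \<subseteq> forest \<xi>" "avoiding ?A Y \<inter> D = {}" "D \<subseteq> E" "\<And>e. e \<in> D \<Longrightarrow> \<xi> e < s" "0 \<le> s"
    using lev by (auto simp: D_def avoiding_def)
  then obtain \<xi>' where \<xi>': "Q \<xi>'" "pure \<xi>' x0" "avoiding ?A Y \<subseteq> forest \<xi>'"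
    "\<And>e. e \<notin> D \<Longrightarrow> \<xi>' e = \<xi> e" "\<And>e. e \<in> D \<Longrightarrow> \<xi>' e > s"
    using raise_many[OF finD \<open>D \<subseteq> E\<close> Q _ _ x0V x0(5) \<open>pure \<xi> x0\<close> _ \<open>0 \<le> s\<close> lev(3)] by metis
  have sub: "below \<xi>' s \<subseteq> avoiding (below \<xi> s) Y"
  proof
    fix e assume e: "e \<in> below \<xi>' s"
    then have "e \<notin> D" using \<xi>'(5)[of e] by (auto simp: below_def)
    then show "e \<in> avoiding (below \<xi> s) Y"
      using e \<xi>'(4)[of e] by (auto simp: below_def avoiding_def D_def)
  qed
  have sup: "avoiding (below \<xi> s') Y \<subseteq> below \<xi>' s'"
    using \<xi>'(4) by (auto simp: below_def avoiding_def D_def)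
  have inf': "w \<in> inf_verts \<xi>' s'" if "w \<in> V" "infinite (cluster (avoiding (below \<xi> s') Y) w)" for w
    using that finite_subset[OF cluster_mono[OF sup]] by (auto simp: inf_verts_def)
  have "cluster (avoiding ?A Y) x0 \<subseteq> cluster (avoiding (below \<xi> s') Y) x0"
    by (intro cluster_mono avoiding_mono) auto
  then have x0i: "x0 \<in> inf_verts \<xi>' s'" using inf'[OF x0V] x0(5) finite_subset by blast
  have z0i: "z0 \<in> inf_verts \<xi>' s'" using inf'[OF z0V z0(5)] .
  have "(v, x0) \<in> reachable (below \<xi> s)"
    using x0(4) by (rule reachable_mono) (use below_mono[of s' s \<xi>] lev in auto)
  moreover have "(z, z0) \<in> reachable (below \<xi> s)"
    using z0(4) by (rule reachable_mono) (use below_mono[of s' s \<xi>] lev in auto)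
  ultimately have disc0: "(x0, z0) \<notin> reachable (below \<xi> s)"
    using disc by (meson reachable_sym reachable_trans)
  let ?Y = "insert x0 (insert z0 Y)"
  let ?EY = "{e\<in>E. e \<subseteq> ?Y}"
  have inY: "(y, w) \<in> reachable ?EY" if "y \<in> Y" "w \<in> Y" for y w
  proof -
    have "(y, w) \<in> reachable {e\<in>E. e \<subseteq> Y}"
      by (rule reachable_trans[OF reachable_sym[OF Y(4)[OF that(1)]] Y(4)[OF that(2)]])
    then show ?thesis by (rule reachable_mono) auto
  qed
  have "(x0, y1) \<in> reachable ?EY" "(y2, z0) \<in> reachable ?EY"
    using x0(1) z0(1) \<open>{y1, x0} \<in> E\<close> \<open>{y2, z0} \<in> E\<close>
    using reachable_edge[of y1 x0 ?EY] reachable_edge[of y2 z0 ?EY] reachable_sym[of y1 x0 ?EY] by auto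
  then have "(x0, z0) \<in> reachable ?EY" using reachable_trans[OF reachable_trans[OF _ inY[OF x0(1) z0(1)]]] by blast
  then have "\<exists>ps. ps \<noteq> [] \<and> hd ps = x0 \<and> last ps = z0 \<and> distinct ps \<and>
      (\<forall>i. Suc i < length ps \<longrightarrow> {ps ! i, ps ! Suc i} \<in> ?EY)"
    by (rule reachable_distinct_path)
  then obtain ps where ps: "ps \<noteq> []" "hd ps = x0" "last ps = z0" "distinct ps"
    "\<forall>i. Suc i < length ps \<longrightarrow> {ps ! i, ps ! Suc i} \<in> ?EY"
    by (elim exE conjE)
  obtain qs where qs: "ps = x0 # qs" using ps by (cases ps) auto
  have x0z0: "x0 \<noteq> z0" using disc0 by auto
  then have qne: "qs \<noteq> []" using ps(3) qs by auto
  have qY: "q \<in> insert z0 Y" if q: "q \<in> set qs" for q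
  proof -
    obtain i where i: "i < length qs" "qs ! i = q" using q by (auto simp: in_set_conv_nth)
    then have "q \<in> ?Y" using ps(5)[rule_format, of i] qs by auto
    moreover have "q \<noteq> x0" using q ps(4) qs by auto
    ultimately show ?thesis by simp
  qed
  have lst: "last qs = z0" using ps(3) qs qne by simp
  have iso: "{q, b} \<notin> below \<xi>' s" if "q \<in> Y" for q b
    using sub that by (auto simp: avoiding_def)
  show False
  proof (rule no_link[OF \<xi>'(1) x0i \<xi>'(2) lev(1,2) _ qne])
    show "s \<le> 1" using lev by simp
    show "distinct (x0 # qs)" using ps(4) qs by simp
    show "successively (\<lambda>a b. {a, b} \<in> E) (x0 # qs)"
      using ps(5) unfolding qs successively_conv_nth by blast
    show "(x0, q) \<notin> reachable (below \<xi>' s)" if q: "q \<in> set qs" for q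
    proof
      assume r: "(x0, q) \<in> reachable (below \<xi>' s)"
      show False
      proof (cases "q = z0")
        case True
        then show False using disc0 r reachable_mono[OF r] sub avoiding_subset by (metis subset_trans)
      next
        case False
        then have "q \<in> Y" using qY q by blast
        then have "cluster (below \<xi>' s) q \<subseteq> {q}" using iso by (intro cluster_subset) auto
        moreover have "x0 \<in> cluster (below \<xi>' s) q" using reachable_sym[OF r] by simp
        ultimately have "x0 = q" by blast
        then show False using \<open>q \<in> Y\<close> x0 by simp
      qed
    qed
    show "{q, b} \<notin> below \<xi>' s" if q: "q \<in> set (butlast qs)" for q b
    proof -
      have "distinct qs" using ps(4) qs by simp
      then have "q \<noteq> z0"
        using q lst qne by (metis append_butlast_last_id distinct_append disjoint_iff list.set_intros(1))
      then show ?thesis using qY[of q] in_set_butlastD[OF q] iso by blast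
    qed
    show "last qs \<in> inf_verts \<xi>' s'" using lst z0i by simp
  qed
qed

end

context lf_graph
begin

section \<open>Counting ends\<close>

text \<open>Koenig's lemma. A state is the set of visited vertices with a current vertex whose
  cluster stays infinite after deleting them; \<open>infinite_cluster_avoiding\<close> supplies the
  next vertex.\<close>

lemma ray_in_infinite_cluster:
  assumes "A \<subseteq> E" "infinite (cluster A x)"
  shows "\<exists>p :: nat \<Rightarrow> 'a. inj p \<and> p 0 = x \<and> (\<forall>n. {p n, p (Suc n)} \<in> A)"
proof -
  define P where "P st \<longleftrightarrow> finite (fst st) \<and> snd st \<notin> fst st \<and> infinite (cluster (avoiding A (fst st)) (snd st))"
    for st :: "'a set \<times> 'a"
  define R where "R st st' \<longleftrightarrow> fst st' = insert (snd st) (fst st) \<and> {snd st, snd st'} \<in> avoiding A (fst st)"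
    for st st' :: "'a set \<times> 'a"
  have "\<exists>f. \<forall>n. (P (f n) \<and> (n = 0 \<longrightarrow> f n = ({}, x))) \<and> R (f n) (f (Suc n))"
  proof (rule dependent_nat_choice)
    have "avoiding A {} = A" by (auto simp: avoiding_def)
    then show "\<exists>st. P st \<and> (0 = (0::nat) \<longrightarrow> st = ({}, x))"
      using assms(2) by (intro exI[of _ "({}, x)"]) (simp add: P_def)
    fix st and n :: nat assume "P st \<and> (n = 0 \<longrightarrow> st = ({}, x))"
    then obtain S z where st: "st = (S, z)" "finite S" "z \<notin> S" "infinite (cluster (avoiding A S) z)"
      unfolding P_def by (cases st) auto
    have "avoiding A S \<subseteq> E" using assms(1) avoiding_subset by blast
    from infinite_cluster_avoiding[OF this _ _ st(4), of "{z}"] obtain z' where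
      z': "z' \<noteq> z" "{z, z'} \<in> avoiding A S" "infinite (cluster (avoiding (avoiding A S) {z}) z')" by auto
    have "avoiding (avoiding A S) {z} = avoiding A (insert z S)" by (auto simp: avoiding_def)
    moreover have "z' \<notin> S" using z'(2) by (auto simp: avoiding_def)
    ultimately show "\<exists>st'. (P st' \<and> (Suc n = 0 \<longrightarrow> st' = ({}, x))) \<and> R st st'"
      using st z' by (intro exI[of _ "(insert z S, z')"]) (auto simp: P_def R_def)
  qed
  then obtain f where f: "\<And>n. P (f n)" "f 0 = ({}, x)" "\<And>n. R (f n) (f (Suc n))" by blast
  define p where "p n = snd (f n)" for n
  have visited: "p m \<in> fst (f n)" if "m < n" for m n
    using that
  proof (induction n)
    case (Suc n)
    have "fst (f (Suc n)) = insert (p n) (fst (f n))" using f(3)[of n] by (simp add: R_def p_def)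
    then show ?case using Suc by (cases "m = n") auto
  qed simp
  have fresh: "p n \<notin> fst (f n)" for n using f(1)[of n] by (simp add: P_def p_def)
  have "inj p"
  proof (rule injI)
    fix m n assume "p m = p n"
    then show "m = n" using visited[of m n] visited[of n m] fresh[of m] fresh[of n]
      by (cases m n rule: linorder_cases) auto
  qed
  moreover have "{p n, p (Suc n)} \<in> A" for n
    using f(3)[of n] avoiding_subset unfolding R_def p_def by blast
  ultimately show ?thesis using f(2) by (intro exI[of _ p]) (simp add: p_def)
qed

text \<open>Cutting one more edge of a forest splits one piece in two; the representative of that
  piece is replaced by the two ends of the edge.\<close>

lemma cut_representatives:
  assumes inj: "inj_on \<xi> E" and v: "v \<in> V" and "finite H" "H \<subseteq> forest \<xi>" "\<Union> H \<subseteq> cluster (forest \<xi>) v"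
  shows "\<exists>X. X \<subseteq> cluster (forest \<xi>) v \<and> finite X \<and> card X = Suc (card H) \<and>
    (\<forall>x\<in>X. \<forall>y\<in>X. x \<noteq> y \<longrightarrow> (x, y) \<notin> reachable (forest \<xi> - H))"
  using assms(3-5)
proof (induction H rule: finite_induct)
  case empty
  then show ?case by (intro exI[of _ "{v}"]) auto
next
  case (insert h H)
  let ?T = "cluster (forest \<xi>) v"
  obtain X where X: "X \<subseteq> ?T" "finite X" "card X = Suc (card H)"
    "\<And>x y. x \<in> X \<Longrightarrow> y \<in> X \<Longrightarrow> x \<noteq> y \<Longrightarrow> (x, y) \<notin> reachable (forest \<xi> - H)"
    using insert by auto
  have "h \<in> E" using insert.prems forest_subset by blast
  then obtain c d where cd: "h = {c, d}" "c \<noteq> d" by (rule edgeE)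
  have cdT: "c \<in> ?T" "d \<in> ?T" using insert.prems cd by auto
  let ?F = "forest \<xi> - H" and ?F' = "forest \<xi> - insert h H"
  have mono: "(x, y) \<in> reachable ?F' \<Longrightarrow> (x, y) \<in> reachable ?F" for x y
    by (erule reachable_mono) auto
  have card: "card (insert h H) = Suc (card H)" using insert.hyps by simp
  show ?case
  proof (cases "\<exists>x\<in>X. (c, x) \<in> reachable ?F")
    \<comment> \<open>The induction does not record that \<open>X\<close> meets every piece; a piece
      without a representative simply gets one.\<close>
    case False
    then have cX: "c \<notin> X" by auto
    have "(x, y) \<notin> reachable ?F'" if "x \<in> insert c X" "y \<in> insert c X" "x \<noteq> y" for x y
      using that X(4)[of x y] mono[of x y] False reachable_sym[of x y ?F] by blast
    then show ?thesis using X cX cdT card by (intro exI[of _ "insert c X"]) simp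
  next
    case True
    then obtain x0 where x0: "x0 \<in> X" "(c, x0) \<in> reachable ?F" by blast
    have hF: "h \<in> ?F" using insert.hyps insert.prems by blast
    then have dc: "(d, c) \<in> reachable ?F" using cd reachable_edge[of d c ?F] by (simp add: insert_commute)
    have dx: "(d, x0) \<in> reachable ?F" using dc x0(2) by (rule reachable_trans)
    have n: "(z, x) \<notin> reachable ?F" if z: "z = c \<or> z = d" and x: "x \<in> X - {x0}" for z x
    proof
      assume r: "(z, x) \<in> reachable ?F"
      have "(x0, z) \<in> reachable ?F" using z reachable_sym[OF x0(2)] reachable_sym[OF dx] by auto
      then have "(x0, x) \<in> reachable ?F" using r by (rule reachable_trans)
      then show False using X(4)[of x0 x] x0(1) x by auto
    qed
    have n': "(x, z) \<notin> reachable ?F" if "z = c \<or> z = d" "x \<in> X - {x0}" for z x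
      using n[OF that] reachable_sym[of x z ?F] by blast
    have cd': "(c, d) \<notin> reachable ?F'"
    proof
      assume "(c, d) \<in> reachable ?F'"
      then have "(c, d) \<in> reachable (forest \<xi> - {h})" by (rule reachable_mono) auto
      then show False using forest_acyclic[OF inj, of c d] hF cd by simp
    qed
    let ?X = "insert c (insert d (X - {x0}))"
    have "(x, y) \<notin> reachable ?F'" if xy: "x \<in> ?X" "y \<in> ?X" "x \<noteq> y" for x y
    proof -
      consider "x = c" "y = d" | "x = d" "y = c" | "x = c \<or> x = d" "y \<in> X - {x0}"
        | "y = c \<or> y = d" "x \<in> X - {x0}" | "x \<in> X" "y \<in> X" using xy by blast
      then show ?thesis
      proof cases
        case 2
        then show ?thesis using cd' reachable_sym[of d c ?F'] by blast
      next
        case 3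
        then show ?thesis using n mono by blast
      next
        case 4
        then show ?thesis using n' mono by blast
      next
        case 5
        then show ?thesis using X(4) xy mono by blast
      qed (use cd' in simp)
    qed
    moreover have "c \<notin> insert d (X - {x0})" "d \<notin> X - {x0}"
      using n[of c c] n[of d d] cd(2) by (metis reachable_refl insert_iff)+
    then have "card ?X = Suc (Suc (card (X - {x0})))" using X(2) by simp
    then have "card ?X = Suc (card (insert h H))" using X x0(1) card by simp
    ultimately show ?thesis using X cdT by (intro exI[of _ ?X]) auto
  qed
qed

lemma infinite_cut_component:
  assumes "finite H" "H \<subseteq> bridges \<xi>" "infinite (cluster (forest \<xi>) x)"
  shows "infinite (cluster (forest \<xi> - H) x)"
proof (cases "\<exists>h\<in>H. h \<inter> cluster (forest \<xi> - H) x \<noteq> {}")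
  case False
  have "cluster (forest \<xi>) x \<subseteq> cluster (forest \<xi> - H) x"
  proof (rule cluster_subset)
    fix a b assume a: "a \<in> cluster (forest \<xi> - H) x" "{a, b} \<in> forest \<xi>"
    then have "{a, b} \<inter> cluster (forest \<xi> - H) x \<noteq> {}" by simp
    then have "{a, b} \<in> forest \<xi> - H" using False a(2) by (metis DiffI)
    then show "b \<in> cluster (forest \<xi> - H) x" using a(1) reachable_trans[OF _ reachable_edge[of a b "forest \<xi> - H"]] by simp
  qed simp
  then show ?thesis using assms(3) finite_subset by blast
next
  case True
  let ?C = "cluster (forest \<xi> - H) x"
  let ?K = "{h\<in>H. h \<inter> ?C \<noteq> {}}"
  obtain h where h: "h \<in> ?K" "\<And>f. f \<in> ?K \<Longrightarrow> \<xi> h \<le> \<xi> f"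
    using ex_min_on[of ?K \<xi>] assms(1) True by auto
  then obtain c where c: "c \<in> h" "c \<in> ?C" by blast
  have "infinite (cluster (below \<xi> (\<xi> h)) c)"
    using h(1) c(1) assms(2) unfolding bridges_def inf_verts_def by blast
  then have "infinite (cluster (forest \<xi> \<inter> below \<xi> (\<xi> h)) c)" by (rule infinite_cluster_forest_below)
  moreover have "cluster (forest \<xi> \<inter> below \<xi> (\<xi> h)) c \<subseteq> ?C"
  proof (rule cluster_subset[OF c(2)])
    fix a b assume a: "a \<in> ?C" "{a, b} \<in> forest \<xi> \<inter> below \<xi> (\<xi> h)"
    then have "{a, b} \<notin> ?K" using h(2)[of "{a, b}"] by (auto simp: below_def)
    then have "{a, b} \<in> forest \<xi> - H" using a by blast
    then show "b \<in> ?C" using a(1) reachable_trans[OF _ reachable_edge[of a b "forest \<xi> - H"]] by simp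
  qed
  ultimately show ?thesis using finite_subset by blast
qed

lemma infinite_ends:
  assumes inj: "inj_on \<xi> E" and v: "v \<in> V"
    and inf: "infinite {h\<in>bridges \<xi>. h \<subseteq> cluster (forest \<xi>) v}"
  shows "infinite (tree_ends (induced_edges (forest \<xi>) (cluster (forest \<xi>) v)))"
proof
  let ?T = "cluster (forest \<xi>) v"
  let ?E = "induced_edges (forest \<xi>) ?T"
  assume fin: "finite (tree_ends ?E)"
  obtain H where H: "finite H" "card H = card (tree_ends ?E)" "H \<subseteq> {h\<in>bridges \<xi>. h \<subseteq> ?T}"
    using infinite_arbitrarily_large[OF inf] by blast
  have HF: "H \<subseteq> forest \<xi>" "H \<subseteq> bridges \<xi>" "\<Union> H \<subseteq> ?T" using H bridges_subset by blast+
  obtain X where X: "X \<subseteq> ?T" "finite X" "card X = Suc (card H)"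
    "\<And>x y. x \<in> X \<Longrightarrow> y \<in> X \<Longrightarrow> x \<noteq> y \<Longrightarrow> (x, y) \<notin> reachable (forest \<xi> - H)"
    using cut_representatives[OF inj v H(1) HF(1,3)] by blast
  have "infinite ?T"
  proof
    assume "finite ?T"
    then have "finite (Pow ?T)" by simp
    moreover have "{h\<in>bridges \<xi>. h \<subseteq> ?T} \<subseteq> Pow ?T" by blast
    ultimately have "finite {h\<in>bridges \<xi>. h \<subseteq> ?T}" by (rule finite_subset[rotated])
    then show False using inf by simp
  qed
  then have infc: "infinite (cluster (forest \<xi> - H) x)" if "x \<in> X" for x
    using infinite_cut_component[OF H(1) HF(2)] cluster_eq[of v x "forest \<xi>"] X(1) that by auto
  have "\<exists>p. \<forall>x\<in>X. inj (p x) \<and> p x (0::nat) = x \<and> (\<forall>n. {p x n, p x (Suc n)} \<in> forest \<xi> - H)"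
    using ray_in_infinite_cluster[OF _ infc] forest_subset by (intro bchoice ballI) blast
  then obtain p where p: "\<And>x. x \<in> X \<Longrightarrow> inj (p x)" "\<And>x. x \<in> X \<Longrightarrow> p x (0::nat) = x"
    "\<And>x n. x \<in> X \<Longrightarrow> {p x n, p x (Suc n)} \<in> forest \<xi> - H" by blast
  define P where "P x = range (\<lambda>n. {p x n, p x (Suc n)})" for x
  have reach: "(x, p x n) \<in> reachable (forest \<xi> - H)" if "x \<in> X" for x n
  proof (induction n)
    case (Suc n)
    then show ?case using reachable_trans[OF _ reachable_edge[OF p(3)[OF that, of n]]] by blast
  qed (use p(2)[OF that] in simp)
  have inT: "p x n \<in> ?T" if "x \<in> X" for x n
  proof -
    have "(x, p x n) \<in> reachable (forest \<xi>)" using reach[OF that] by (rule reachable_mono) auto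
    then show ?thesis using X(1) that reachable_trans[of v x "forest \<xi>" "p x n"] by auto
  qed
  have ray: "is_ray ?E (P x)" if "x \<in> X" for x
  proof -
    have "P x \<subseteq> ?E" using p(3)[OF that] inT[OF that] unfolding P_def induced_edges_def by blast
    then show ?thesis using p(1)[OF that] unfolding is_ray_def P_def by blast
  qed
  have infP: "infinite (P x)" if "x \<in> X" for x
  proof -
    have "inj (\<lambda>n. {p x n, p x (Suc n)})"
      using p(1)[OF that] by (intro injI) (auto simp: doubleton_eq_iff inj_eq)
    then show ?thesis unfolding P_def by (rule range_inj_infinite)
  qed
  \<comment> \<open>Rays in different pieces share no vertex, hence no edge, so their symmetric
    difference is infinite and they define different ends.\<close>
  have disj: "P x \<inter> P y = {}" if "x \<in> X" "y \<in> X" "x \<noteq> y" for x y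
  proof (rule ccontr)
    assume "P x \<inter> P y \<noteq> {}"
    then obtain m n where "{p x m, p x (Suc m)} = {p y n, p y (Suc n)}" unfolding P_def by auto
    then obtain k where "p x m = p y k" by (metis insert_iff singletonD insertI1)
    then have "(x, y) \<in> reachable (forest \<xi> - H)"
      using reach[OF that(1), of m] reach[OF that(2), of k] reachable_sym reachable_trans by metis
    then show False using X(4) that by blast
  qed
  define cls where "cls x = end_rel ?E `` {P x}" for x
  have self: "P x \<in> cls x" if "x \<in> X" for x
    using ray[OF that] unfolding cls_def end_rel_def by simp
  have "inj_on cls X"
  proof (rule inj_onI, rule ccontr)
    fix x y assume xy: "x \<in> X" "y \<in> X" "cls x = cls y" "x \<noteq> y"
    then have "P y \<in> cls x" using self by simp
    then have "finite (sym_diff (P x) (P y))" unfolding cls_def end_rel_def by simp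
    moreover have "P x \<subseteq> sym_diff (P x) (P y)" using disj xy by blast
    ultimately show False using infP[OF xy(1)] finite_subset by blast
  qed
  moreover have "cls ` X \<subseteq> tree_ends ?E"
    unfolding cls_def tree_ends_def using ray by (auto intro!: quotientI)
  ultimately have "card X \<le> card (tree_ends ?E)" using fin card_inj_on_le by blast
  then show False using X(3) H(2) by simp
qed

section \<open>Random labels\<close>

definition unif :: "real measure" where
  "unif = uniform_measure lborel {0..1}"

text \<open>As a product over \<open>E\<close> it lives on extensional functions: the value off
  \<open>E\<close> is fixed.\<close>

definition labels :: "('a set \<Rightarrow> real) measure" where
  "labels = PiM E (\<lambda>_. unif)"

lemma prob_space_unif: "prob_space unif"
  unfolding unif_def by (rule prob_space_uniform_measure) auto

lemma sets_unif [measurable_cong]: "sets unif = sets borel"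
  by (simp add: unif_def)

lemma space_unif [simp]: "space unif = UNIV"
  by (simp add: unif_def)

lemma emeasure_unif_interval:
  "0 \<le> a \<Longrightarrow> a \<le> b \<Longrightarrow> b \<le> 1 \<Longrightarrow> emeasure unif {a<..<b} = ennreal (b - a)"
proof -
  assume ab: "0 \<le> a" "a \<le> b" "b \<le> 1"
  have "{0..1} \<inter> {a<..<b} = {a<..<b}" using ab by auto
  then show ?thesis using ab unfolding unif_def
    by (subst emeasure_uniform_measure) (auto simp: divide_ennreal_def)
qed

lemma AE_unif_neq: "AE u in unif. u \<noteq> (c :: real)"
proof -
  have "AE u in lborel. u \<noteq> c" by (rule AE_lborel_singleton)
  then show ?thesis unfolding unif_def by (subst AE_uniform_measure) auto
qed

lemma AE_unif_ex:
  assumes "AE u in unif. P u" "0 \<le> a" "a < b" "b \<le> 1"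
  shows "\<exists>u. a < u \<and> u < b \<and> P u"
proof (rule ccontr)
  assume no: "\<not> ?thesis"
  have "AE u in unif. u \<notin> {a<..<b}"
    using assms(1) by eventually_elim (use no in auto)
  then have "emeasure unif {a<..<b} = 0"
    by (subst (asm) AE_iff_measurable[of "{a<..<b}"]) auto
  then show False using emeasure_unif_interval[of a b] assms by (simp add: ennreal_eq_0_iff)
qed

sublocale unif: prob_space unif
  by (rule prob_space_unif)

sublocale labels: prob_space labels
  unfolding labels_def by (intro prob_space_PiM prob_space_unif)

lemma space_labels: "space labels = E \<rightarrow>\<^sub>E UNIV"
  by (simp add: labels_def space_PiM)

lemma sets_labels [measurable_cong]: "sets labels = sets (PiM E (\<lambda>_. borel))"
  unfolding labels_def by (intro sets_PiM_cong) (auto simp: sets_unif)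

lemma measurable_label: "e \<in> E \<Longrightarrow> (\<lambda>\<xi>. \<xi> e) \<in> borel_measurable labels"
  by (subst measurable_cong_sets[OF sets_labels refl]) (rule measurable_component_singleton)

lemma label_upd_in_space: "\<xi> \<in> space labels \<Longrightarrow> e \<in> E \<Longrightarrow> \<xi>(e := u) \<in> space labels"
  unfolding space_labels by (auto simp: PiE_iff extensional_def)

lemma measurable_resample: "e \<in> E \<Longrightarrow> (\<lambda>(\<xi>, u). \<xi>(e := u)) \<in> labels \<Otimes>\<^sub>M unif \<rightarrow>\<^sub>M labels"
proof -
  assume e: "e \<in> E"
  have "(\<lambda>(\<xi>, u). \<xi>(e := u)) \<in> PiM E (\<lambda>_. borel :: real measure) \<Otimes>\<^sub>M borel \<rightarrow>\<^sub>M PiM (insert e E) (\<lambda>_. borel)"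
    by measurable
  then show ?thesis
    by (subst measurable_cong_sets[OF sets_pair_measure_cong[OF sets_labels sets_unif] sets_labels])
       (simp add: insert_absorb[OF e])
qed

lemma distr_resample:
  assumes e: "e \<in> E"
  shows "distr (labels \<Otimes>\<^sub>M unif) labels (\<lambda>(\<xi>, u). \<xi>(e := u)) = labels"
proof -
  interpret P: pair_sigma_finite unif labels ..
  have swap: "labels \<Otimes>\<^sub>M unif = distr (unif \<Otimes>\<^sub>M labels) (labels \<Otimes>\<^sub>M unif) (\<lambda>(x, y). (y, x))"
    by (rule pair_sigma_finite.distr_pair_swap) unfold_locales
  have "distr (labels \<Otimes>\<^sub>M unif) labels (\<lambda>(\<xi>, u). \<xi>(e := u)) =
      distr (distr (unif \<Otimes>\<^sub>M labels) (labels \<Otimes>\<^sub>M unif) (\<lambda>(x, y). (y, x))) labels (\<lambda>(\<xi>, u). \<xi>(e := u))"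
    by (rule arg_cong[OF swap])
  also have "\<dots> = distr (unif \<Otimes>\<^sub>M labels) labels ((\<lambda>(\<xi>, u). \<xi>(e := u)) \<circ> (\<lambda>(x, y). (y, x)))"
    by (rule distr_distr[OF measurable_resample[OF e] measurable_pair_swap'])
  also have "\<dots> = distr (unif \<Otimes>\<^sub>M labels) labels (\<lambda>(u, \<xi>). \<xi>(e := u))"
    by (rule distr_cong) auto
  also have "\<dots> = labels"
    using distr_pair_PiM_eq_PiM[of E "\<lambda>_. unif" e, OF prob_space_unif prob_space_unif]
    unfolding labels_def insert_absorb[OF e] .
  finally show ?thesis .
qed

lemma AE_resample:
  assumes "AE \<xi> in labels. P \<xi>" "e \<in> E"
  shows "AE \<xi> in labels. AE u in unif. P (\<xi>(e := u))"
proof -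
  interpret P: pair_sigma_finite labels unif ..
  have "AE x in labels \<Otimes>\<^sub>M unif. P ((\<lambda>(\<xi>, u). \<xi>(e := u)) x)"
    using assms(1) by (intro AE_distrD[OF measurable_resample[OF assms(2)]]) (unfold distr_resample[OF assms(2)])
  then have "AE x in labels \<Otimes>\<^sub>M unif. (\<lambda>(\<xi>, u). P (\<xi>(e := u))) x"
    by (simp add: case_prod_unfold)
  from P.AE_pair[OF this] show ?thesis by simp
qed

text \<open>Fubini in the converse direction, hence the measurability assumption. It reduces an
  almost sure statement to one in which a single label varies.\<close>

lemma AE_resample_rev:
  assumes P: "Measurable.pred labels P" and e: "e \<in> E"
    and AE: "AE \<xi> in labels. AE u in unif. P (\<xi>(e := u))"
  shows "AE \<xi> in labels. P \<xi>"
proof -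
  interpret P: pair_sigma_finite labels unif ..
  have "Measurable.pred (labels \<Otimes>\<^sub>M unif) (P \<circ> (\<lambda>(\<xi>, u). \<xi>(e := u)))"
    by (rule measurable_comp[OF measurable_resample[OF e] P])
  then have m: "{x \<in> space (labels \<Otimes>\<^sub>M unif). P ((\<lambda>(\<xi>, u). \<xi>(e := u)) x)} \<in> sets (labels \<Otimes>\<^sub>M unif)"
    by (simp add: pred_def comp_def)
  have "AE x in labels \<Otimes>\<^sub>M unif. P ((\<lambda>(\<xi>, u). \<xi>(e := u)) x)"
    by (rule P.AE_pair_measure[OF m]) (use AE in simp)
  then have "AE \<xi> in distr (labels \<Otimes>\<^sub>M unif) labels (\<lambda>(\<xi>, u). \<xi>(e := u)). P \<xi>"
    using P by (subst AE_distr_iff[OF measurable_resample[OF e]]) (auto simp: pred_def)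
  then show ?thesis unfolding distr_resample[OF e] .
qed

text \<open>\<open>Q\<close> is the intersection of the sets obtained by demanding again and again
  that almost every resampled label stays in the previous set. Each is almost sure by
  \<open>AE_resample\<close>, there are countably many, and shifting the index gives
  closure.\<close>

lemma AE_resampling_closed:
  assumes "AE \<xi> in labels. P \<xi>"
  obtains Q where "AE \<xi> in labels. Q \<xi>" "\<And>\<xi>. Q \<xi> \<Longrightarrow> P \<xi>"
    "\<And>\<xi> e. Q \<xi> \<Longrightarrow> e \<in> E \<Longrightarrow> AE u in unif. Q (\<xi>(e := u))"
proof
  define R where "R = rec_nat P (\<lambda>_ R \<xi>. R \<xi> \<and> (\<forall>e\<in>E. AE u in unif. R (\<xi>(e := u))))"
  have R0: "R 0 = P" and RS: "R (Suc n) \<xi> \<longleftrightarrow> R n \<xi> \<and> (\<forall>e\<in>E. AE u in unif. R n (\<xi>(e := u)))" for n \<xi>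
    by (simp_all add: R_def)
  have "AE \<xi> in labels. R n \<xi>" for n
  proof (induction n)
    case (Suc n)
    have "AE \<xi> in labels. \<forall>e\<in>E. AE u in unif. R n (\<xi>(e := u))"
      by (intro AE_ball_countable'[OF AE_resample[OF Suc] countable_E])
    with Suc show ?case unfolding RS by eventually_elim auto
  qed (use assms R0 in simp)
  then show "AE \<xi> in labels. \<forall>n. R n \<xi>" by (simp add: AE_all_countable)
  show "P \<xi>" if "\<forall>n. R n \<xi>" for \<xi> using that R0 by metis
  show "AE u in unif. \<forall>n. R n (\<xi>(e := u))" if "\<forall>n. R n \<xi>" "e \<in> E" for \<xi> e
    using that(1)[rule_format, of "Suc _"] that(2) by (simp add: AE_all_countable RS)
qed

section \<open>Independence\<close>

text \<open>Only \<open>J \<inter> E\<close> is read, so that \<open>J\<close> can be written as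
  \<open>{e. e \<inter> S \<noteq> {}}\<close> without mentioning \<open>E\<close>.\<close>

definition depends_on :: "(('a set \<Rightarrow> real) \<Rightarrow> bool) \<Rightarrow> 'a set set \<Rightarrow> bool" where
  "depends_on P J \<longleftrightarrow> (\<forall>\<xi>\<in>space labels. \<forall>\<xi>'\<in>space labels. (\<forall>e\<in>J \<inter> E. \<xi> e = \<xi>' e) \<longrightarrow> P \<xi> = P \<xi>')"

lemma depends_on_not: "depends_on P J \<Longrightarrow> depends_on (\<lambda>\<xi>. \<not> P \<xi>) J"
  unfolding depends_on_def by blast

lemma indep_labels: "labels.indep_vars (\<lambda>_. unif) (\<lambda>e \<xi>. \<xi> e) E"
proof -
  interpret P: product_prob_space "\<lambda>_. unif" E
    by unfold_locales
  have "distr labels (PiM E (\<lambda>_. unif)) (\<lambda>x. \<lambda>i\<in>E. x i) = distr labels labels (\<lambda>x. x)"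
    unfolding labels_def by (rule distr_cong) (auto simp: space_PiM PiE_restrict)
  also have "\<dots> = PiM E (\<lambda>_. unif)" by (simp add: labels_def)
  also have "\<dots> = PiM E (\<lambda>i. distr labels unif (\<lambda>x. x i))"
    unfolding labels_def by (intro PiM_cong refl P.PiM_component[symmetric])
  finally show ?thesis
    unfolding labels_def[symmetric]
    by (subst labels.indep_vars_iff_distr_eq_PiM'[OF E_nonempty]) (auto simp: labels_def)
qed

lemma prob_indep:
  assumes fin: "finite I" "I \<noteq> {}"
    and P: "\<And>i. i \<in> I \<Longrightarrow> Measurable.pred labels (P i)" "\<And>i. i \<in> I \<Longrightarrow> depends_on (P i) (J i)"
    and disj: "\<And>i j. i \<in> I \<Longrightarrow> j \<in> I \<Longrightarrow> i \<noteq> j \<Longrightarrow> J i \<inter> J j \<inter> E = {}"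
  shows "labels.prob {\<xi>\<in>space labels. \<forall>i\<in>I. P i \<xi>} = (\<Prod>i\<in>I. labels.prob {\<xi>\<in>space labels. P i \<xi>})"
proof -
  let ?J = "\<lambda>i. J i \<inter> E"
  let ?X = "\<lambda>i \<xi>. restrict (\<lambda>e. \<xi> e) (?J i)"
  have ind: "labels.indep_vars (\<lambda>i. PiM (?J i) (\<lambda>_. unif)) ?X I"
    by (rule labels.indep_vars_restrict[OF indep_labels]) (use disj in \<open>auto simp: disjoint_family_on_def\<close>)
  \<comment> \<open>Completes labels on \<open>J i\<close> to a configuration; the default 0 is
    harmless because \<open>P i\<close> reads only \<open>J i\<close>.\<close>
  define ext where "ext i \<eta> = (\<lambda>e\<in>E. if e \<in> J i then \<eta> e else (0::real))" for i and \<eta> :: "'a set \<Rightarrow> real"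
  have ext_meas: "ext i \<in> PiM (?J i) (\<lambda>_. unif) \<rightarrow>\<^sub>M labels" for i
    unfolding labels_def ext_def
  proof (rule measurable_restrict)
    fix e assume "e \<in> E"
    then show "(\<lambda>\<eta>. if e \<in> J i then \<eta> e else 0) \<in> PiM (?J i) (\<lambda>_. unif) \<rightarrow>\<^sub>M unif"
      by (cases "e \<in> J i") auto
  qed
  define A where "A i = {\<eta>\<in>space (PiM (?J i) (\<lambda>_. unif)). P i (ext i \<eta>)}" for i
  have A: "A i \<in> sets (PiM (?J i) (\<lambda>_. unif))" if "i \<in> I" for i
    using measurable_comp[OF ext_meas P(1)[OF that]] unfolding A_def by (simp add: pred_def comp_def)
  have eq: "?X i -` A i \<inter> space labels = {\<xi>\<in>space labels. P i \<xi>}" if "i \<in> I" for i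
  proof -
    have "P i (ext i (?X i \<xi>)) = P i \<xi>" if \<xi>: "\<xi> \<in> space labels" for \<xi>
    proof -
      have "ext i (?X i \<xi>) \<in> space labels" unfolding ext_def space_labels by auto
      moreover have "\<forall>e\<in>J i \<inter> E. ext i (?X i \<xi>) e = \<xi> e" by (simp add: ext_def)
      ultimately show ?thesis using P(2)[OF \<open>i \<in> I\<close>] \<xi> unfolding depends_on_def by blast
    qed
    then show ?thesis unfolding A_def by (auto simp: space_PiM)
  qed
  have "labels.prob (\<Inter>i\<in>I. ?X i -` A i \<inter> space labels) = (\<Prod>i\<in>I. labels.prob (?X i -` A i \<inter> space labels))"
    using labels.indep_varsD[OF ind fin(2,1) subset_refl] A by blast
  moreover have "(\<Inter>i\<in>I. ?X i -` A i \<inter> space labels) = {\<xi>\<in>space labels. \<forall>i\<in>I. P i \<xi>}"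
    using eq fin(2) by auto
  ultimately show ?thesis using eq by simp
qed

lemma prob_indep2:
  assumes "Measurable.pred labels P" "Measurable.pred labels R" "depends_on P J" "depends_on R K"
    "J \<inter> K \<inter> E = {}"
  shows "labels.prob {\<xi>\<in>space labels. P \<xi> \<and> R \<xi>} =
    labels.prob {\<xi>\<in>space labels. P \<xi>} * labels.prob {\<xi>\<in>space labels. R \<xi>}"
proof -
  have "labels.prob {\<xi>\<in>space labels. \<forall>b\<in>{0, 1::nat}. (if b = 0 then P else R) \<xi>} =
      (\<Prod>b\<in>{0, 1::nat}. labels.prob {\<xi>\<in>space labels. (if b = 0 then P else R) \<xi>})"
    using assms by (intro prob_indep[where J = "\<lambda>b. if b = 0 then J else K"]) auto
  then show ?thesis by simp
qed

section \<open>Automorphisms\<close>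

abbreviation Aut :: "('a \<Rightarrow> 'a) set" where "Aut \<equiv> graph_aut V E"

lemma Aut_bij: "\<phi> \<in> Aut \<Longrightarrow> bij \<phi>"
  unfolding graph_aut_def using permutes_bij by blast

lemma Aut_in_V: "\<phi> \<in> Aut \<Longrightarrow> \<phi> x \<in> V \<longleftrightarrow> x \<in> V"
  unfolding graph_aut_def using permutes_in_image by fastforce

lemma Aut_edge: "\<phi> \<in> Aut \<Longrightarrow> \<phi> ` e \<in> E \<longleftrightarrow> e \<in> E"
proof
  assume \<phi>: "\<phi> \<in> Aut" and "e \<in> E"
  then obtain x y where "e = {x, y}" "x \<in> V" "y \<in> V" by (elim edgeE)
  then show "\<phi> ` e \<in> E" using \<phi> \<open>e \<in> E\<close> by (auto simp: graph_aut_def)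
next
  assume \<phi>: "\<phi> \<in> Aut" and "\<phi> ` e \<in> E"
  then obtain x y where xy: "\<phi> ` e = {x, y}" "x \<in> V" "y \<in> V" by (elim edgeE)
  have "x \<in> \<phi> ` e" "y \<in> \<phi> ` e" using xy(1) by simp_all
  then obtain x' y' where "\<phi> x' = x" "\<phi> y' = y" by (elim imageE) simp
  then have "\<phi> ` e = \<phi> ` {x', y'}" using xy by simp
  then have "e = {x', y'}" by (rule iffD1[OF inj_image_eq_iff[OF bij_is_inj[OF Aut_bij[OF \<phi>]]]])
  moreover have "x' \<in> V" "y' \<in> V" using xy Aut_in_V[OF \<phi>] \<open>\<phi> x' = x\<close> \<open>\<phi> y' = y\<close> by auto
  ultimately show "e \<in> E" using \<phi> \<open>\<phi> ` e \<in> E\<close> by (auto simp: graph_aut_def)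
qed

lemma Aut_inv: "\<phi> \<in> Aut \<Longrightarrow> inv \<phi> \<in> Aut"
proof -
  assume \<phi>: "\<phi> \<in> Aut"
  have p: "inv \<phi> permutes V" using \<phi> by (auto simp: graph_aut_def permutes_inv)
  have "{inv \<phi> x, inv \<phi> y} \<in> E \<longleftrightarrow> {x, y} \<in> E" for x y
    using Aut_edge[OF \<phi>, of "{inv \<phi> x, inv \<phi> y}"] Aut_bij[OF \<phi>]
    by (simp add: surj_f_inv_f bij_is_surj)
  then show ?thesis using p by (auto simp: graph_aut_def)
qed

lemma Aut_comp: "\<phi> \<in> Aut \<Longrightarrow> \<psi> \<in> Aut \<Longrightarrow> \<phi> \<circ> \<psi> \<in> Aut"
  by (auto simp: graph_aut_def permutes_compose permutes_in_image)

text \<open>Pullback along \<open>\<phi>\<close>; the restriction to \<open>E\<close> keeps the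
  result in \<open>space labels\<close>.\<close>

definition relabel :: "('a \<Rightarrow> 'a) \<Rightarrow> ('a set \<Rightarrow> real) \<Rightarrow> 'a set \<Rightarrow> real" where
  "relabel \<phi> \<xi> = (\<lambda>e\<in>E. \<xi> (\<phi> ` e))"

lemma relabel_measurable: "\<phi> \<in> Aut \<Longrightarrow> relabel \<phi> \<in> labels \<rightarrow>\<^sub>M labels"
  unfolding labels_def relabel_def by (intro measurable_restrict measurable_component_singleton) (simp add: Aut_edge)

lemma distr_relabel:
  assumes \<phi>: "\<phi> \<in> Aut"
  shows "distr labels labels (relabel \<phi>) = labels"
proof -
  have "inj_on ((`) \<phi>) E" using inj_image_eq_iff[OF bij_is_inj[OF Aut_bij[OF \<phi>]]] by (auto simp: inj_on_def)
  then show ?thesis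
    using distr_PiM_reindex[of E "\<lambda>_. unif" "(`) \<phi>" E] prob_space_unif Aut_edge[OF \<phi>]
    unfolding labels_def relabel_def by auto
qed

lemma prob_relabel:
  assumes \<phi>: "\<phi> \<in> Aut" and P: "Measurable.pred labels P"
  shows "labels.prob {\<xi>\<in>space labels. P (relabel \<phi> \<xi>)} = labels.prob {\<xi>\<in>space labels. P \<xi>}"
proof -
  have "labels.prob {\<xi>\<in>space labels. P \<xi>} = measure (distr labels labels (relabel \<phi>)) {\<xi>\<in>space labels. P \<xi>}"
    by (simp add: distr_relabel[OF \<phi>])
  also have "\<dots> = labels.prob (relabel \<phi> -` {\<xi>\<in>space labels. P \<xi>} \<inter> space labels)"
    using P by (intro measure_distr relabel_measurable[OF \<phi>]) (simp add: pred_def)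
  also have "relabel \<phi> -` {\<xi>\<in>space labels. P \<xi>} \<inter> space labels = {\<xi>\<in>space labels. P (relabel \<phi> \<xi>)}"
    using measurable_space[OF relabel_measurable[OF \<phi>]] by auto
  finally show ?thesis by simp
qed

end

lemma pred_countable_bounded:
  assumes "countable I" "\<And>i. i \<in> I \<Longrightarrow> Measurable.pred M (\<lambda>x. P x i)"
  shows "Measurable.pred M (\<lambda>x. \<forall>i\<in>I. P x i)" "Measurable.pred M (\<lambda>x. \<exists>i\<in>I. P x i)"
  using assms unfolding pred_def
  by (auto intro!: sets.sets_Collect_countable_Ball sets.sets_Collect_countable_Bex)

context lf_graph
begin

section \<open>Measurability\<close>

text \<open>Membership of each single edge is enough, because \<open>E\<close> and \<open>V\<close>
  are countable and all derived events use countable quantifiers over them.\<close>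

definition random_edges :: "(('a set \<Rightarrow> real) \<Rightarrow> 'a set set) \<Rightarrow> bool" where
  "random_edges A \<longleftrightarrow> (\<forall>\<xi>. A \<xi> \<subseteq> E) \<and> (\<forall>e\<in>E. Measurable.pred labels (\<lambda>\<xi>. e \<in> A \<xi>))"

lemma random_edgesD: "random_edges A \<Longrightarrow> Measurable.pred labels (\<lambda>\<xi>. e \<in> A \<xi>)"
proof (cases "e \<in> E")
  case False
  moreover assume "random_edges A"
  ultimately have "(\<lambda>\<xi>. e \<in> A \<xi>) = (\<lambda>_. False)" unfolding random_edges_def by blast
  then show ?thesis by simp
qed (simp add: random_edges_def)

lemma random_below: "random_edges (\<lambda>\<xi>. below \<xi> t)"
proof -
  have "Measurable.pred labels (\<lambda>\<xi>. e \<in> below \<xi> t)" if "e \<in> E" for e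
    using measurable_label[OF that] that unfolding below_def by simp
  then show ?thesis using below_subset by (simp add: random_edges_def)
qed

lemma random_below_label: "f \<in> E \<Longrightarrow> random_edges (\<lambda>\<xi>. below \<xi> (\<xi> f))"
proof -
  assume f: "f \<in> E"
  have "Measurable.pred labels (\<lambda>\<xi>. e \<in> below \<xi> (\<xi> f))" if "e \<in> E" for e
    using measurable_label[OF that] measurable_label[OF f] that unfolding below_def by simp
  then show ?thesis using below_subset by (simp add: random_edges_def)
qed

lemma random_avoiding: "random_edges A \<Longrightarrow> random_edges (\<lambda>\<xi>. avoiding (A \<xi>) S)"
  unfolding random_edges_def avoiding_def by auto

lemma pred_adj_pow:
  assumes "random_edges A"
  shows "Measurable.pred labels (\<lambda>\<xi>. (x, y) \<in> adj (A \<xi>) ^^ n)"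
proof (induction n arbitrary: y)
  case (Suc n)
  have "(x, y) \<in> adj (A \<xi>) ^^ Suc n \<longleftrightarrow> (\<exists>z\<in>V. (x, z) \<in> adj (A \<xi>) ^^ n \<and> {z, y} \<in> A \<xi>)" for \<xi>
  proof
    assume "(x, y) \<in> adj (A \<xi>) ^^ Suc n"
    then obtain z where "(x, z) \<in> adj (A \<xi>) ^^ n" "{z, y} \<in> A \<xi>" by (auto simp: adj_def)
    moreover from this have "z \<in> V" using assms edge_verts unfolding random_edges_def by blast
    ultimately show "\<exists>z\<in>V. (x, z) \<in> adj (A \<xi>) ^^ n \<and> {z, y} \<in> A \<xi>" by blast
  qed (auto simp: adj_def)
  moreover have "Measurable.pred labels (\<lambda>\<xi>. \<exists>z\<in>V. (x, z) \<in> adj (A \<xi>) ^^ n \<and> {z, y} \<in> A \<xi>)"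
    by (intro pred_countable_bounded pred_intros_logic countable_V Suc random_edgesD[OF assms])
  ultimately show ?case by simp
qed simp

lemma pred_reachable:
  assumes "random_edges A"
  shows "Measurable.pred labels (\<lambda>\<xi>. (x, y) \<in> reachable (A \<xi>))"
  unfolding reachable_iff_adj by (intro pred_intros_countable pred_adj_pow assms)

text \<open>Both quantifiers on the right are countable, which is what makes infinity of a random
  vertex set measurable.\<close>

lemma infinite_iff_finite_escape:
  "A \<subseteq> V \<Longrightarrow> infinite A \<longleftrightarrow> (\<forall>S\<in>{S. finite S \<and> S \<subseteq> V}. \<exists>y\<in>V. y \<in> A \<and> y \<notin> S)"
proof (intro iffI ballI)
  fix S assume "A \<subseteq> V" "infinite A" "S \<in> {S. finite S \<and> S \<subseteq> V}"
  then have "\<not> A \<subseteq> S" using finite_subset by auto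
  then show "\<exists>y\<in>V. y \<in> A \<and> y \<notin> S" using \<open>A \<subseteq> V\<close> by blast
qed auto

lemma countable_finite_subsets: "countable {S. finite S \<and> S \<subseteq> V}"
  by (rule countable_Collect_finite_subset[OF countable_V])

lemma pred_infinite:
  assumes "\<And>\<xi>. A \<xi> \<subseteq> V" "\<And>y. Measurable.pred labels (\<lambda>\<xi>. y \<in> A \<xi>)"
  shows "Measurable.pred labels (\<lambda>\<xi>. infinite (A \<xi>))"
  unfolding infinite_iff_finite_escape[OF assms(1)]
  by (intro pred_countable_bounded pred_intros_logic countable_V countable_finite_subsets assms(2)) simp

lemma pred_infinite_cluster:
  assumes "random_edges A" "x \<in> V"
  shows "Measurable.pred labels (\<lambda>\<xi>. infinite (cluster (A \<xi>) x))"
proof (rule pred_infinite)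
  show "cluster (A \<xi>) x \<subseteq> V" for \<xi>
    using assms by (intro cluster_subset_V) (auto simp: random_edges_def)
qed (simp add: pred_reachable[OF assms(1)])

lemma pred_inf_verts: "Measurable.pred labels (\<lambda>\<xi>. x \<in> inf_verts \<xi> t)"
  by (cases "x \<in> V") (auto simp: inf_verts_def intro!: pred_infinite_cluster random_below)

lemma pred_inf_verts_label: "e \<in> E \<Longrightarrow> Measurable.pred labels (\<lambda>\<xi>. x \<in> inf_verts \<xi> (\<xi> e))"
  by (cases "x \<in> V") (auto simp: inf_verts_def intro!: pred_infinite_cluster random_below_label)

lemma random_forest: "random_edges forest"
proof -
  have "Measurable.pred labels (\<lambda>\<xi>. e \<in> forest \<xi>)" if e: "e \<in> E" for e
  proof -
    obtain x y where xy: "e = {x, y}" using e by (rule edgeE)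
    have "e \<in> forest \<xi> \<longleftrightarrow> (x, y) \<notin> reachable (below \<xi> (\<xi> e))" for \<xi>
      using forestI[of x y \<xi>] forestD[of x y \<xi>] e xy by blast
    then show ?thesis
      by (auto intro!: pred_intros_logic pred_reachable random_below_label e)
  qed
  then show ?thesis using forest_subset by (simp add: random_edges_def)
qed

lemma random_bridges: "random_edges bridges"
proof -
  have "Measurable.pred labels (\<lambda>\<xi>. e \<in> bridges \<xi>)" if e: "e \<in> E" for e
    unfolding bridges_def mem_Collect_eq subset_iff Ball_def[symmetric]
    by (intro pred_intros_logic random_edgesD[OF random_forest] pred_intros_finite(3) finite_edge e pred_inf_verts_label)
  then show ?thesis using subset_trans[OF bridges_subset forest_subset] by (simp add: random_edges_def)
qed

lemma pred_bridge_endpoint: "Measurable.pred labels (\<lambda>\<xi>. y \<in> \<Union> (bridges \<xi>))"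
proof -
  have "y \<in> \<Union> (bridges \<xi>) \<longleftrightarrow> (\<exists>e\<in>E. y \<in> e \<and> e \<in> bridges \<xi>)" for \<xi>
    using bridges_subset forest_subset by blast
  moreover have "Measurable.pred labels (\<lambda>\<xi>. \<exists>e\<in>E. y \<in> e \<and> e \<in> bridges \<xi>)"
    by (intro pred_countable_bounded pred_intros_logic countable_E random_edgesD[OF random_bridges]) simp
  ultimately show ?thesis by presburger
qed

lemma bridge_endpoints_subset: "\<Union> (bridges \<xi>) \<subseteq> V"
  using bridges_subset forest_subset edge_subset by blast

lemma pred_in_nearest: "Measurable.pred labels (\<lambda>\<xi>. y \<in> nearest \<xi> v)"
proof -
  have "y \<in> nearest \<xi> v \<longleftrightarrow> y \<in> \<Union> (bridges \<xi>) \<and> (\<exists>n. (v, y) \<in> adj (forest \<xi>) ^^ n \<and>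
     (\<forall>m\<in>{..<n}. \<forall>z\<in>V. z \<in> \<Union> (bridges \<xi>) \<longrightarrow> (v, z) \<notin> adj (forest \<xi>) ^^ m))" for \<xi>
    using bridge_endpoints_subset[of \<xi>] unfolding nearest_def by blast
  moreover have "Measurable.pred labels (\<lambda>\<xi>. y \<in> \<Union> (bridges \<xi>) \<and> (\<exists>n. (v, y) \<in> adj (forest \<xi>) ^^ n \<and>
     (\<forall>m\<in>{..<n}. \<forall>z\<in>V. z \<in> \<Union> (bridges \<xi>) \<longrightarrow> (v, z) \<notin> adj (forest \<xi>) ^^ m)))"
    by (intro pred_intros_logic pred_intros_countable pred_countable_bounded countable_V
      countable_finite finite_lessThan pred_bridge_endpoint pred_adj_pow random_forest)
  ultimately show ?thesis by presburger
qed

lemma nearest_subset_V: "nearest \<xi> v \<subseteq> V"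
  using nearest_subset[of \<xi> v] bridge_endpoints_subset[of \<xi>] by blast

lemma pred_nearest: "A \<subseteq> V \<Longrightarrow> Measurable.pred labels (\<lambda>\<xi>. nearest \<xi> v = A)"
proof -
  assume A: "A \<subseteq> V"
  have "nearest \<xi> v = A \<longleftrightarrow> (\<forall>y\<in>V. y \<in> nearest \<xi> v \<longleftrightarrow> y \<in> A)" for \<xi>
    using A nearest_subset_V[of \<xi> v] by blast
  moreover have "Measurable.pred labels (\<lambda>\<xi>. \<forall>y\<in>V. y \<in> nearest \<xi> v \<longleftrightarrow> y \<in> A)"
    by (intro pred_countable_bounded pred_intros_logic countable_V pred_in_nearest) simp
  ultimately show ?thesis by simp
qed

section \<open>Equivariance\<close>

text \<open>Preimage under \<open>\<phi>\<close>: this is how the edge sets derived from the labels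
  transform under \<open>relabel\<close>.\<close>

definition pull :: "('a \<Rightarrow> 'a) \<Rightarrow> 'a set set \<Rightarrow> 'a set set" where
  "pull \<phi> A = {e\<in>E. \<phi> ` e \<in> A}"

lemma pull_edge: "\<phi> \<in> Aut \<Longrightarrow> A \<subseteq> E \<Longrightarrow> {x, y} \<in> pull \<phi> A \<longleftrightarrow> {\<phi> x, \<phi> y} \<in> A"
  using Aut_edge[of \<phi> "{x, y}"] unfolding pull_def by auto

lemma adj_pow_pull:
  assumes \<phi>: "\<phi> \<in> Aut" and A: "A \<subseteq> E"
  shows "(x, y) \<in> adj (pull \<phi> A) ^^ n \<longleftrightarrow> (\<phi> x, \<phi> y) \<in> adj A ^^ n"
proof (induction n arbitrary: y)
  case 0
  then show ?case using Aut_bij[OF \<phi>] by (auto simp: bij_def inj_eq)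
next
  case (Suc n)
  have "(x, y) \<in> adj (pull \<phi> A) ^^ Suc n \<longleftrightarrow> (\<exists>z. (\<phi> x, \<phi> z) \<in> adj A ^^ n \<and> {\<phi> z, \<phi> y} \<in> A)"
    using Suc pull_edge[OF \<phi> A] by (auto simp: adj_def)
  also have "\<dots> \<longleftrightarrow> (\<exists>w. (\<phi> x, w) \<in> adj A ^^ n \<and> {w, \<phi> y} \<in> A)"
    using Aut_bij[OF \<phi>] by (metis bij_is_surj surj_f_inv_f)
  also have "\<dots> \<longleftrightarrow> (\<phi> x, \<phi> y) \<in> adj A ^^ Suc n" by (auto simp: adj_def)
  finally show ?case .
qed

lemma reachable_pull:
  "\<phi> \<in> Aut \<Longrightarrow> A \<subseteq> E \<Longrightarrow> (x, y) \<in> reachable (pull \<phi> A) \<longleftrightarrow> (\<phi> x, \<phi> y) \<in> reachable A"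
  by (simp add: reachable_iff_adj adj_pow_pull)

lemma infinite_cluster_pull:
  assumes "\<phi> \<in> Aut" "A \<subseteq> E"
  shows "infinite (cluster (pull \<phi> A) x) \<longleftrightarrow> infinite (cluster A (\<phi> x))"
proof -
  have b: "bij \<phi>" by (rule Aut_bij[OF assms(1)])
  have "cluster (pull \<phi> A) x = \<phi> -` cluster A (\<phi> x)"
    using reachable_pull[OF assms] by (auto simp: vimage_def)
  then show ?thesis
    using finite_vimageI[of "cluster A (\<phi> x)" \<phi>] finite_vimageD[of \<phi> "cluster A (\<phi> x)"] b
    by (auto simp: bij_def)
qed

lemma below_relabel: "below (relabel \<phi> \<xi>) t = pull \<phi> (below \<xi> t)" if "\<phi> \<in> Aut"
  using Aut_edge[OF that] unfolding below_def pull_def relabel_def by auto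

lemma inf_verts_relabel:
  assumes "\<phi> \<in> Aut"
  shows "x \<in> inf_verts (relabel \<phi> \<xi>) t \<longleftrightarrow> \<phi> x \<in> inf_verts \<xi> t"
  using infinite_cluster_pull[OF assms below_subset, of \<xi> t x] Aut_in_V[OF assms]
  by (simp add: inf_verts_def below_relabel[OF assms])

lemma forest_relabel:
  assumes \<phi>: "\<phi> \<in> Aut"
  shows "forest (relabel \<phi> \<xi>) = pull \<phi> (forest \<xi>)"
proof (intro set_eqI)
  fix e
  show "e \<in> forest (relabel \<phi> \<xi>) \<longleftrightarrow> e \<in> pull \<phi> (forest \<xi>)"
  proof (cases "e \<in> E")
    case True
    then obtain x y where xy: "e = {x, y}" by (rule edgeE)
    have "e \<in> forest (relabel \<phi> \<xi>) \<longleftrightarrow> (x, y) \<notin> reachable (below (relabel \<phi> \<xi>) (\<xi> (\<phi> ` e)))"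
      using True xy forestI[of x y "relabel \<phi> \<xi>"] forestD[of x y "relabel \<phi> \<xi>"] by (auto simp: relabel_def)
    also have "\<dots> \<longleftrightarrow> (\<phi> x, \<phi> y) \<notin> reachable (below \<xi> (\<xi> (\<phi> ` e)))"
      using reachable_pull[OF \<phi> below_subset] by (simp add: below_relabel[OF \<phi>])
    also have "\<dots> \<longleftrightarrow> \<phi> ` e \<in> forest \<xi>"
      using forestI[of "\<phi> x" "\<phi> y" \<xi>] forestD[of "\<phi> x" "\<phi> y" \<xi>] True xy Aut_edge[OF \<phi>, of e] by auto
    finally show ?thesis using True by (simp add: pull_def)
  qed (use forest_subset in \<open>auto simp: pull_def\<close>)
qed

lemma bridges_relabel:
  assumes \<phi>: "\<phi> \<in> Aut"
  shows "bridges (relabel \<phi> \<xi>) = pull \<phi> (bridges \<xi>)"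
  using forest_subset inf_verts_relabel[OF \<phi>]
  unfolding bridges_def forest_relabel[OF \<phi>] pull_def by (auto simp: relabel_def subset_iff)

lemma bridge_endpoint_relabel:
  assumes \<phi>: "\<phi> \<in> Aut"
  shows "y \<in> \<Union> (bridges (relabel \<phi> \<xi>)) \<longleftrightarrow> \<phi> y \<in> \<Union> (bridges \<xi>)"
proof
  assume "y \<in> \<Union> (bridges (relabel \<phi> \<xi>))"
  then show "\<phi> y \<in> \<Union> (bridges \<xi>)" unfolding bridges_relabel[OF \<phi>] pull_def by blast
next
  assume "\<phi> y \<in> \<Union> (bridges \<xi>)"
  then obtain h where h: "h \<in> bridges \<xi>" "\<phi> y \<in> h" by blast
  have "\<phi> ` (\<phi> -` h) = h" using Aut_bij[OF \<phi>] by (simp add: bij_is_surj surj_image_vimage_eq)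
  moreover have "h \<in> E" using h bridges_subset forest_subset by blast
  ultimately have "\<phi> -` h \<in> pull \<phi> (bridges \<xi>)"
    using h(1) Aut_edge[OF \<phi>, of "\<phi> -` h"] by (simp add: pull_def)
  then show "y \<in> \<Union> (bridges (relabel \<phi> \<xi>))" using h(2) bridges_relabel[OF \<phi>] by auto
qed

lemma nearest_relabel:
  assumes \<phi>: "\<phi> \<in> Aut"
  shows "y \<in> nearest (relabel \<phi> \<xi>) v \<longleftrightarrow> \<phi> y \<in> nearest \<xi> (\<phi> v)"
proof -
  have all: "(\<forall>z. P (\<phi> z)) \<longleftrightarrow> (\<forall>z. P z)" for P :: "'a \<Rightarrow> bool"
    using Aut_bij[OF \<phi>] by (metis bij_is_surj surj_f_inv_f)
  show ?thesis
    unfolding nearest_def mem_Collect_eq bridge_endpoint_relabel[OF \<phi>] Ball_def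
      forest_relabel[OF \<phi>] adj_pow_pull[OF \<phi> forest_subset]
    using all[of "\<lambda>z. z \<in> \<Union> (bridges \<xi>) \<longrightarrow> (\<phi> v, z) \<notin> adj (forest \<xi>) ^^ _"] by simp
qed

text \<open>Borel-Cantelli: the expected number of occurring events is finite, so the number itself
  is finite almost surely.\<close>

lemma AE_finite_of_summable:
  assumes I: "countable I" and P: "\<And>i. i \<in> I \<Longrightarrow> Measurable.pred labels (P i)"
    and sum: "(\<integral>\<^sup>+i. emeasure labels {\<xi>\<in>space labels. P i \<xi>} \<partial>count_space I) < \<infinity>"
  shows "AE \<xi> in labels. finite {i\<in>I. P i \<xi>}"
proof -
  let ?f = "\<lambda>i \<xi>. indicator {\<xi>\<in>space labels. P i \<xi>} \<xi> :: ennreal"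
  have m: "?f i \<in> borel_measurable labels" if "i \<in> I" for i
    using P[OF that] by (intro borel_measurable_indicator) (simp add: pred_def)
  have eq: "(\<integral>\<^sup>+\<xi>. \<integral>\<^sup>+i. ?f i \<xi> \<partial>count_space I \<partial>labels) < \<infinity>"
  proof -
    have "(\<integral>\<^sup>+\<xi>. \<integral>\<^sup>+i. ?f i \<xi> \<partial>count_space I \<partial>labels) = (\<integral>\<^sup>+i. \<integral>\<^sup>+\<xi>. ?f i \<xi> \<partial>labels \<partial>count_space I)"
      by (rule nn_integral_count_space_nn_integral[OF I m])
    also have "\<dots> = (\<integral>\<^sup>+i. emeasure labels {\<xi>\<in>space labels. P i \<xi>} \<partial>count_space I)"
      using P by (intro nn_integral_cong nn_integral_indicator) (simp add: pred_def)
    finally show ?thesis using sum by simp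
  qed
  have "(\<lambda>\<xi>. \<integral>\<^sup>+i. ?f i \<xi> \<partial>count_space I) \<in> borel_measurable labels"
  proof -
    interpret C: sigma_finite_measure "count_space I" by (rule sigma_finite_measure_count_space_countable[OF I])
    have "(\<lambda>x. ?f (snd x) (fst x)) \<in> borel_measurable (labels \<Otimes>\<^sub>M count_space I)"
      by (rule measurable_compose_countable'[where f = "\<lambda>i x. ?f i (fst x)" and g = snd and I = I])
         (use m I in \<open>auto intro: measurable_compose[OF measurable_fst]\<close>)
    then show ?thesis
      using C.borel_measurable_nn_integral[of "\<lambda>\<xi> i. ?f i \<xi>" labels] by (simp add: case_prod_unfold)
  qed
  then have "AE \<xi> in labels. (\<integral>\<^sup>+i. ?f i \<xi> \<partial>count_space I) \<noteq> \<infinity>"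
    using eq by (intro nn_integral_PInf_AE) auto
  with AE_space show ?thesis
  proof eventually_elim
    case (elim \<xi>)
    have "(\<integral>\<^sup>+i. ?f i \<xi> \<partial>count_space I) = (\<integral>\<^sup>+i. indicator {i\<in>I. P i \<xi>} i \<partial>count_space I)"
      using elim(1) by (intro nn_integral_cong) (auto simp: indicator_def)
    also have "\<dots> = emeasure (count_space I) {i\<in>I. P i \<xi>}" by (intro nn_integral_indicator) auto
    finally show "finite {i\<in>I. P i \<xi>}" using elim(2) by (auto simp: emeasure_count_space split: if_splits)
  qed
qed

end

section \<open>Mass transport\<close>

locale utgraph = lf_graph +
  assumes transitive: "transitive_graph V E"
    and unimodular: "unimodular_graph V E"
begin

lemma AutE:
  assumes "x \<in> V" "y \<in> V"
  obtains \<phi> where "\<phi> \<in> Aut" "\<phi> x = y"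
  using transitive assms unfolding transitive_graph_def by blast

lemma Aut_adj_pow:
  assumes \<phi>: "\<phi> \<in> Aut"
  shows "(\<phi> x, \<phi> y) \<in> adj E ^^ n \<longleftrightarrow> (x, y) \<in> adj E ^^ n"
proof -
  have "pull \<phi> E = E" using Aut_edge[OF \<phi>] by (auto simp: pull_def)
  then show ?thesis using adj_pow_pull[OF \<phi>, of E x y n] by simp
qed

text \<open>If \<open>z\<close> is reached from \<open>w\<close> in \<open>n\<close> steps, its
  images are reached from \<open>x\<close> in \<open>n\<close> steps.\<close>

lemma finite_Aut_images:
  assumes "z \<in> V" "w \<in> V"
  shows "finite {\<phi> z | \<phi>. \<phi> \<in> Aut \<and> \<phi> w = x}"
proof -
  obtain n where "(w, z) \<in> adj E ^^ n" using reachable_V[OF assms(2,1)] by (auto simp: reachable_iff_adj)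
  then have "{\<phi> z | \<phi>. \<phi> \<in> Aut \<and> \<phi> w = x} \<subseteq> {y. (x, y) \<in> adj E ^^ n}"
    using Aut_adj_pow by blast
  then show ?thesis using finite_adj_ball[of E x n] finite_subset by blast
qed

text \<open>\<open>N y\<close> holds the points \<open>w\<close> for which some automorphism carries
  \<open>(o', y)\<close> to \<open>(w, o')\<close>. The mass \<open>f o' y = f w o'\<close> is
  spread evenly over \<open>N y\<close>. The relation is symmetric and unimodularity gives
  \<open>N y\<close> and \<open>N w\<close> the same size, so exchanging the two sums proves the
  claim.\<close>

lemma mass_transport:
  fixes f :: "'a \<Rightarrow> 'a \<Rightarrow> ennreal"
  assumes inv: "\<And>\<phi> x y. \<phi> \<in> Aut \<Longrightarrow> x \<in> V \<Longrightarrow> y \<in> V \<Longrightarrow> f (\<phi> x) (\<phi> y) = f x y" and o: "o' \<in> V"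
  shows "(\<integral>\<^sup>+y. f o' y \<partial>count_space V) = (\<integral>\<^sup>+y. f y o' \<partial>count_space V)"
proof -
  define N where "N y = {\<phi> o' | \<phi>. \<phi> \<in> Aut \<and> \<phi> y = o'}" for y
  have NV: "N y \<subseteq> V" for y using o by (auto simp: N_def Aut_in_V)
  have sym: "y \<in> N w" if "w \<in> N y" "y \<in> V" for y w
  proof -
    obtain \<phi> where \<phi>: "\<phi> \<in> Aut" "w = \<phi> o'" "\<phi> y = o'" using \<open>w \<in> N y\<close> by (auto simp: N_def)
    then have "inv \<phi> w = o'" "inv \<phi> o' = y" using Aut_bij[OF \<phi>(1)] by (auto simp: bij_is_inj inv_f_eq)
    then show ?thesis using Aut_inv[OF \<phi>(1)] unfolding N_def by blast
  qed
  have fin: "finite (N y)" if "y \<in> V" for y unfolding N_def by (rule finite_Aut_images[OF o that])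
  have ne: "N y \<noteq> {}" if y: "y \<in> V" for y using AutE[OF y o] by (auto simp: N_def)
  \<comment> \<open>An automorphism taking \<open>y\<close> to \<open>o'\<close> maps the orbit of
    \<open>o'\<close> under the stabilizer of \<open>y\<close> onto \<open>N y\<close>.\<close>
  have N1: "card (N y) = card (stab_orbit V E y o')" if y: "y \<in> V" for y
  proof -
    obtain \<phi> where \<phi>: "\<phi> \<in> Aut" "\<phi> y = o'" using AutE[OF y o] .
    have b: "bij \<phi>" by (rule Aut_bij[OF \<phi>(1)])
    have "N y = \<phi> ` stab_orbit V E y o'"
    proof (intro set_eqI iffI)
      fix w assume "w \<in> N y"
      then obtain \<psi> where \<psi>: "\<psi> \<in> Aut" "w = \<psi> o'" "\<psi> y = o'" by (auto simp: N_def)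
      have "inv \<phi> \<circ> \<psi> \<in> stab V E y"
        using Aut_comp[OF Aut_inv[OF \<phi>(1)] \<psi>(1)] \<psi>(3) \<phi>(2) b by (auto simp: stab_def bij_is_inj inv_f_eq)
      moreover have "w = \<phi> ((inv \<phi> \<circ> \<psi>) o')" using b \<psi>(2) by (simp add: bij_is_surj surj_f_inv_f)
      ultimately show "w \<in> \<phi> ` stab_orbit V E y o'" unfolding stab_orbit_def by blast
    next
      fix w assume "w \<in> \<phi> ` stab_orbit V E y o'"
      then obtain \<sigma> where \<sigma>: "\<sigma> \<in> Aut" "\<sigma> y = y" "w = \<phi> (\<sigma> o')" by (auto simp: stab_orbit_def stab_def)
      then have "(\<phi> \<circ> \<sigma>) y = o'" "w = (\<phi> \<circ> \<sigma>) o'" using \<phi>(2) by auto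
      then show "w \<in> N y" using Aut_comp[OF \<phi>(1) \<sigma>(1)] unfolding N_def by blast
    qed
    then show ?thesis using b by (simp add: card_image bij_is_inj inj_on_subset[OF _ subset_UNIV])
  qed
  \<comment> \<open>Conjugation by \<open>\<phi>\<close> carries the stabilizer of \<open>o'\<close>
    to that of \<open>w\<close>; unimodularity then exchanges the roles of \<open>o'\<close> and
    \<open>y\<close>.\<close>
  have N2: "card (N w) = card (N y)" if w: "w \<in> N y" and y: "y \<in> V" for w y
  proof -
    obtain \<phi> where \<phi>: "\<phi> \<in> Aut" "w = \<phi> o'" "\<phi> y = o'" using w by (auto simp: N_def)
    have b: "bij \<phi>" by (rule Aut_bij[OF \<phi>(1)])
    have wV: "w \<in> V" using w NV by blast
    have "stab_orbit V E w o' = \<phi> ` stab_orbit V E o' y"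
    proof (intro set_eqI iffI)
      fix z assume "z \<in> stab_orbit V E w o'"
      then obtain \<sigma> where \<sigma>: "\<sigma> \<in> Aut" "\<sigma> w = w" "z = \<sigma> o'" by (auto simp: stab_orbit_def stab_def)
      have "inv \<phi> \<circ> \<sigma> \<circ> \<phi> \<in> stab V E o'"
        using Aut_comp[OF Aut_comp[OF Aut_inv[OF \<phi>(1)] \<sigma>(1)] \<phi>(1)] \<sigma>(2) \<phi>(2) b
        by (auto simp: stab_def bij_is_inj inv_f_eq)
      moreover have "z = \<phi> ((inv \<phi> \<circ> \<sigma> \<circ> \<phi>) y)" using b \<sigma>(3) \<phi>(3) by (simp add: bij_is_surj surj_f_inv_f)
      ultimately show "z \<in> \<phi> ` stab_orbit V E o' y" unfolding stab_orbit_def by blast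
    next
      fix z assume "z \<in> \<phi> ` stab_orbit V E o' y"
      then obtain \<sigma> where \<sigma>: "\<sigma> \<in> Aut" "\<sigma> o' = o'" "z = \<phi> (\<sigma> y)" by (auto simp: stab_orbit_def stab_def)
      have "inv \<phi> w = o'" "inv \<phi> o' = y" using \<phi> b by (auto simp: bij_is_inj inv_f_eq)
      then have "\<phi> \<circ> \<sigma> \<circ> inv \<phi> \<in> stab V E w" "z = (\<phi> \<circ> \<sigma> \<circ> inv \<phi>) o'"
        using Aut_comp[OF Aut_comp[OF \<phi>(1) \<sigma>(1)] Aut_inv[OF \<phi>(1)]] \<sigma> \<phi>(2) by (auto simp: stab_def)
      then show "z \<in> stab_orbit V E w o'" unfolding stab_orbit_def by blast
    qed
    then have "card (stab_orbit V E w o') = card (stab_orbit V E o' y)"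
      using b by (simp add: card_image bij_is_inj inj_on_subset[OF _ subset_UNIV])
    then show ?thesis using N1[OF wV] N1[OF y] unimodular o y unfolding unimodular_graph_def by simp
  qed
  have feq: "f o' y = f w o'" if "w \<in> N y" "y \<in> V" for w y
  proof -
    obtain \<phi> where \<phi>: "\<phi> \<in> Aut" "w = \<phi> o'" "\<phi> y = o'" using \<open>w \<in> N y\<close> by (auto simp: N_def)
    then show ?thesis using inv[OF \<phi>(1) o \<open>y \<in> V\<close>] by simp
  qed
  have part: "(\<integral>\<^sup>+w. c / of_nat (card (N y)) * indicator (N y) w \<partial>count_space V) = c" if y: "y \<in> V" for y and c :: ennreal
  proof -
    have "card (N y) \<noteq> 0" using fin[OF y] ne[OF y] by simp
    then have n0: "of_nat (card (N y)) \<noteq> (0::ennreal)" by simp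
    have "(\<integral>\<^sup>+w. c / of_nat (card (N y)) * indicator (N y) w \<partial>count_space V) =
        c / of_nat (card (N y)) * of_nat (card (N y))"
      using NV[of y] fin[OF y] by (subst nn_integral_cmult_indicator) (auto simp: emeasure_count_space)
    also have "\<dots> = c" using n0 by (simp add: ennreal_divide_times ennreal_divide_self of_nat_less_top)
    finally show ?thesis .
  qed
  have "(\<integral>\<^sup>+y. f o' y \<partial>count_space V) =
      (\<integral>\<^sup>+y. \<integral>\<^sup>+w. f o' y / of_nat (card (N y)) * indicator (N y) w \<partial>count_space V \<partial>count_space V)"
    using part by (intro nn_integral_cong) simp
  also have "\<dots> = (\<integral>\<^sup>+w. \<integral>\<^sup>+y. f o' y / of_nat (card (N y)) * indicator (N y) w \<partial>count_space V \<partial>count_space V)"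
    by (rule nn_integral_count_space_nn_integral[OF countable_V]) simp
  also have "\<dots> = (\<integral>\<^sup>+w. \<integral>\<^sup>+y. f w o' / of_nat (card (N w)) * indicator (N w) y \<partial>count_space V \<partial>count_space V)"
  proof (intro nn_integral_cong)
    fix y w assume "w \<in> space (count_space V)" "y \<in> space (count_space V)"
    then have yw: "y \<in> V" "w \<in> V" by auto
    show "f o' y / of_nat (card (N y)) * indicator (N y) w = f w o' / of_nat (card (N w)) * indicator (N w) y"
    proof (cases "w \<in> N y")
      case True
      then show ?thesis using feq[OF True yw(1)] N2[OF True yw(1)] sym[OF True yw(1)] by simp
    next
      case False
      then have "y \<notin> N w" using sym[of y w] yw by blast
      then show ?thesis using False by simp
    qed
  qed
  also have "\<dots> = (\<integral>\<^sup>+w. f w o' \<partial>count_space V)"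
    using part by (intro nn_integral_cong) simp
  finally show ?thesis .
qed

lemma prob_nearest_relabel:
  assumes \<phi>: "\<phi> \<in> Aut" and A: "A \<subseteq> V"
  shows "emeasure labels {\<xi>\<in>space labels. nearest \<xi> (\<phi> v) = \<phi> ` A} = emeasure labels {\<xi>\<in>space labels. nearest \<xi> v = A}"
proof -
  have b: "bij \<phi>" by (rule Aut_bij[OF \<phi>])
  have "nearest \<xi> (\<phi> v) = \<phi> ` A \<longleftrightarrow> nearest (relabel \<phi> \<xi>) v = A" for \<xi>
  proof -
    have "nearest (relabel \<phi> \<xi>) v = \<phi> -` nearest \<xi> (\<phi> v)"
      using nearest_relabel[OF \<phi>] by auto
    then show ?thesis
      using b by (metis bij_is_inj bij_is_surj inj_vimage_image_eq surj_image_vimage_eq)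
  qed
  then show ?thesis
    using prob_relabel[OF \<phi> pred_nearest[OF A, of v]] by (simp add: labels.emeasure_eq_measure)
qed

text \<open>Each vertex divides mass 1 equally among its nearest bridge endpoints. By mass transport
  a point \<open>y\<close> receives at most 1 in expectation. If \<open>y\<close> is in
  \<open>A\<close>, the event \<open>nearest \<xi> v = A\<close> contributes its probability divided
  by \<open>card A\<close>, so the sum is at most \<open>card A\<close>.\<close>

lemma summable_nearest:
  assumes A: "finite A" "A \<noteq> {}" "A \<subseteq> V"
  shows "(\<integral>\<^sup>+v. emeasure labels {\<xi>\<in>space labels. nearest \<xi> v = A} \<partial>count_space V) < \<infinity>"
proof -
  define Fin where "Fin = {A. finite A \<and> A \<noteq> {} \<and> A \<subseteq> V}"
  have cF: "countable Fin"
    by (rule countable_subset[OF _ countable_finite_subsets]) (auto simp: Fin_def)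
  define q where "q v A = emeasure labels {\<xi>\<in>space labels. nearest \<xi> v = A}" for v A
  \<comment> \<open>The expected mass sent from \<open>v\<close> to \<open>y\<close>, split by the
    value of the nearest set.\<close>
  define f where "f v y = (\<integral>\<^sup>+A. q v A / of_nat (card A) * indicator A y \<partial>count_space Fin)" for v y
  have inv: "f (\<phi> v) (\<phi> y) = f v y" if \<phi>: "\<phi> \<in> Aut" for \<phi> v y
  proof -
    have b: "bij \<phi>" by (rule Aut_bij[OF \<phi>])
    have bF: "bij_betw ((`) \<phi>) Fin Fin"
    proof (rule bij_betw_imageI)
      show "inj_on ((`) \<phi>) Fin"
        using inj_image_eq_iff[OF bij_is_inj[OF b]] by (auto simp: inj_on_def)
      show "(`) \<phi> ` Fin = Fin"
      proof (intro equalityI subsetI)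
        fix B assume "B \<in> (`) \<phi> ` Fin"
        then show "B \<in> Fin" using Aut_in_V[OF \<phi>] by (auto simp: Fin_def)
      next
        fix B assume B: "B \<in> Fin"
        have im: "\<phi> ` (\<phi> -` B) = B" using b by (simp add: bij_is_surj surj_image_vimage_eq)
        moreover from this have "\<phi> -` B \<noteq> {}" using B by (metis (mono_tags) Fin_def image_empty mem_Collect_eq)
        then have "\<phi> -` B \<in> Fin"
          using B im Aut_in_V[OF \<phi>] finite_vimageI[OF _ bij_is_inj[OF b]] by (auto simp: Fin_def)
        ultimately show "B \<in> (`) \<phi> ` Fin" by (metis imageI)
      qed
    qed
    have "f (\<phi> v) (\<phi> y) = (\<integral>\<^sup>+A. q (\<phi> v) (\<phi> ` A) / of_nat (card (\<phi> ` A)) * indicator (\<phi> ` A) (\<phi> y) \<partial>count_space Fin)"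
      unfolding f_def by (rule nn_integral_bij_count_space[OF bF, symmetric])
    also have "\<dots> = f v y"
      unfolding f_def
    proof (intro nn_integral_cong)
      fix A assume "A \<in> space (count_space Fin)"
      then have "A \<subseteq> V" by (simp add: Fin_def)
      moreover have "card (\<phi> ` A) = card A" using b by (intro card_image) (meson bij_is_inj inj_on_subset subset_UNIV)
      moreover have "indicator (\<phi> ` A) (\<phi> y) = (indicator A y :: ennreal)"
        using bij_is_inj[OF b] by (simp add: indicator_def inj_image_mem_iff)
      ultimately show "q (\<phi> v) (\<phi> ` A) / of_nat (card (\<phi> ` A)) * indicator (\<phi> ` A) (\<phi> y) =
          q v A / of_nat (card A) * indicator A y"
        using prob_nearest_relabel[OF \<phi>] by (simp add: q_def)
    qed
    finally show ?thesis .
  qed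
  obtain y where y: "y \<in> A" "y \<in> V" using A by blast
  have cancel: "c / of_nat (card B) * of_nat (card B) = c" if "B \<in> Fin" for B and c :: ennreal
  proof -
    have "of_nat (card B) \<noteq> (0::ennreal)" using that by (auto simp: Fin_def)
    then show ?thesis by (simp add: ennreal_divide_times ennreal_divide_self of_nat_less_top)
  qed
  have "(\<integral>\<^sup>+v. f v y \<partial>count_space V) = (\<integral>\<^sup>+v. f y v \<partial>count_space V)"
    by (rule mass_transport[OF inv y(2), symmetric])
  also have "\<dots> = (\<integral>\<^sup>+B. \<integral>\<^sup>+v. q y B / of_nat (card B) * indicator B v \<partial>count_space V \<partial>count_space Fin)"
    unfolding f_def by (rule nn_integral_count_space_nn_integral[OF cF]) simp
  also have "\<dots> = (\<integral>\<^sup>+B. q y B \<partial>count_space Fin)"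
  proof (intro nn_integral_cong)
    fix B assume "B \<in> space (count_space Fin)"
    then have B: "B \<in> Fin" by simp
    then have "finite B" "B \<subseteq> V" by (auto simp: Fin_def)
    then have "(\<integral>\<^sup>+v. q y B / of_nat (card B) * indicator B v \<partial>count_space V) = q y B / of_nat (card B) * of_nat (card B)"
      by (subst nn_integral_cmult_indicator) (auto simp: emeasure_count_space)
    then show "(\<integral>\<^sup>+v. q y B / of_nat (card B) * indicator B v \<partial>count_space V) = q y B"
      using cancel[OF B] by simp
  qed
  also have "\<dots> = emeasure labels (\<Union>B\<in>Fin. {\<xi>\<in>space labels. nearest \<xi> y = B})"
    unfolding q_def
    by (rule emeasure_UN_countable[symmetric])
       (use cF pred_nearest in \<open>auto simp: pred_def Fin_def disjoint_family_on_def\<close>)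
  also have "\<dots> \<le> 1" by (rule labels.measure_le_1)
  finally have le: "(\<integral>\<^sup>+v. f v y \<partial>count_space V) \<le> 1" .
  have AF: "A \<in> Fin" using A by (simp add: Fin_def)
  have "q v A \<le> of_nat (card A) * f v y" for v
  proof -
    have "q v A / of_nat (card A) = (\<integral>\<^sup>+B. (q v B / of_nat (card B) * indicator B y) * indicator {A} B \<partial>count_space Fin)"
      using AF y by (subst nn_integral_count_space'[of "{A}"]) (auto simp: indicator_def)
    also have "\<dots> \<le> f v y" unfolding f_def by (intro nn_integral_mono) (auto simp: indicator_def)
    finally have "q v A / of_nat (card A) * of_nat (card A) \<le> f v y * of_nat (card A)"
      by (rule mult_right_mono) simp
    then show ?thesis using cancel[OF AF] by (simp add: mult.commute)
  qed
  then have "(\<integral>\<^sup>+v. q v A \<partial>count_space V) \<le> (\<integral>\<^sup>+v. of_nat (card A) * f v y \<partial>count_space V)"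
    by (intro nn_integral_mono)
  also have "\<dots> = of_nat (card A) * (\<integral>\<^sup>+v. f v y \<partial>count_space V)"
    by (rule nn_integral_cmult) simp
  also have "\<dots> \<le> of_nat (card A) * 1" by (intro mult_left_mono le) simp
  also have "\<dots> < \<infinity>" by (simp add: of_nat_less_top)
  finally show ?thesis unfolding q_def .
qed

lemma AE_balanced: "AE \<xi> in labels. balanced \<xi>"
proof -
  have "AE \<xi> in labels. \<forall>A\<in>{A. finite A \<and> A \<subseteq> V}. A \<noteq> {} \<longrightarrow> finite {v\<in>V. nearest \<xi> v = A}"
  proof (rule AE_ball_countable'[OF _ countable_finite_subsets])
    fix A assume "A \<in> {A. finite A \<and> A \<subseteq> V}"
    then have A: "finite A" "A \<subseteq> V" by auto
    show "AE \<xi> in labels. A \<noteq> {} \<longrightarrow> finite {v\<in>V. nearest \<xi> v = A}"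
    proof (cases "A = {}")
      case False
      then have "AE \<xi> in labels. finite {v\<in>V. nearest \<xi> v = A}"
        using A by (intro AE_finite_of_summable countable_V pred_nearest summable_nearest)
      then show ?thesis by eventually_elim simp
    qed simp
  qed
  then show ?thesis
  proof eventually_elim
    case (elim \<xi>)
    show ?case unfolding balanced_def
    proof (rule notI, elim exE conjE)
      fix A assume A: "finite A" "A \<noteq> {}" "infinite {v\<in>V. nearest \<xi> v = A}"
      then obtain v where "nearest \<xi> v = A" using not_finite_existsD by auto
      then have "A \<subseteq> V" using nearest_subset_V by blast
      then show False using elim A by blast
    qed
  qed
qed

end

lemma (in prob_space) prob_sym_diff_diff:
  assumes "A \<in> events" "B \<in> events"
  shows "\<bar>prob A - prob B\<bar> \<le> prob (sym_diff A B)"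
proof -
  have "prob A \<le> prob (B \<union> sym_diff A B)" "prob B \<le> prob (A \<union> sym_diff A B)"
    using assms by (auto intro!: finite_measure_mono)
  moreover have "prob (B \<union> sym_diff A B) \<le> prob B + prob (sym_diff A B)"
    "prob (A \<union> sym_diff A B) \<le> prob A + prob (sym_diff A B)"
    using assms by (auto intro!: measure_Un_le)
  ultimately show ?thesis by linarith
qed

context lf_graph
begin

section \<open>Ergodicity\<close>

abbreviation event :: "(('a set \<Rightarrow> real) \<Rightarrow> bool) \<Rightarrow> ('a set \<Rightarrow> real) set" where
  "event P \<equiv> {\<xi>\<in>space labels. P \<xi>}"

lemma depends_onD:
  assumes "depends_on P J" "\<xi> \<in> space labels" "\<xi>' \<in> space labels"
    and eq: "\<And>e. e \<in> J \<Longrightarrow> e \<in> E \<Longrightarrow> \<xi> e = \<xi>' e"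
  shows "P \<xi> = P \<xi>'"
  by (rule mp[OF bspec[OF bspec[OF assms(1)[unfolded depends_on_def] assms(2)] assms(3)]])
     (intro ballI, elim IntE, rule eq)

lemma depends_on_bex:
  assumes "\<And>n. n \<in> I \<Longrightarrow> depends_on (P n) (J n)"
  shows "depends_on (\<lambda>\<xi>. \<exists>n\<in>I. P n \<xi>) (\<Union>n\<in>I. J n)"
  unfolding depends_on_def
proof (intro ballI impI bex_cong refl)
  fix \<xi> \<xi>' n assume "\<xi> \<in> space labels" "\<xi>' \<in> space labels" "\<forall>e\<in>(\<Union>n\<in>I. J n) \<inter> E. \<xi> e = \<xi>' e" "n \<in> I"
  then show "P n \<xi> = P n \<xi>'" by (intro depends_onD[OF assms]) auto
qed

text \<open>The approximable events contain the generating cylinders and are closed under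
  complements and countable unions.\<close>

lemma local_approximation:
  assumes A: "A \<in> sets labels" and \<epsilon>: "\<epsilon> > 0"
  shows "\<exists>J P. finite J \<and> Measurable.pred labels P \<and> depends_on P J \<and> labels.prob (sym_diff A (event P)) < \<epsilon>"
proof -
  let ?G = "{{f\<in>\<Pi>\<^sub>E i\<in>E. space unif. f i \<in> A} | i A. i \<in> E \<and> A \<in> sets unif}"
  have S: "sets labels = sigma_sets (space labels) ?G"
    unfolding labels_def by (subst sets_PiM_single) (simp add: space_PiM)
  have "A \<in> sigma_sets (space labels) ?G" using A S by simp
  then have "\<forall>\<epsilon>>0. \<exists>J P. finite J \<and> Measurable.pred labels P \<and> depends_on P J \<and> labels.prob (sym_diff A (event P)) < \<epsilon>"
  proof (induction rule: sigma_sets.induct)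
    case (Basic a)
    then obtain i B where iB: "i \<in> E" "B \<in> sets unif" "a = {f\<in>\<Pi>\<^sub>E i\<in>E. space unif. f i \<in> B}" by auto
    have "a = event (\<lambda>\<xi>. \<xi> i \<in> B)" by (simp add: iB space_labels)
    moreover have "Measurable.pred labels (\<lambda>\<xi>. \<xi> i \<in> B)"
      using iB(2) sets_unif by (intro pred_sets1[OF _ measurable_label[OF iB(1)]]) simp
    moreover have "depends_on (\<lambda>\<xi>. \<xi> i \<in> B) {i}" using iB by (auto simp: depends_on_def)
    ultimately show ?case by (intro allI impI exI[of _ "{i}"] exI[of _ "\<lambda>\<xi>. \<xi> i \<in> B"]) auto
  next
    case Empty
    show ?case by (intro allI impI exI[of _ "{}"] exI[of _ "\<lambda>_. False"]) (auto simp: depends_on_def)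
  next
    case (Compl a)
    show ?case
    proof (intro allI impI)
      fix \<epsilon> :: real assume "\<epsilon> > 0"
      then obtain J P where P: "finite J" "Measurable.pred labels P" "depends_on P J"
        "labels.prob (sym_diff a (event P)) < \<epsilon>" using Compl by blast
      have "a \<subseteq> space labels" using Compl.hyps S sets.sets_into_space by blast
      then have "sym_diff (space labels - a) (event (\<lambda>\<xi>. \<not> P \<xi>)) = sym_diff a (event P)" by auto
      then show "\<exists>J P. finite J \<and> Measurable.pred labels P \<and> depends_on P J \<and>
          labels.prob (sym_diff (space labels - a) (event P)) < \<epsilon>"
        using P by (intro exI[of _ J] exI[of _ "\<lambda>\<xi>. \<not> P \<xi>"]) (auto intro: depends_on_not)
    qed
  next
    case (Union a)
    have a: "a n \<in> sets labels" for n using Union.hyps S by simp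
    show ?case
    proof (intro allI impI)
      fix \<epsilon> :: real assume \<epsilon>: "\<epsilon> > 0"
      let ?U = "\<Union>n. a n" and ?F = "\<lambda>N. \<Union>n<N. a n"
      have "(\<lambda>N. labels.prob (?F N)) \<longlonglongrightarrow> labels.prob (\<Union>N. ?F N)"
      proof (rule labels.finite_Lim_measure_incseq)
        show "incseq ?F" by (intro incseq_SucI UN_mono) auto
      qed (use a in auto)
      moreover have "(\<Union>N. ?F N) = ?U" by blast
      ultimately have "(\<lambda>N. labels.prob (?F N)) \<longlonglongrightarrow> labels.prob ?U" by simp
      then obtain N where "\<bar>labels.prob (?F N) - labels.prob ?U\<bar> < \<epsilon> / 2"
        using LIMSEQ_D[of _ _ "\<epsilon> / 2"] \<epsilon> by fastforce
      moreover have "labels.prob (?U - ?F N) = labels.prob ?U - labels.prob (?F N)"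
        using a by (intro labels.finite_measure_Diff) auto
      ultimately have N: "labels.prob (?U - ?F N) < \<epsilon> / 2" by linarith
      \<comment> \<open>Half of \<open>\<epsilon>\<close> pays for cutting the union at
        \<open>N\<close>, the other half is shared by the \<open>N\<close> approximations;
        \<open>Suc N\<close> avoids division by zero.\<close>
      have "\<forall>n. \<exists>J P. finite J \<and> Measurable.pred labels P \<and> depends_on P J \<and>
          labels.prob (sym_diff (a n) (event P)) < \<epsilon> / (2 * Suc N)"
        using Union.IH \<epsilon> by auto
      from choice[OF this] obtain J where "\<forall>n. \<exists>P. finite (J n) \<and> Measurable.pred labels P \<and> depends_on P (J n) \<and>
          labels.prob (sym_diff (a n) (event P)) < \<epsilon> / (2 * Suc N)" ..
      from choice[OF this] obtain P where "\<forall>n. finite (J n) \<and> Measurable.pred labels (P n) \<and> depends_on (P n) (J n) \<and>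
          labels.prob (sym_diff (a n) (event (P n))) < \<epsilon> / (2 * Suc N)" ..
      then have P: "\<And>n. finite (J n)" "\<And>n. Measurable.pred labels (P n)" "\<And>n. depends_on (P n) (J n)"
          "\<And>n. labels.prob (sym_diff (a n) (event (P n))) < \<epsilon> / (2 * Suc N)" by simp_all
      let ?P = "\<lambda>\<xi>. \<exists>n\<in>{..<N}. P n \<xi>"
      have ev: "event (P n) \<in> sets labels" for n using P(2) by (simp add: pred_def)
      have mP: "Measurable.pred labels ?P" by (intro pred_countable_bounded P) auto
      have sub: "sym_diff ?U (event ?P) \<subseteq> (?U - ?F N) \<union> (\<Union>n<N. sym_diff (a n) (event (P n)))"
      proof
        fix \<xi> assume "\<xi> \<in> sym_diff ?U (event ?P)"
        then consider "\<xi> \<in> ?U" "\<xi> \<notin> event ?P" | "\<xi> \<in> event ?P" "\<xi> \<notin> ?U" by blast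
        then show "\<xi> \<in> (?U - ?F N) \<union> (\<Union>n<N. sym_diff (a n) (event (P n)))"
        proof cases
          case 1
          show ?thesis
          proof (cases "\<xi> \<in> ?F N")
            case True
            then obtain n where n: "n < N" "\<xi> \<in> a n" by blast
            then have "\<xi> \<notin> event (P n)" using 1(2) by auto
            then show ?thesis using n by blast
          qed (use 1 in blast)
        next
          case 2
          then obtain n where n: "n < N" "\<xi> \<in> event (P n)" by auto
          then have "\<xi> \<notin> a n" using 2(2) by blast
          then show ?thesis using n by blast
        qed
      qed
      have "labels.prob (sym_diff ?U (event ?P)) \<le> labels.prob ((?U - ?F N) \<union> (\<Union>n<N. sym_diff (a n) (event (P n))))"
        using a ev by (intro labels.finite_measure_mono sub sets.Un sets.Diff sets.finite_UN sets.countable_UN) auto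
      also have "\<dots> \<le> labels.prob (?U - ?F N) + labels.prob (\<Union>n<N. sym_diff (a n) (event (P n)))"
        using a ev by (intro measure_Un_le) auto
      also have "labels.prob (\<Union>n<N. sym_diff (a n) (event (P n))) \<le> (\<Sum>n<N. labels.prob (sym_diff (a n) (event (P n))))"
        using a ev by (intro labels.finite_measure_subadditive_finite) auto
      also have "\<dots> \<le> (\<Sum>n<N. \<epsilon> / (2 * Suc N))"
        using P(4) by (intro sum_mono less_imp_le) auto
      also have "\<dots> = real N * (\<epsilon> / (2 * Suc N))" by simp
      also have "\<dots> \<le> \<epsilon> / 2" using \<epsilon> by (simp add: field_simps)
      finally have "labels.prob (sym_diff ?U (event ?P)) < \<epsilon>" using N by linarith
      moreover have "depends_on ?P (\<Union>n<N. J n)"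
        using P(3) by (intro depends_on_bex)
      ultimately show "\<exists>J P. finite J \<and> Measurable.pred labels P \<and> depends_on P J \<and>
          labels.prob (sym_diff ?U (event P)) < \<epsilon>"
        using P(1) mP by (intro exI[of _ "\<Union>n<N. J n"] exI[of _ ?P]) auto
    qed
  qed
  then show ?thesis using \<epsilon> by blast
qed

lemma pred_relabel: "\<phi> \<in> Aut \<Longrightarrow> Measurable.pred labels P \<Longrightarrow> Measurable.pred labels (\<lambda>\<xi>. P (relabel \<phi> \<xi>))"
  by (rule measurable_compose[OF relabel_measurable])

lemma depends_on_relabel:
  assumes \<phi>: "\<phi> \<in> Aut" and P: "depends_on P J"
  shows "depends_on (\<lambda>\<xi>. P (relabel \<phi> \<xi>)) ((`) \<phi> ` J)"
  unfolding depends_on_def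
proof (intro ballI impI)
  fix \<xi> \<xi>' assume \<xi>: "\<xi> \<in> space labels" "\<xi>' \<in> space labels" "\<forall>e\<in>(`) \<phi> ` J \<inter> E. \<xi> e = \<xi>' e"
  have "relabel \<phi> \<xi> e = relabel \<phi> \<xi>' e" if "e \<in> J \<inter> E" for e
    using that \<xi>(3) Aut_edge[OF \<phi>, of e] by (auto simp: relabel_def)
  moreover have "relabel \<phi> \<xi> \<in> space labels" "relabel \<phi> \<xi>' \<in> space labels"
    using \<xi> measurable_space[OF relabel_measurable[OF \<phi>]] by auto
  ultimately show "P (relabel \<phi> \<xi>) = P (relabel \<phi> \<xi>')" using P unfolding depends_on_def by blast
qed

end

context utgraph
begin

text \<open>Automorphisms that carry some endpoint of \<open>J\<close> to an endpoint of
  \<open>J\<close> send \<open>o'\<close> to only finitely many places, and \<open>V\<close> is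
  infinite.\<close>

lemma Aut_disjoint:
  assumes "finite J" "J \<subseteq> E"
  obtains \<phi> where "\<phi> \<in> Aut" "(`) \<phi> ` J \<inter> J = {}"
proof -
  obtain o' where o: "o' \<in> V" using V_nonempty by blast
  let ?S = "\<Union> J"
  have S: "finite ?S" "?S \<subseteq> V" using assms finite_edge edge_subset by blast+
  let ?B = "\<Union>z\<in>?S. \<Union>x\<in>?S. {\<phi> o' | \<phi>. \<phi> \<in> Aut \<and> \<phi> z = x}"
  have "finite ?B" using S o by (intro finite_UN_I finite_Aut_images) auto
  then obtain y where y: "y \<in> V" "y \<notin> ?B" using infinite_V by (meson finite_subset subsetI)
  obtain \<phi> where \<phi>: "\<phi> \<in> Aut" "\<phi> o' = y" using AutE[OF o y(1)] .
  have "(`) \<phi> ` J \<inter> J = {}"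
  proof (rule ccontr)
    assume "(`) \<phi> ` J \<inter> J \<noteq> {}"
    then obtain e where e: "e \<in> J" "\<phi> ` e \<in> J" by blast
    then have "e \<in> E" using assms by blast
    then have "e \<noteq> {}" by (elim edgeE) simp
    then obtain z where z: "z \<in> e" by auto
    have "z \<in> ?S" "\<phi> z \<in> ?S" using e z by auto
    then have "\<phi> o' \<in> ?B" using \<phi>(1) by blast
    then show False using y \<phi> by simp
  qed
  with \<phi> show thesis using that by blast
qed

text \<open>Approximate \<open>P\<close> by an event \<open>R\<close> of finitely many labels and
  move \<open>R\<close> to a disjoint set of edges. By invariance \<open>P\<close> is close to the
  conjunction of the two copies, which are independent, so \<open>p = p ^ 2\<close> for its
  probability \<open>p\<close>.\<close>

lemma zero_one:
  assumes P: "Measurable.pred labels P" and inv: "\<And>\<phi> \<xi>. \<phi> \<in> Aut \<Longrightarrow> P (relabel \<phi> \<xi>) = P \<xi>"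
    and pos: "\<not> (AE \<xi> in labels. \<not> P \<xi>)"
  shows "AE \<xi> in labels. P \<xi>"
proof -
  let ?p = "labels.prob (event P)"
  have evP: "event P \<in> sets labels" using P by (simp add: pred_def)
  \<comment> \<open>Half of the bound comes from replacing \<open>P\<close> by the conjunction, half
    from replacing \<open>?r ^ 2\<close> by \<open>?p ^ 2\<close>, where the factor
    \<open>?r + ?p\<close> is at most 2.\<close>
  have close: "\<bar>?p - ?p ^ 2\<bar> < 4 * \<epsilon>" if \<epsilon>: "\<epsilon> > 0" for \<epsilon>
  proof -
    obtain J R where R: "finite J" "Measurable.pred labels R" "depends_on R J"
      "labels.prob (sym_diff (event P) (event R)) < \<epsilon>"
      using local_approximation[OF evP \<epsilon>] by blast
    have R': "depends_on R (J \<inter> E)" using R(3) unfolding depends_on_def by (simp only: Int_assoc Int_absorb)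
    obtain \<phi> where \<phi>: "\<phi> \<in> Aut" "(`) \<phi> ` (J \<inter> E) \<inter> (J \<inter> E) = {}"
      using Aut_disjoint[of "J \<inter> E"] R(1) by auto
    let ?R = "\<lambda>\<xi>. R (relabel \<phi> \<xi>)"
    have mR: "Measurable.pred labels ?R" by (rule pred_relabel[OF \<phi>(1) R(2)])
    have ev: "event R \<in> sets labels" "event ?R \<in> sets labels" "event (\<lambda>\<xi>. R \<xi> \<and> ?R \<xi>) \<in> sets labels"
      using R(2) mR by (simp_all add: pred_def)
    let ?r = "labels.prob (event R)"
    have pr: "\<bar>?p - ?r\<bar> < \<epsilon>" using labels.prob_sym_diff_diff[OF evP ev(1)] R(4) by linarith
    have "labels.prob (event (\<lambda>\<xi>. R \<xi> \<and> ?R \<xi>)) = ?r * labels.prob (event ?R)"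
      using \<phi>(2) by (intro prob_indep2[OF R(2) mR R' depends_on_relabel[OF \<phi>(1) R']]) auto
    then have rr: "labels.prob (event (\<lambda>\<xi>. R \<xi> \<and> ?R \<xi>)) = ?r ^ 2"
      using prob_relabel[OF \<phi>(1) R(2)] by (simp add: power2_eq_square)
    let ?D = "\<lambda>\<xi>. P \<xi> \<noteq> R \<xi>"
    have D: "sym_diff (event P) (event R) = event ?D" by auto
    have mD: "Measurable.pred labels ?D" using P R(2) by simp
    have D': "labels.prob (event (\<lambda>\<xi>. ?D (relabel \<phi> \<xi>))) < \<epsilon>"
      using prob_relabel[OF \<phi>(1) mD] R(4) D by simp
    have evD: "event ?D \<in> sets labels" "event (\<lambda>\<xi>. ?D (relabel \<phi> \<xi>)) \<in> sets labels"
      using mD pred_relabel[OF \<phi>(1) mD] by (simp_all add: pred_def)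
    have "\<bar>?p - ?r ^ 2\<bar> \<le> labels.prob (sym_diff (event P) (event (\<lambda>\<xi>. R \<xi> \<and> ?R \<xi>)))"
      using labels.prob_sym_diff_diff[OF evP ev(3)] rr by simp
    also have "\<dots> \<le> labels.prob (event ?D \<union> event (\<lambda>\<xi>. ?D (relabel \<phi> \<xi>)))"
    proof (rule labels.finite_measure_mono)
      show "sym_diff (event P) (event (\<lambda>\<xi>. R \<xi> \<and> ?R \<xi>)) \<subseteq> event ?D \<union> event (\<lambda>\<xi>. ?D (relabel \<phi> \<xi>))"
      proof
        fix \<xi> assume "\<xi> \<in> sym_diff (event P) (event (\<lambda>\<xi>. R \<xi> \<and> ?R \<xi>))"
        then have 2: "\<xi> \<in> space labels" "P \<xi> \<noteq> (R \<xi> \<and> ?R \<xi>)" by blast+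
        have 3: "P (relabel \<phi> \<xi>) = P \<xi>" by (rule inv[OF \<phi>(1)])
        show "\<xi> \<in> event ?D \<union> event (\<lambda>\<xi>. ?D (relabel \<phi> \<xi>))"
        proof (cases "P \<xi> = R \<xi>")
          case True
          then have "P (relabel \<phi> \<xi>) \<noteq> ?R \<xi>" using 2(2) 3 by argo
          then show ?thesis using 2(1) by simp
        qed (use 2 in simp)
      qed
    qed (rule sets.Un[OF evD])
    also have "\<dots> \<le> labels.prob (event ?D) + labels.prob (event (\<lambda>\<xi>. ?D (relabel \<phi> \<xi>)))"
      using evD by (intro measure_Un_le)
    also have "\<dots> < 2 * \<epsilon>" using D' R(4) D by simp
    finally have 1: "\<bar>?p - ?r ^ 2\<bar> < 2 * \<epsilon>" .
    have "?r ^ 2 - ?p ^ 2 = (?r - ?p) * (?r + ?p)"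
      by (simp add: power2_eq_square algebra_simps)
    then have "\<bar>?r ^ 2 - ?p ^ 2\<bar> = \<bar>?r - ?p\<bar> * \<bar>?r + ?p\<bar>" by (simp only: abs_mult)
    also have "\<dots> \<le> \<epsilon> * 2"
    proof (rule mult_mono)
      show "\<bar>?r - ?p\<bar> \<le> \<epsilon>" using pr by linarith
      have "0 \<le> ?r" "0 \<le> ?p" "?r \<le> 1" "?p \<le> 1" by simp_all
      then show "\<bar>?r + ?p\<bar> \<le> 2" by linarith
    qed (use \<epsilon> in auto)
    finally show ?thesis using 1 by linarith
  qed
  have "?p = ?p ^ 2"
  proof (rule ccontr)
    assume "?p \<noteq> ?p ^ 2"
    then show False using close[of "\<bar>?p - ?p ^ 2\<bar> / 4"] by simp
  qed
  then have "?p = 0 \<or> ?p = 1" by (simp add: power2_eq_square)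
  moreover have "?p \<noteq> 0"
  proof
    assume "?p = 0"
    then have "AE \<xi> in labels. \<xi> \<notin> event P"
      using labels.prob_eq_0[OF evP] by simp
    with AE_space have "AE \<xi> in labels. \<not> P \<xi>" by eventually_elim auto
    then show False using pos by simp
  qed
  ultimately have "?p = 1" by simp
  then have "AE \<xi> in labels. \<xi> \<in> event P" using labels.prob_eq_1[OF evP] by simp
  then show ?thesis by eventually_elim simp
qed

lemma AE_bridges:
  assumes "\<not> (AE \<xi> in labels. bridges \<xi> = {})"
  shows "AE \<xi> in labels. bridges \<xi> \<noteq> {}"
proof (rule zero_one)
  have "bridges \<xi> \<noteq> {} \<longleftrightarrow> (\<exists>e\<in>E. e \<in> bridges \<xi>)" for \<xi> using bridges_subset forest_subset by blast
  moreover have "Measurable.pred labels (\<lambda>\<xi>. \<exists>e\<in>E. e \<in> bridges \<xi>)"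
    by (intro pred_countable_bounded countable_E random_edgesD[OF random_bridges])
  ultimately show "Measurable.pred labels (\<lambda>\<xi>. bridges \<xi> \<noteq> {})" by presburger
  fix \<phi> \<xi> assume \<phi>: "\<phi> \<in> Aut"
  have "bridges \<xi> \<noteq> {} \<longleftrightarrow> \<Union> (bridges \<xi>) \<noteq> {}" for \<xi>
  proof -
    have "e \<noteq> {}" if "e \<in> bridges \<xi>" for e
    proof -
      have "e \<in> E" using that bridges_subset forest_subset by blast
      then show ?thesis by (elim edgeE) simp
    qed
    then show ?thesis by auto
  qed
  moreover have "\<Union> (bridges (relabel \<phi> \<xi>)) = \<phi> -` \<Union> (bridges \<xi>)"
    using bridge_endpoint_relabel[OF \<phi>] by (intro set_eqI) (simp only: vimage_eq)
  ultimately show "(bridges (relabel \<phi> \<xi>) \<noteq> {}) = (bridges \<xi> \<noteq> {})"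
    using Aut_bij[OF \<phi>] by (metis bij_is_surj surj_image_vimage_eq image_empty vimage_empty)
next
  show "\<not> (AE \<xi> in labels. \<not> bridges \<xi> \<noteq> {})" using assms by simp
qed

lemma AE_inf_verts:
  assumes "\<not> (AE \<xi> in labels. inf_verts \<xi> s = {})"
  shows "AE \<xi> in labels. inf_verts \<xi> s \<noteq> {}"
proof (rule zero_one)
  have "inf_verts \<xi> s \<noteq> {} \<longleftrightarrow> (\<exists>x\<in>V. x \<in> inf_verts \<xi> s)" for \<xi> using inf_verts_subset by blast
  moreover have "Measurable.pred labels (\<lambda>\<xi>. \<exists>x\<in>V. x \<in> inf_verts \<xi> s)"
    by (intro pred_countable_bounded countable_V pred_inf_verts)
  ultimately show "Measurable.pred labels (\<lambda>\<xi>. inf_verts \<xi> s \<noteq> {})" by presburger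
  fix \<phi> \<xi> assume \<phi>: "\<phi> \<in> Aut"
  have "inf_verts (relabel \<phi> \<xi>) s = \<phi> -` inf_verts \<xi> s"
    using inf_verts_relabel[OF \<phi>] by auto
  then show "(inf_verts (relabel \<phi> \<xi>) s \<noteq> {}) = (inf_verts \<xi> s \<noteq> {})"
    using Aut_bij[OF \<phi>] by (metis bij_is_surj surj_image_vimage_eq image_empty vimage_empty)
next
  show "\<not> (AE \<xi> in labels. \<not> inf_verts \<xi> s \<noteq> {})" using assms by simp
qed

end

text \<open>Greedy choice: each chosen point discards at most \<open>c\<close> points of
  \<open>X\<close>, itself included.\<close>

lemma independent_subset:
  assumes "finite X" "\<And>y. y \<in> X \<Longrightarrow> card {y'\<in>X. conf y y'} \<le> c" "M * c \<le> card X" "0 < c"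
    and conf: "\<And>y. conf y y" "\<And>y y'. conf y y' \<Longrightarrow> conf y' y"
  shows "\<exists>Y\<subseteq>X. card Y = M \<and> (\<forall>y\<in>Y. \<forall>y'\<in>Y. y \<noteq> y' \<longrightarrow> \<not> conf y y')"
  using assms(1-3)
proof (induction M arbitrary: X)
  case 0
  then show ?case by (intro exI[of _ "{}"]) auto
next
  case (Suc M)
  then have "X \<noteq> {}" using \<open>0 < c\<close> by auto
  then obtain y where y: "y \<in> X" by blast
  let ?X = "X - {y'\<in>X. conf y y'}"
  have "card ?X = card X - card {y'\<in>X. conf y y'}"
    using Suc.prems(1) by (intro card_Diff_subset) auto
  then have "M * c \<le> card ?X" using Suc.prems(2)[OF y] Suc.prems(3) by simp
  moreover have "card {y''\<in>?X. conf y' y''} \<le> c" if "y' \<in> ?X" for y'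
    using that Suc.prems(1,2) card_mono[of "{y''\<in>X. conf y' y''}" "{y''\<in>?X. conf y' y''}"] by fastforce
  ultimately obtain Y where Y: "Y \<subseteq> ?X" "card Y = M" "\<And>z z'. z \<in> Y \<Longrightarrow> z' \<in> Y \<Longrightarrow> z \<noteq> z' \<Longrightarrow> \<not> conf z z'"
    using Suc.IH[of ?X] Suc.prems(1) by blast
  have "y \<notin> Y" using Y(1) y conf(1) by blast
  moreover have "finite Y" using Y(1) Suc.prems(1) finite_subset by blast
  ultimately have "card (insert y Y) = Suc M" using Y(2) by simp
  moreover have "\<not> conf y z \<and> \<not> conf z y" if "z \<in> Y" for z
    using that Y(1) conf(2) by blast
  ultimately show ?case using Y y by (intro exI[of _ "insert y Y"]) auto
qed

context lf_graph
begin

section \<open>Infinite clusters near large finite sets\<close>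

text \<open>Along an exhaustion of \<open>V\<close> by finite sets the bad events decrease to the
  empty event, since a finite set is contained in some stage.\<close>

lemma tight_finite_sets:
  assumes A: "\<And>\<xi>. A \<xi> \<subseteq> V" "\<And>y. Measurable.pred labels (\<lambda>\<xi>. y \<in> A \<xi>)" and \<epsilon>: "\<epsilon> > 0"
  obtains S where "finite S" "S \<subseteq> V" "labels.prob (event (\<lambda>\<xi>. finite (A \<xi>) \<and> \<not> A \<xi> \<subseteq> S)) < \<epsilon>"
proof -
  define S where "S n = from_nat_into V ` {..<n::nat}" for n
  have S: "finite (S n)" "S n \<subseteq> V" for n
    using from_nat_into[OF V_nonempty] by (auto simp: S_def)
  have mono: "S m \<subseteq> S n" if "m \<le> n" for m n using that by (auto simp: S_def)
  have exh: "\<exists>n. F \<subseteq> S n" if F: "finite F" "F \<subseteq> V" for F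
    using F
  proof (induction F rule: finite_induct)
    case (insert x F)
    then obtain n where n: "F \<subseteq> S n" by auto
    obtain m where "x = from_nat_into V m"
      using insert.prems from_nat_into_surj[OF countable_V, of x] by auto
    then have "x \<in> S (Suc m)" by (auto simp: S_def)
    then have "insert x F \<subseteq> S (max n (Suc m))" using n mono[of n "max n (Suc m)"] mono[of "Suc m" "max n (Suc m)"] by auto
    then show ?case by blast
  qed simp
  let ?B = "\<lambda>n. event (\<lambda>\<xi>. finite (A \<xi>) \<and> \<not> A \<xi> \<subseteq> S n)"
  have sub: "A \<xi> \<subseteq> T \<longleftrightarrow> (\<forall>y\<in>V. y \<in> A \<xi> \<longrightarrow> y \<in> T)" for \<xi> T using A(1)[of \<xi>] by blast
  have meas: "?B n \<in> sets labels" for n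
  proof -
    have "Measurable.pred labels (\<lambda>\<xi>. \<not> infinite (A \<xi>) \<and> \<not> A \<xi> \<subseteq> S n)"
      unfolding sub by (intro pred_intros_logic pred_infinite pred_countable_bounded countable_V A) simp
    then show ?thesis by (simp add: pred_def)
  qed
  have "(\<lambda>n. labels.prob (?B n)) \<longlonglongrightarrow> labels.prob (\<Inter>n. ?B n)"
  proof (rule labels.finite_Lim_measure_decseq)
    show "decseq ?B"
    proof (rule decseq_SucI)
      fix n show "?B (Suc n) \<subseteq> ?B n" using mono[of n "Suc n"] by auto
    qed
  qed (use meas in auto)
  moreover have "(\<Inter>n. ?B n) = {}" using exh A(1) by fastforce
  ultimately have "(\<lambda>n. labels.prob (?B n)) \<longlonglongrightarrow> 0" by simp
  then obtain n where "\<bar>labels.prob (?B n) - 0\<bar> < \<epsilon>"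
    using LIMSEQ_D[of _ _ \<epsilon>] \<epsilon> by fastforce
  then show thesis using that[OF S] by simp
qed

text \<open>As long as the cluster stays in \<open>S\<close>, exploring it reads only edges that
  touch \<open>S\<close>.\<close>

lemma depends_on_cluster_subset:
  "depends_on (\<lambda>\<xi>. cluster (below \<xi> s) y \<subseteq> S) {e. e \<inter> S \<noteq> {}}"
proof -
  have sub: "cluster (below \<xi>' s) y \<subseteq> S"
    if eq: "\<forall>e\<in>{e. e \<inter> S \<noteq> {}} \<inter> E. \<xi> e = \<xi>' e" and S: "cluster (below \<xi> s) y \<subseteq> S" for \<xi> \<xi>' :: "'a set \<Rightarrow> real"
  proof -
    have "cluster (below \<xi>' s) y \<subseteq> cluster (below \<xi> s) y"
    proof (rule cluster_subset)
      fix a b assume a: "a \<in> cluster (below \<xi> s) y" "{a, b} \<in> below \<xi>' s"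
      then have "a \<in> S" using S by blast
      then have "\<xi> {a, b} = \<xi>' {a, b}" using eq a(2) by (auto simp: below_def)
      then have "{a, b} \<in> below \<xi> s" using a(2) by (simp add: below_def)
      then show "b \<in> cluster (below \<xi> s) y" using a(1) reachable_trans[OF _ reachable_edge[of a b "below \<xi> s"]] by simp
    qed simp
    then show ?thesis using S by blast
  qed
  show ?thesis unfolding depends_on_def
  proof (intro ballI impI iffI)
    fix \<xi> \<xi>' :: "'a set \<Rightarrow> real" assume eq: "\<forall>e\<in>{e. e \<inter> S \<noteq> {}} \<inter> E. \<xi> e = \<xi>' e"
    show "cluster (below \<xi>' s) y \<subseteq> S" if "cluster (below \<xi> s) y \<subseteq> S"
      by (rule sub[OF eq that])
    have eq': "\<forall>e\<in>{e. e \<inter> S \<noteq> {}} \<inter> E. \<xi>' e = \<xi> e" using eq by (intro ballI) (rule sym, rule bspec)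
    show "cluster (below \<xi> s) y \<subseteq> S" if "cluster (below \<xi>' s) y \<subseteq> S"
      by (rule sub[OF eq' that])
  qed
qed

lemma pred_cluster_subset:
  assumes y: "y \<in> V" shows "Measurable.pred labels (\<lambda>\<xi>. cluster (below \<xi> s) y \<subseteq> S)"
proof -
  have "cluster (below \<xi> s) y \<subseteq> S \<longleftrightarrow> (\<forall>z\<in>V. (y, z) \<in> reachable (below \<xi> s) \<longrightarrow> z \<in> S)" for \<xi>
    using cluster_subset_V[OF below_subset y, of \<xi> s] by (auto simp: cluster_def)
  moreover have "Measurable.pred labels (\<lambda>\<xi>. \<forall>z\<in>V. (y, z) \<in> reachable (below \<xi> s) \<longrightarrow> z \<in> S)"
    by (intro pred_countable_bounded pred_intros_logic countable_V pred_reachable random_below) simp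
  ultimately show ?thesis by presburger
qed

text \<open>A lost vertex lies in \<open>B\<close> or in a finite piece attached to one of the
  finitely many neighbours of \<open>B\<close>.\<close>

lemma finite_lost:
  assumes A: "A \<subseteq> E" and B: "finite B"
  shows "finite {y. infinite (cluster A y) \<and> finite (cluster (avoiding A B) y)}"
proof -
  let ?c = "\<lambda>y. cluster (avoiding A B) y"
  let ?N = "{a\<in>(\<Union>b\<in>B. {a. {b, a} \<in> E}). finite (?c a)}"
  have "{y. infinite (cluster A y) \<and> finite (?c y)} \<subseteq> B \<union> (\<Union>a\<in>?N. ?c a)"
  proof
    fix y assume "y \<in> {y. infinite (cluster A y) \<and> finite (?c y)}"
    then have y: "infinite (cluster A y)" "finite (?c y)" by auto
    then have "\<not> cluster A y \<subseteq> ?c y" using finite_subset by blast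
    then obtain z where z: "(y, z) \<in> reachable A" "z \<notin> ?c y" unfolding subset_iff in_cluster by blast
    obtain a b where ab: "a \<in> ?c y" "b \<notin> ?c y" "{a, b} \<in> A"
      using reachable_exit[OF z(1) _ z(2)] by auto
    have "{a, b} \<notin> avoiding A B"
    proof
      assume "{a, b} \<in> avoiding A B"
      then have "b \<in> ?c y" using ab(1) reachable_trans[OF _ reachable_edge[of a b "avoiding A B"]] by simp
      then show False using ab(2) by simp
    qed
    then consider "a \<in> B" | "a \<notin> B" "b \<in> B" using ab(3) by (auto simp: avoiding_def)
    then show "y \<in> B \<union> (\<Union>a\<in>?N. ?c a)"
    proof cases
      case 1
      have "?c a \<subseteq> {a}" using 1 by (intro cluster_subset) (auto simp: avoiding_def)
      moreover have "y \<in> ?c a" using ab(1) reachable_sym[of y a] by simp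
      ultimately show ?thesis using 1 by blast
    next
      case 2
      have "?c a = ?c y" using ab(1) by (intro cluster_eq) simp
      moreover have "{b, a} \<in> E" using ab(3) A by (auto simp: insert_commute)
      ultimately have "a \<in> ?N" "y \<in> ?c a" using 2 y(2) by auto
      then show ?thesis by blast
    qed
  qed
  moreover have "finite (B \<union> (\<Union>a\<in>?N. ?c a))"
    using B finite_nbrs by (intro finite_UnI finite_UN_I) auto
  ultimately show ?thesis by (rule finite_subset)
qed

lemma adj_pow_sym: "(x, y) \<in> adj A ^^ n \<Longrightarrow> (y, x) \<in> adj A ^^ n"
proof (induction n arbitrary: y)
  case (Suc n)
  then obtain z where z: "(x, z) \<in> adj A ^^ n" "(z, y) \<in> adj A" by auto
  then have "(y, z) \<in> adj A" by (simp add: adj_def insert_commute)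
  then show ?case using Suc.IH[OF z(1)] by (rule relpow_Suc_I2)
qed simp

end

context utgraph
begin

lemma prob_inf_verts_pos:
  assumes "AE \<xi> in labels. inf_verts \<xi> s \<noteq> {}"
  obtains p where "0 < p" "\<And>y. y \<in> V \<Longrightarrow> labels.prob (event (\<lambda>\<xi>. y \<in> inf_verts \<xi> s)) = p"
proof -
  obtain o' where o: "o' \<in> V" using V_nonempty by blast
  let ?p = "labels.prob (event (\<lambda>\<xi>. o' \<in> inf_verts \<xi> s))"
  have eq: "labels.prob (event (\<lambda>\<xi>. y \<in> inf_verts \<xi> s)) = ?p" if y: "y \<in> V" for y
  proof -
    obtain \<phi> where \<phi>: "\<phi> \<in> Aut" "\<phi> o' = y" using AutE[OF o y] .
    then show ?thesis using prob_relabel[OF \<phi>(1) pred_inf_verts, of o' s] inf_verts_relabel[OF \<phi>(1), of o' _ s] by simp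
  qed
  have "?p \<noteq> 0"
  proof
    assume "?p = 0"
    have "AE \<xi> in labels. \<forall>y\<in>V. y \<notin> inf_verts \<xi> s"
    proof (rule AE_ball_countable'[OF _ countable_V])
      fix y assume y: "y \<in> V"
      have ev: "event (\<lambda>\<xi>. y \<in> inf_verts \<xi> s) \<in> sets labels" using pred_inf_verts by (simp add: pred_def)
      have "labels.prob (event (\<lambda>\<xi>. y \<in> inf_verts \<xi> s)) = 0" using eq[OF y] \<open>?p = 0\<close> by simp
      then have "AE \<xi> in labels. \<xi> \<notin> event (\<lambda>\<xi>. y \<in> inf_verts \<xi> s)"
        using labels.prob_eq_0[OF ev] by simp
      with AE_space show "AE \<xi> in labels. y \<notin> inf_verts \<xi> s" by eventually_elim auto
    qed
    with assms have "AE \<xi> in labels. False"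
      by eventually_elim (use inf_verts_subset in blast)
    then show False by simp
  qed
  then have "0 < ?p" by (simp add: zero_less_measure_iff)
  then show thesis using that eq by blast
qed

text \<open>Apart from the finitely many vertices that lose an infinite cluster when
  \<open>B\<close> is deleted, a finite cluster off \<open>B\<close> means a finite cluster at level
  \<open>s\<close>. Confinement to translates of a finite set \<open>S\<close> is independent at
  \<open>M\<close> points that are far apart, and each time has probability at most
  \<open>1 - p\<close>.\<close>

lemma hit_infinite_cluster:
  assumes inf: "AE \<xi> in labels. inf_verts \<xi> s \<noteq> {}" and B: "finite B" and \<epsilon>: "\<epsilon> > 0"
  shows "\<exists>n. \<forall>X. finite X \<longrightarrow> X \<subseteq> V \<longrightarrow> n \<le> card X \<longrightarrow>
    labels.prob (event (\<lambda>\<xi>. \<forall>y\<in>X. finite (cluster (avoiding (below \<xi> s) B) y))) \<le> \<epsilon>"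
proof -
  obtain p where p: "0 < p" "\<And>y. y \<in> V \<Longrightarrow> labels.prob (event (\<lambda>\<xi>. y \<in> inf_verts \<xi> s)) = p"
    by (rule prob_inf_verts_pos[OF inf]) blast
  obtain o' where o: "o' \<in> V" using V_nonempty by blast
  have p1: "p \<le> 1" using p(2)[OF o] by (metis labels.prob_le_1)
  \<comment> \<open>There are three errors of size \<open>\<epsilon> / 3\<close>: confinement at all
    \<open>M\<close> points, a finite cluster that leaves its translate of \<open>S\<close>, and a
    lost vertex outside \<open>Z\<close>.\<close>
  obtain M0 where "(1 - p) ^ M0 < \<epsilon> / 3" using real_arch_pow_inv[of "\<epsilon> / 3" "1 - p"] \<epsilon> p(1) by auto
  then have M: "(1 - p) ^ Suc M0 < \<epsilon> / 3"
    using p(1) p1 power_decreasing[of M0 "Suc M0" "1 - p"] by auto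
  \<comment> \<open>The successor makes \<open>M\<close> positive: it occurs as a divisor, and
    \<open>Y\<close> below must be nonempty.\<close>
  define M where "M = Suc M0"
  have av: "random_edges (\<lambda>\<xi>. avoiding (below \<xi> s) B)" by (intro random_avoiding random_below)
  define lost where "lost \<xi> = {y\<in>V. infinite (cluster (below \<xi> s) y) \<and> finite (cluster (avoiding (below \<xi> s) B) y)}" for \<xi>
  have fin_lost: "finite (lost \<xi>)" for \<xi>
    by (rule finite_subset[OF _ finite_lost[OF below_subset B]]) (auto simp: lost_def)
  have pred_fin: "Measurable.pred labels (\<lambda>\<xi>. finite (cluster (avoiding (below \<xi> s) B) y))" if "y \<in> V" for y
    using pred_intros_logic(2)[OF pred_infinite_cluster[OF av that]] by simp
  have pred_lost: "Measurable.pred labels (\<lambda>\<xi>. y \<in> lost \<xi>)" for y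
  proof (cases "y \<in> V")
    case True
    then show ?thesis unfolding lost_def mem_Collect_eq
      by (intro pred_intros_logic pred_infinite_cluster random_below pred_fin) simp
  qed (simp add: lost_def)
  obtain Z where Z: "finite Z" "Z \<subseteq> V" "labels.prob (event (\<lambda>\<xi>. finite (lost \<xi>) \<and> \<not> lost \<xi> \<subseteq> Z)) < \<epsilon> / 3"
    by (rule tight_finite_sets[of lost "\<epsilon> / 3"]) (use pred_lost \<epsilon> in \<open>auto simp: lost_def\<close>)
  have \<delta>: "0 < \<epsilon> / (3 * real M)" using \<epsilon> by (simp add: M_def)
  obtain S where S: "finite S" "S \<subseteq> V"
    "labels.prob (event (\<lambda>\<xi>. finite (cluster (below \<xi> s) o') \<and> \<not> cluster (below \<xi> s) o' \<subseteq> S)) < \<epsilon> / (3 * real M)"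
    by (rule tight_finite_sets[OF _ _ \<delta>, of "\<lambda>\<xi>. cluster (below \<xi> s) o'"])
       (use cluster_subset_V[OF below_subset o] pred_reachable[OF random_below] in auto)
  have "\<exists>\<phi>. \<phi> \<in> Aut \<and> \<phi> o' = y" if "y \<in> V" for y using AutE[OF o that] by blast
  then obtain \<phi> where \<phi>: "\<And>y. y \<in> V \<Longrightarrow> \<phi> y \<in> Aut" "\<And>y. y \<in> V \<Longrightarrow> \<phi> y o' = y" by metis
  let ?S = "\<lambda>y. \<phi> y ` S"
  define esc where "esc y \<xi> \<longleftrightarrow> \<not> cluster (below \<xi> s) y \<subseteq> ?S y" for y \<xi>
  have pred_esc: "Measurable.pred labels (esc y)" if "y \<in> V" for y
    unfolding esc_def by (intro pred_intros_logic pred_cluster_subset that)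
  have esc_relabel: "esc y \<xi> \<longleftrightarrow> \<not> cluster (below (relabel (\<phi> y) \<xi>) s) o' \<subseteq> S"
    "finite (cluster (below \<xi> s) y) \<longleftrightarrow> finite (cluster (below (relabel (\<phi> y) \<xi>) s) o')" if y: "y \<in> V" for y \<xi>
  proof -
    have b: "bij (\<phi> y)" by (rule Aut_bij[OF \<phi>(1)[OF y]])
    have eq: "cluster (below (relabel (\<phi> y) \<xi>) s) o' = \<phi> y -` cluster (below \<xi> s) y"
      unfolding below_relabel[OF \<phi>(1)[OF y]]
      using reachable_pull[OF \<phi>(1)[OF y] below_subset, of o' _ \<xi> s] \<phi>(2)[OF y] by auto
    have "\<phi> y -` C \<subseteq> S \<longleftrightarrow> C \<subseteq> \<phi> y ` S" for C
      using b by (metis bij_is_inj bij_is_surj image_subset_iff_subset_vimage inj_vimage_image_eq surj_image_vimage_eq image_mono vimage_mono)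
    then show "esc y \<xi> \<longleftrightarrow> \<not> cluster (below (relabel (\<phi> y) \<xi>) s) o' \<subseteq> S" unfolding esc_def eq by simp
    show "finite (cluster (below \<xi> s) y) \<longleftrightarrow> finite (cluster (below (relabel (\<phi> y) \<xi>) s) o')"
      using infinite_cluster_pull[OF \<phi>(1)[OF y] below_subset, of \<xi> s o'] \<phi>(2)[OF y]
      unfolding below_relabel[OF \<phi>(1)[OF y]] by simp
  qed
  have esc_fin: "labels.prob (event (\<lambda>\<xi>. finite (cluster (below \<xi> s) y) \<and> esc y \<xi>)) < \<epsilon> / (3 * real M)" if y: "y \<in> V" for y
  proof -
    have "Measurable.pred labels (\<lambda>\<xi>. \<not> infinite (cluster (below \<xi> s) o') \<and> \<not> cluster (below \<xi> s) o' \<subseteq> S)"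
      by (intro pred_intros_logic pred_infinite_cluster random_below pred_cluster_subset o)
    then have "Measurable.pred labels (\<lambda>\<xi>. finite (cluster (below \<xi> s) o') \<and> \<not> cluster (below \<xi> s) o' \<subseteq> S)" by simp
    from prob_relabel[OF \<phi>(1)[OF y] this] S(3) show ?thesis using esc_relabel[OF y] by simp
  qed
  have esc_p: "labels.prob (event (\<lambda>\<xi>. \<not> esc y \<xi>)) \<le> 1 - p" if y: "y \<in> V" for y
  proof -
    have ev: "event (\<lambda>\<xi>. y \<in> inf_verts \<xi> s) \<in> sets labels" using pred_inf_verts by (simp add: pred_def)
    have "event (\<lambda>\<xi>. \<not> esc y \<xi>) \<subseteq> space labels - event (\<lambda>\<xi>. y \<in> inf_verts \<xi> s)"
      using S(1) unfolding esc_def inf_verts_def by (auto dest: finite_subset)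
    then have "labels.prob (event (\<lambda>\<xi>. \<not> esc y \<xi>)) \<le> labels.prob (space labels - event (\<lambda>\<xi>. y \<in> inf_verts \<xi> s))"
      using ev by (intro labels.finite_measure_mono) auto
    then show ?thesis using labels.prob_compl[OF ev] p(2)[OF y] by simp
  qed
  have esc_dep: "depends_on (\<lambda>\<xi>. \<not> esc y \<xi>) {e. e \<inter> ?S y \<noteq> {}}" for y
    unfolding esc_def using depends_on_cluster_subset by simp
  have "\<exists>N. \<forall>z\<in>S. \<exists>n\<le>N. (o', z) \<in> adj E ^^ n"
    using S(1,2)
  proof (induction S rule: finite_induct)
    case (insert z S)
    then obtain N where N: "\<forall>z\<in>S. \<exists>n\<le>N. (o', z) \<in> adj E ^^ n" by auto
    obtain k where "(o', z) \<in> adj E ^^ k"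
      using reachable_V[OF o, of z] insert.prems by (auto simp: reachable_iff_adj)
    then show ?case using N by (intro exI[of _ "max N k"]) (auto intro: max.coboundedI1 max.coboundedI2)
  qed simp
  then obtain N where N: "\<And>z. z \<in> S \<Longrightarrow> \<exists>n\<le>N. (o', z) \<in> adj E ^^ n" by blast
  \<comment> \<open>Translates of \<open>S\<close> reach distance \<open>N\<close>, and one edge may
    touch two of them: hence \<open>2 * N + 1\<close>.\<close>
  define conf where "conf y y' \<longleftrightarrow> (\<exists>m\<le>2 * N + 1. (y, y') \<in> adj E ^^ m)" for y y'
  have conf_disj: "{e. e \<inter> ?S y \<noteq> {}} \<inter> {e. e \<inter> ?S y' \<noteq> {}} \<inter> E = {}" if yV: "y \<in> V" "y' \<in> V" and nc: "\<not> conf y y'" for y y'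
  proof (rule ccontr)
    assume "\<not> ?thesis"
    then obtain e z z' where e: "e \<in> E" "z \<in> S" "\<phi> y z \<in> e" "z' \<in> S" "\<phi> y' z' \<in> e" by blast
    obtain n where n: "n \<le> N" "(o', z) \<in> adj E ^^ n" using N[OF e(2)] by blast
    obtain n' where n': "n' \<le> N" "(o', z') \<in> adj E ^^ n'" using N[OF e(4)] by blast
    have 1: "(y, \<phi> y z) \<in> adj E ^^ n"
      using Aut_adj_pow[OF \<phi>(1)[OF yV(1)], of o' z n] n(2) \<phi>(2)[OF yV(1)] by simp
    have 2: "(\<phi> y' z', y') \<in> adj E ^^ n'"
      using Aut_adj_pow[OF \<phi>(1)[OF yV(2)], of o' z' n'] n'(2) \<phi>(2)[OF yV(2)] by (simp add: adj_pow_sym)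
    have "\<exists>k\<le>1. (\<phi> y z, \<phi> y' z') \<in> adj E ^^ k"
    proof (cases "\<phi> y z = \<phi> y' z'")
      case False
      obtain a b where "e = {a, b}" using e(1) by (rule edgeE)
      then have "e = {\<phi> y z, \<phi> y' z'}" using e False by auto
      then have "(\<phi> y z, \<phi> y' z') \<in> adj E ^^ 1" using e(1) by (simp add: adj_def)
      then show ?thesis by blast
    qed (intro exI[of _ 0], simp)
    then obtain k where k: "k \<le> 1" "(\<phi> y z, \<phi> y' z') \<in> adj E ^^ k" by blast
    have "(y, y') \<in> adj E ^^ (n + k + n')"
      unfolding relpow_add by (intro relcompI[OF relcompI[OF 1 k(2)] 2])
    moreover have "n + k + n' \<le> 2 * N + 1" using n(1) n'(1) k(1) by linarith
    ultimately show False using nc unfolding conf_def by blast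
  qed
  define c where "c = card {y'. conf o' y'}"
  have "{y'. conf y y'} = (\<Union>m\<in>{..2 * N + 1}. {y'. (y, y') \<in> adj E ^^ m})" for y
    by (auto simp: conf_def)
  then have fin_conf: "finite {y'. conf y y'}" for y using finite_adj_ball by simp
  have conf_refl: "conf y y" for y unfolding conf_def by (intro exI[of _ 0]) simp
  have conf_sym: "conf y y' \<Longrightarrow> conf y' y" for y y' unfolding conf_def using adj_pow_sym by blast
  have c0: "0 < c" unfolding c_def using conf_refl[of o'] fin_conf by (auto simp: card_gt_0_iff)
  have card_conf: "card {y'\<in>X. conf y y'} \<le> c" if "y \<in> V" for y X
  proof -
    have b: "bij (\<phi> y)" by (rule Aut_bij[OF \<phi>(1)[OF that]])
    have "{y'. conf y y'} \<subseteq> \<phi> y ` {y'. conf o' y'}"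
    proof
      fix y' assume "y' \<in> {y'. conf y y'}"
      moreover obtain z where z: "y' = \<phi> y z" using b by (metis bij_is_surj surjD)
      ultimately have "conf o' z"
        using Aut_adj_pow[OF \<phi>(1)[OF that], of o' z] \<phi>(2)[OF that] by (simp add: conf_def)
      then show "y' \<in> \<phi> y ` {y'. conf o' y'}" using z by blast
    qed
    then have "card {y'. conf y y'} \<le> c"
      unfolding c_def using fin_conf by (meson card_image_le card_mono finite_imageI le_trans)
    moreover have "card {y'\<in>X. conf y y'} \<le> card {y'. conf y y'}" using fin_conf by (intro card_mono) auto
    ultimately show ?thesis by simp
  qed
  \<comment> \<open>At most \<open>card Z\<close> points are discarded, and \<open>M * c\<close>
    others suffice to pick \<open>M\<close> that are pairwise far apart.\<close>
  show ?thesis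
  proof (intro exI[of _ "M * c + card Z"] allI impI)
    fix X assume X: "finite X" "X \<subseteq> V" "M * c + card Z \<le> card X"
    have "card X - card Z \<le> card (X - Z)" by (rule diff_card_le_card_Diff[OF Z(1)])
    then have "M * c \<le> card (X - Z)" using X(3) by linarith
    then obtain Y where Y: "Y \<subseteq> X - Z" "card Y = M" "\<And>y y'. y \<in> Y \<Longrightarrow> y' \<in> Y \<Longrightarrow> y \<noteq> y' \<Longrightarrow> \<not> conf y y'"
      using independent_subset[of "X - Z" conf c M] X card_conf c0 conf_refl conf_sym by blast
    have YV: "Y \<subseteq> V" and finY: "finite Y" using Y(1) X finite_subset by blast+
    have Yne: "Y \<noteq> {}" using Y(2) by (auto simp: M_def)
    let ?E1 = "event (\<lambda>\<xi>. \<forall>y\<in>Y. \<not> esc y \<xi>)"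
    let ?E2 = "\<Union>y\<in>Y. event (\<lambda>\<xi>. finite (cluster (below \<xi> s) y) \<and> esc y \<xi>)"
    let ?E3 = "event (\<lambda>\<xi>. finite (lost \<xi>) \<and> \<not> lost \<xi> \<subseteq> Z)"
    let ?D = "event (\<lambda>\<xi>. \<forall>y\<in>X. finite (cluster (avoiding (below \<xi> s) B) y))"
    have E1: "?E1 \<in> sets labels"
    proof -
      have "Measurable.pred labels (\<lambda>\<xi>. \<forall>y\<in>Y. \<not> esc y \<xi>)"
        using pred_esc YV finY by (intro pred_countable_bounded pred_intros_logic countable_finite) auto
      then show ?thesis by (simp add: pred_def)
    qed
    have E2': "event (\<lambda>\<xi>. finite (cluster (below \<xi> s) y) \<and> esc y \<xi>) \<in> sets labels" if "y \<in> V" for y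
    proof -
      have "Measurable.pred labels (\<lambda>\<xi>. \<not> infinite (cluster (below \<xi> s) y) \<and> esc y \<xi>)"
        by (intro pred_intros_logic pred_infinite_cluster random_below pred_esc that)
      then show ?thesis by (simp add: pred_def)
    qed
    then have E2: "?E2 \<in> sets labels" using finY YV by (intro sets.finite_UN) auto
    have E3: "?E3 \<in> sets labels"
    proof -
      have "Measurable.pred labels (\<lambda>\<xi>. \<exists>y\<in>V. y \<in> lost \<xi> \<and> y \<notin> Z)"
        by (intro pred_countable_bounded pred_intros_logic countable_V pred_lost) simp
      moreover have "(finite (lost \<xi>) \<and> \<not> lost \<xi> \<subseteq> Z) \<longleftrightarrow> (\<exists>y\<in>V. y \<in> lost \<xi> \<and> y \<notin> Z)" for \<xi>
        using fin_lost[of \<xi>] unfolding lost_def by blast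
      ultimately show ?thesis by (simp add: pred_def)
    qed
    \<comment> \<open>\<open>Y\<close> lies outside \<open>Z\<close>, so unless a vertex outside
      \<open>Z\<close> is lost, all clusters of \<open>Y\<close> at level \<open>s\<close> are
      finite; then either all are confined or a finite one escapes.\<close>
    have sub: "?D \<subseteq> ?E1 \<union> ?E2 \<union> ?E3"
    proof
      fix \<xi> assume \<xi>: "\<xi> \<in> ?D"
      show "\<xi> \<in> ?E1 \<union> ?E2 \<union> ?E3"
      proof (cases "lost \<xi> \<subseteq> Z")
        case True
        have "finite (cluster (below \<xi> s) y)" if y: "y \<in> Y" for y
        proof (rule ccontr)
          assume "infinite (cluster (below \<xi> s) y)"
          then have "y \<in> lost \<xi>" using \<xi> y Y(1) YV by (auto simp: lost_def)
          then show False using True y Y(1) by blast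
        qed
        then show ?thesis using \<xi> by auto
      qed (use \<xi> fin_lost in simp)
    qed
    have "labels.prob ?D \<le> labels.prob (?E1 \<union> ?E2 \<union> ?E3)"
      by (rule labels.finite_measure_mono[OF sub]) (intro sets.Un E1 E2 E3)
    also have "\<dots> \<le> labels.prob ?E1 + labels.prob ?E2 + labels.prob ?E3"
      using measure_Un_le[OF sets.Un[OF E1 E2] E3] measure_Un_le[OF E1 E2] by linarith
    also have "labels.prob ?E1 = (\<Prod>y\<in>Y. labels.prob (event (\<lambda>\<xi>. \<not> esc y \<xi>)))"
    proof (rule prob_indep[where J = "\<lambda>y. {e. e \<inter> ?S y \<noteq> {}}", OF finY Yne])
      show "Measurable.pred labels (\<lambda>\<xi>. \<not> esc y \<xi>)" if "y \<in> Y" for y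
        using pred_esc[of y] that YV by (intro pred_intros_logic) auto
      show "depends_on (\<lambda>\<xi>. \<not> esc y \<xi>) {e. e \<inter> ?S y \<noteq> {}}" for y by (rule esc_dep)
      show "{e. e \<inter> ?S y \<noteq> {}} \<inter> {e. e \<inter> ?S y' \<noteq> {}} \<inter> E = {}" if "y \<in> Y" "y' \<in> Y" "y \<noteq> y'" for y y'
        by (rule conf_disj[OF subsetD[OF YV that(1)] subsetD[OF YV that(2)] Y(3)[OF that]])
    qed
    also have "\<dots> \<le> (\<Prod>y\<in>Y. 1 - p)" using esc_p YV by (intro prod_mono) auto
    also have "\<dots> = (1 - p) ^ M" using Y(2) by simp
    also have "labels.prob ?E2 \<le> (\<Sum>y\<in>Y. labels.prob (event (\<lambda>\<xi>. finite (cluster (below \<xi> s) y) \<and> esc y \<xi>)))"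
      using E2' YV finY by (intro labels.finite_measure_subadditive_finite) auto
    also have "\<dots> \<le> (\<Sum>y\<in>Y. \<epsilon> / (3 * real M))" using esc_fin YV by (intro sum_mono less_imp_le) auto
    also have "\<dots> = \<epsilon> / 3"
    proof -
      have "real M > 0" by (simp add: M_def)
      then show ?thesis using Y(2) by (simp add: field_simps)
    qed
    finally show "labels.prob ?D \<le> \<epsilon>" using M Z(3) unfolding M_def by linarith
  qed
qed

end

context lf_graph
begin

section \<open>Invasion\<close>

definition bd :: "'a set \<Rightarrow> 'a set set" where
  "bd S = {e\<in>E. e \<inter> S \<noteq> {} \<and> \<not> e \<subseteq> S}"

definition min_bd :: "('a set \<Rightarrow> real) \<Rightarrow> 'a set \<Rightarrow> 'a set \<Rightarrow> bool" where
  "min_bd \<xi> S e \<longleftrightarrow> e \<in> bd S \<and> (\<forall>f\<in>bd S. \<xi> e \<le> \<xi> f)"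

text \<open>
  For distinct labels there is exactly one such set for each \<open>k\<close>; collecting all of them avoids
  a choice between ties.
\<close>

fun invaded :: "('a set \<Rightarrow> real) \<Rightarrow> 'a \<Rightarrow> nat \<Rightarrow> 'a set set" where
  "invaded \<xi> v 0 = {{v}}"
| "invaded \<xi> v (Suc k) = {S \<union> e | S e. S \<in> invaded \<xi> v k \<and> min_bd \<xi> S e}"

lemma bdE:
  assumes "e \<in> bd S"
  obtains x w where "e = {x, w}" "x \<in> S" "w \<notin> S" "e \<in> E" "w \<in> V"
proof -
  have e: "e \<in> E" "e \<inter> S \<noteq> {}" "\<not> e \<subseteq> S" using assms by (auto simp: bd_def)
  obtain a b where ab: "e = {a, b}" "a \<in> V" "b \<in> V" using e(1) by (rule edgeE)
  show thesis
  proof (cases "a \<in> S")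
    case True
    then have "b \<notin> S" using e(3) ab(1) by simp
    then show thesis using that[of a b] True ab e(1) by simp
  next
    case False
    then have "b \<in> S" using e(2) ab(1) by auto
    then show thesis using that[of b a] False ab e(1) by (simp add: insert_commute)
  qed
qed

lemma bdI: "{x, w} \<in> E \<Longrightarrow> x \<in> S \<Longrightarrow> w \<notin> S \<Longrightarrow> {x, w} \<in> bd S"
  by (simp add: bd_def)

lemma invaded_props:
  assumes "v \<in> V" "S \<in> invaded \<xi> v k"
  shows "finite S \<and> S \<subseteq> V \<and> v \<in> S \<and> card S = Suc k"
  using assms(2)
proof (induction k arbitrary: S)
  case 0
  then show ?case using assms(1) by simp
next
  case (Suc k)
  then obtain S' e where S': "S = S' \<union> e" "S' \<in> invaded \<xi> v k" "e \<in> bd S'" by (auto simp: min_bd_def)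
  then obtain x w where xw: "e = {x, w}" "x \<in> S'" "w \<notin> S'" "w \<in> V" by (elim bdE) blast
  have "S = insert w S'" using S'(1) xw by auto
  then show ?case using Suc.IH[OF S'(2)] xw by auto
qed

lemma finite_bd: "finite S \<Longrightarrow> finite (bd S)"
  by (rule finite_subset[OF _ finite_touching]) (auto simp: bd_def)

lemma bd_nonempty:
  assumes "finite S" "v \<in> S" "v \<in> V" shows "bd S \<noteq> {}"
proof -
  obtain y where y: "y \<in> V" "y \<notin> S" using infinite_V assms(1) by (meson finite_subset subsetI)
  obtain a b where "a \<in> S" "b \<notin> S" "{a, b} \<in> E"
    using reachable_exit[OF reachable_V[OF assms(3) y(1)] assms(2) y(2)] by blast
  then show ?thesis using bdI by blast
qed

lemma invaded_step:
  assumes "v \<in> V" "S \<in> invaded \<xi> v k"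
  obtains e where "min_bd \<xi> S e" "S \<union> e \<in> invaded \<xi> v (Suc k)"
proof -
  have S: "finite S" "v \<in> S" using invaded_props[OF assms] by auto
  obtain e where "e \<in> bd S" "\<And>f. f \<in> bd S \<Longrightarrow> \<xi> e \<le> \<xi> f"
    using ex_min_on[OF finite_bd[OF S(1)] bd_nonempty[OF S assms(1)], of \<xi>] by blast
  then have "min_bd \<xi> S e" by (simp add: min_bd_def)
  moreover have "S \<union> e \<in> invaded \<xi> v (Suc k)" using calculation assms(2) by auto
  ultimately show thesis using that by blast
qed

lemma invaded_nonempty: "v \<in> V \<Longrightarrow> \<exists>S. S \<in> invaded \<xi> v k"
proof (induction k)
  case (Suc k)
  then obtain S where "S \<in> invaded \<xi> v k" by blast
  from invaded_step[OF Suc.prems this] show ?case by blast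
qed simp

lemma min_bd_unique:
  assumes "inj_on \<xi> E" "min_bd \<xi> S e" "min_bd \<xi> S e'" shows "e = e'"
proof -
  have "\<xi> e = \<xi> e'" using assms(2,3) unfolding min_bd_def by (meson order_antisym)
  moreover have "e \<in> E" "e' \<in> E" using assms(2,3) by (auto simp: min_bd_def bd_def)
  ultimately show ?thesis using assms(1) by (auto dest: inj_onD)
qed

lemma invaded_unique:
  assumes "inj_on \<xi> E" "S \<in> invaded \<xi> v k" "S' \<in> invaded \<xi> v k" shows "S = S'"
  using assms(2,3)
proof (induction k arbitrary: S S')
  case (Suc k)
  then obtain T e T' e' where T: "S = T \<union> e" "T \<in> invaded \<xi> v k" "min_bd \<xi> T e"
    "S' = T' \<union> e'" "T' \<in> invaded \<xi> v k" "min_bd \<xi> T' e'" by auto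
  have "T = T'" using Suc.IH[OF T(2,5)] .
  then have "e = e'" using min_bd_unique[OF assms(1) T(3)] T(6) by simp
  then show ?case using T \<open>T = T'\<close> by simp
qed simp

lemma invaded_mono:
  assumes inj: "inj_on \<xi> E" and S: "S \<in> invaded \<xi> v j" "min_bd \<xi> S e"
  shows "S' \<in> invaded \<xi> v (Suc j + i) \<Longrightarrow> S \<union> e \<subseteq> S'"
proof (induction i arbitrary: S')
  case 0
  have "S \<union> e \<in> invaded \<xi> v (Suc j + 0)" using S by auto
  then show ?case using invaded_unique[OF inj _ 0] by blast
next
  case (Suc i)
  then obtain T f where "S' = T \<union> f" "T \<in> invaded \<xi> v (Suc j + i)" by auto
  then show ?case using Suc.IH by blast
qed

text \<open>Each edge used by the invasion is a cheapest boundary edge, hence a forest edge by the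
  cut property.\<close>

lemma invaded_in_tree: "S \<in> invaded \<xi> v k \<Longrightarrow> S \<subseteq> cluster (forest \<xi>) v"
proof (induction k arbitrary: S)
  case (Suc k)
  then obtain T e where T: "S = T \<union> e" "T \<in> invaded \<xi> v k" "min_bd \<xi> T e" by auto
  then have "e \<in> bd T" by (simp add: min_bd_def)
  then obtain x w where xw: "e = {x, w}" "x \<in> T" "w \<notin> T" "e \<in> E" by (elim bdE) blast
  have "{x, w} \<in> forest \<xi>"
  proof (rule min_boundary_edge_in_forest)
    show "\<xi> {x, w} \<le> \<xi> {c, d}" if "{c, d} \<in> E" "c \<in> T" "d \<notin> T" for c d
      using T(3) xw(1) bdI[OF that] by (simp add: min_bd_def)
  qed (use xw in auto)
  then have "(x, w) \<in> reachable (forest \<xi>)" by (rule reachable_edge)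
  moreover have "(v, x) \<in> reachable (forest \<xi>)" using Suc.IH[OF T(2)] xw(2) by auto
  ultimately have "(v, w) \<in> reachable (forest \<xi>)" by (rule reachable_trans[rotated])
  then show ?case using Suc.IH[OF T(2)] T(1) xw by auto
qed simp

lemma pred_min_bd: "Measurable.pred labels (\<lambda>\<xi>. min_bd \<xi> S e)"
proof (cases "e \<in> bd S")
  case True
  have "Measurable.pred labels (\<lambda>\<xi>. \<xi> e \<le> \<xi> f)" if "f \<in> bd S" for f
    using True that unfolding pred_def by (intro borel_measurable_le measurable_label) (auto simp: bd_def)
  moreover have "countable (bd S)" by (rule countable_subset[OF _ countable_E]) (auto simp: bd_def)
  ultimately have "Measurable.pred labels (\<lambda>\<xi>. \<forall>f\<in>bd S. \<xi> e \<le> \<xi> f)" by (intro pred_countable_bounded)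
  then show ?thesis using True by (simp add: min_bd_def)
qed (simp add: min_bd_def)

lemma pred_invaded:
  assumes v: "v \<in> V" shows "Measurable.pred labels (\<lambda>\<xi>. S \<in> invaded \<xi> v k)"
proof (induction k arbitrary: S)
  case (Suc k)
  have "S \<in> invaded \<xi> v (Suc k) \<longleftrightarrow>
      (\<exists>T\<in>{T. finite T \<and> T \<subseteq> V}. \<exists>e\<in>E. S = T \<union> e \<and> T \<in> invaded \<xi> v k \<and> min_bd \<xi> T e)" for \<xi>
  proof
    assume "S \<in> invaded \<xi> v (Suc k)"
    then obtain T e where T: "S = T \<union> e" "T \<in> invaded \<xi> v k" "min_bd \<xi> T e" by auto
    moreover have "e \<in> E" using T(3) by (simp add: min_bd_def bd_def)
    moreover have "finite T" "T \<subseteq> V" using invaded_props[OF v T(2)] by auto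
    ultimately show "\<exists>T\<in>{T. finite T \<and> T \<subseteq> V}. \<exists>e\<in>E. S = T \<union> e \<and> T \<in> invaded \<xi> v k \<and> min_bd \<xi> T e" by blast
  qed auto
  moreover have "Measurable.pred labels (\<lambda>\<xi>. \<exists>T\<in>{T. finite T \<and> T \<subseteq> V}. \<exists>e\<in>E. S = T \<union> e \<and> T \<in> invaded \<xi> v k \<and> min_bd \<xi> T e)"
    by (intro pred_countable_bounded pred_intros_logic countable_finite_subsets countable_E Suc pred_min_bd) simp
  ultimately show ?case by presburger
qed simp

text \<open>The stages range over the countable family of finite subsets of \<open>V\<close>, so the
  quantifier is a countable union.\<close>

lemma pred_bex_invaded:
  assumes v: "v \<in> V" and P: "\<And>S. S \<subseteq> V \<Longrightarrow> Measurable.pred labels (P S)"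
  shows "Measurable.pred labels (\<lambda>\<xi>. \<exists>S\<in>invaded \<xi> v k. P S \<xi>)"
proof -
  have "(\<exists>S\<in>invaded \<xi> v k. P S \<xi>) \<longleftrightarrow> (\<exists>S\<in>{S. finite S \<and> S \<subseteq> V}. S \<in> invaded \<xi> v k \<and> P S \<xi>)" for \<xi>
    using invaded_props[OF v, of _ \<xi> k] by blast
  moreover have "Measurable.pred labels (\<lambda>\<xi>. \<exists>S\<in>{S. finite S \<and> S \<subseteq> V}. S \<in> invaded \<xi> v k \<and> P S \<xi>)"
    by (intro pred_countable_bounded pred_intros_logic countable_finite_subsets pred_invaded v P) simp
  ultimately show ?thesis by presburger
qed

text \<open>The steps leading to \<open>S\<close> compare only boundary edges of earlier stages, and
  all of these touch \<open>S\<close>. Events that read edges off \<open>S\<close> are therefore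
  independent of this stage.\<close>

lemma depends_on_invaded: "depends_on (\<lambda>\<xi>. S \<in> invaded \<xi> v k) {e. e \<inter> S \<noteq> {}}"
proof -
  have imp: "S \<in> invaded \<xi>' v k"
    if "\<forall>e\<in>{e. e \<inter> S \<noteq> {}} \<inter> E. \<xi> e = \<xi>' e" "S \<in> invaded \<xi> v k" for \<xi> \<xi>' :: "'a set \<Rightarrow> real"
    using that
  proof (induction k arbitrary: S)
    case (Suc k)
    then obtain T e where T: "S = T \<union> e" "T \<in> invaded \<xi> v k" "min_bd \<xi> T e" by auto
    have eq: "\<xi> f = \<xi>' f" if "f \<inter> T \<noteq> {}" "f \<in> E" for f
    proof -
      have "f \<inter> S \<noteq> {}" using that(1) T(1) by blast
      then show ?thesis using Suc.prems(1) that(2) by blast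
    qed
    have "T \<in> invaded \<xi>' v k" using T(2) by (rule Suc.IH[rotated]) (use eq in blast)
    moreover have "min_bd \<xi>' T e"
      unfolding min_bd_def
    proof (intro conjI ballI)
      show "e \<in> bd T" using T(3) by (simp add: min_bd_def)
      fix f assume f: "f \<in> bd T"
      have "\<xi> e \<le> \<xi> f" using T(3) f by (simp add: min_bd_def)
      moreover have "\<xi> e = \<xi>' e" using \<open>e \<in> bd T\<close> by (intro eq) (auto simp: bd_def)
      moreover have "\<xi> f = \<xi>' f" using f by (intro eq) (auto simp: bd_def)
      ultimately show "\<xi>' e \<le> \<xi>' f" by simp
    qed
    ultimately show ?case using T(1) by auto
  qed simp
  show ?thesis unfolding depends_on_def
  proof (intro ballI impI iffI)
    fix \<xi> \<xi>' :: "'a set \<Rightarrow> real" assume eq: "\<forall>e\<in>{e. e \<inter> S \<noteq> {}} \<inter> E. \<xi> e = \<xi>' e"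
    show "S \<in> invaded \<xi>' v k" if "S \<in> invaded \<xi> v k" by (rule imp[OF eq that])
    have eq': "\<forall>e\<in>{e. e \<inter> S \<noteq> {}} \<inter> E. \<xi>' e = \<xi> e" using eq by (intro ballI) (rule sym, rule bspec)
    show "S \<in> invaded \<xi> v k" if "S \<in> invaded \<xi>' v k" by (rule imp[OF eq' that])
  qed
qed

definition avoids :: "('a set \<Rightarrow> real) \<Rightarrow> 'a \<Rightarrow> real \<Rightarrow> bool" where
  "avoids \<xi> v t \<longleftrightarrow> (\<forall>k. \<forall>S\<in>invaded \<xi> v k. S \<inter> inf_verts \<xi> t = {})"

text \<open>No condition is put on the label of \<open>g\<close>; \<open>first_hit_of_chance\<close>
  moves it into the interval from \<open>s\<close> to \<open>t\<close>.\<close>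

definition chance :: "('a set \<Rightarrow> real) \<Rightarrow> 'a \<Rightarrow> real \<Rightarrow> 'a set \<Rightarrow> bool" where
  "chance \<xi> v s g \<longleftrightarrow> (\<exists>k. \<exists>S\<in>invaded \<xi> v k. \<exists>x\<in>S. \<exists>w\<in>V. w \<notin> S \<and> g = {x, w} \<and> g \<in> E \<and> w \<in> inf_verts \<xi> s)"

definition first_hit :: "('a set \<Rightarrow> real) \<Rightarrow> 'a \<Rightarrow> real \<Rightarrow> 'a set \<Rightarrow> bool" where
  "first_hit \<xi> v s g \<longleftrightarrow> (\<exists>k. \<exists>S\<in>invaded \<xi> v k. S \<inter> inf_verts \<xi> s = {} \<and> min_bd \<xi> S g \<and> g \<inter> inf_verts \<xi> s \<noteq> {})"

text \<open>After its first entry the invasion contains a point of \<open>inf_verts \<xi> s\<close>,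
  so no later stage is disjoint from that set.\<close>

lemma first_hit_unique:
  assumes inj: "inj_on \<xi> E" and "first_hit \<xi> v s g" "first_hit \<xi> v s g'"
  shows "g = g'"
proof -
  have le: False if S: "S \<in> invaded \<xi> v j" "min_bd \<xi> S h" "h \<inter> inf_verts \<xi> s \<noteq> {}"
      "S' \<in> invaded \<xi> v k" "S' \<inter> inf_verts \<xi> s = {}" "j < k" for S S' h j k
  proof -
    have "S' \<in> invaded \<xi> v (Suc j + (k - Suc j))" using S(4,6) by simp
    then have "S \<union> h \<subseteq> S'" by (rule invaded_mono[OF inj S(1,2)])
    then show False using S(3,5) by blast
  qed
  obtain k S where S: "S \<in> invaded \<xi> v k" "S \<inter> inf_verts \<xi> s = {}" "min_bd \<xi> S g" "g \<inter> inf_verts \<xi> s \<noteq> {}"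
    using assms(2) unfolding first_hit_def by blast
  obtain k' S' where S': "S' \<in> invaded \<xi> v k'" "S' \<inter> inf_verts \<xi> s = {}" "min_bd \<xi> S' g'" "g' \<inter> inf_verts \<xi> s \<noteq> {}"
    using assms(3) unfolding first_hit_def by blast
  have "k = k'" using le[OF S(1,3,4) S'(1,2)] le[OF S'(1,3,4) S(1,2)] by (cases k k' rule: linorder_cases) auto
  then have "S = S'" using invaded_unique[OF inj S(1)] S'(1) by simp
  then show ?thesis using min_bd_unique[OF inj S(3)] S'(3) by simp
qed

text \<open>
  Lowering a chance edge into the interval from \<open>s\<close> to \<open>t\<close> forces the invasion to use it: otherwise
  it would from some time on only use labels below \<open>t\<close> and hence be in an infinite cluster.
\<close>

lemma first_hit_of_chance:
  assumes v: "v \<in> V" and av: "avoids \<xi> v t" and ch: "chance \<xi> v s g" and u: "s < u" "u < t"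
  shows "first_hit (\<xi>(g := u)) v s g"
proof (rule ccontr)
  assume no: "\<not> ?thesis"
  define \<xi>' where "\<xi>' = \<xi>(g := u)"
  obtain k0 S0 x w where S0: "S0 \<in> invaded \<xi> v k0" "x \<in> S0" "w \<notin> S0" "g = {x, w}" "g \<in> E" "w \<in> inf_verts \<xi> s"
    using ch unfolding chance_def by blast
  have wt: "w \<in> inf_verts \<xi> t" using S0(6) inf_verts_mono[of s t \<xi>] u by auto
  have w_never: "w \<notin> S" if "S \<in> invaded \<xi> v k" for S k using av wt that unfolding avoids_def by blast
  \<comment> \<open>Otherwise \<open>x\<close> would share the infinite cluster of \<open>w\<close>
    at level \<open>t\<close>.\<close>
  have g_t: "\<xi> g \<ge> t"
  proof (rule ccontr)
    assume "\<not> \<xi> g \<ge> t"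
    then have "{w, x} \<in> below \<xi> t" using S0(4,5) by (simp add: below_def insert_commute)
    then have "x \<in> inf_verts \<xi> t" by (intro inf_verts_reachable[OF wt] reachable_edge)
    then show False using av S0(1,2) unfolding avoids_def by blast
  qed
  have "below \<xi>' s = below \<xi> s" using g_t u unfolding \<xi>'_def by (auto simp: below_def)
  then have inf_s: "inf_verts \<xi>' s = inf_verts \<xi> s" by (simp add: inf_verts_def)
  have avs: "S \<inter> inf_verts \<xi> s = {}" if "S \<in> invaded \<xi> v k" for S k
    using av that inf_verts_mono[of s t \<xi>] u unfolding avoids_def by fastforce
  \<comment> \<open>If the lowered edge were ever cheapest, it would be the first hit. So the old
    choice stays cheapest, with a label below \<open>u\<close> whenever \<open>g\<close> is
    available.\<close>
  have step: "S \<in> invaded \<xi>' v k \<Longrightarrow> S \<in> invaded \<xi> v k \<Longrightarrow> min_bd \<xi> S e \<Longrightarrow> min_bd \<xi>' S e \<and> (g \<in> bd S \<longrightarrow> \<xi> e < u)" for S k e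
  proof -
    assume S: "S \<in> invaded \<xi>' v k" "S \<in> invaded \<xi> v k" and e: "min_bd \<xi> S e"
    have ne: "e \<noteq> g"
    proof
      assume "e = g"
      then have "S \<union> g \<in> invaded \<xi> v (Suc k)" using S(2) e by auto
      then show False using w_never[of "S \<union> g"] S0(4) by blast
    qed
    show ?thesis
    proof (cases "g \<in> bd S")
      case False
      then have "\<xi>' f = \<xi> f" if "f \<in> bd S" for f using that by (auto simp: \<xi>'_def)
      then show ?thesis using e False by (auto simp: min_bd_def)
    next
      case True
      have "\<not> min_bd \<xi>' S g"
      proof
        assume "min_bd \<xi>' S g"
        moreover have "g \<inter> inf_verts \<xi>' s \<noteq> {}" using S0(4,6) inf_s by auto
        moreover have "S \<inter> inf_verts \<xi>' s = {}" using avs[OF S(2)] inf_s by simp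
        ultimately show False using no S(1) unfolding first_hit_def \<xi>'_def by blast
      qed
      then obtain f where f: "f \<in> bd S" "\<xi>' f < \<xi>' g" using True by (auto simp: min_bd_def not_le)
      then have "f \<noteq> g" by auto
      then have "\<xi> f < u" using f by (simp add: \<xi>'_def)
      moreover have "\<xi> e \<le> \<xi> f" using e f(1) by (simp add: min_bd_def)
      ultimately have eu: "\<xi> e < u" by simp
      have "\<xi>' e \<le> \<xi>' h" if "h \<in> bd S" for h
        using e that ne eu by (cases "h = g") (auto simp: \<xi>'_def min_bd_def)
      then show ?thesis using e eu by (auto simp: min_bd_def)
    qed
  qed
  have same: "S \<in> invaded \<xi>' v k" if "S \<in> invaded \<xi> v k" for S k
    using that
  proof (induction k arbitrary: S)
    case (Suc k)
    then obtain T e where T: "S = T \<union> e" "T \<in> invaded \<xi> v k" "min_bd \<xi> T e" by auto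
    then have "T \<in> invaded \<xi>' v k" using Suc.IH by blast
    then show ?case using step[OF _ T(2,3)] T(1) by auto
  qed simp
  let ?U = "\<Union>z\<in>S0. cluster (below \<xi> t) z"
  \<comment> \<open>From stage \<open>k0\<close> on, \<open>g\<close> stays on the boundary, so only
    edges of label below \<open>t\<close> are added and the invasion remains in the clusters of
    \<open>S0\<close> at level \<open>t\<close>.\<close>
  have grow: "\<exists>S\<in>invaded \<xi> v (k0 + j). S0 \<subseteq> S \<and> S \<subseteq> ?U" for j
  proof (induction j)
    case 0
    have "S0 \<subseteq> ?U" by auto
    then show ?case using S0(1) by (intro bexI[of _ S0]) auto
  next
    case (Suc j)
    then obtain S where S: "S \<in> invaded \<xi> v (k0 + j)" "S0 \<subseteq> S" "S \<subseteq> ?U" by blast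
    obtain e where e: "min_bd \<xi> S e" "S \<union> e \<in> invaded \<xi> v (Suc (k0 + j))" using invaded_step[OF v S(1)] .
    have "g \<in> bd S" unfolding S0(4) using S0 S w_never[OF S(1)] by (intro bdI) auto
    then have "\<xi> e < t" using step[OF same[OF S(1)] S(1) e(1)] u by auto
    have "e \<in> bd S" using e(1) by (simp add: min_bd_def)
    then obtain a b where ab: "e = {a, b}" "a \<in> S" "b \<notin> S" "e \<in> E" by (elim bdE) blast
    obtain z where z: "z \<in> S0" "(z, a) \<in> reachable (below \<xi> t)" using S(3) ab(2) by auto
    have "{a, b} \<in> below \<xi> t" using ab \<open>\<xi> e < t\<close> by (simp add: below_def)
    then have "(z, b) \<in> reachable (below \<xi> t)" by (rule reachable_trans[OF z(2) reachable_edge])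
    then have "S \<union> e \<subseteq> ?U" using S(3) ab z by auto
    then show ?case using e(2) S(2) by (intro bexI[of _ "S \<union> e"]) auto
  qed
  have "infinite ?U"
  proof
    assume fin: "finite ?U"
    obtain S where S: "S \<in> invaded \<xi> v (k0 + card ?U)" "S \<subseteq> ?U" using grow by blast
    then have "card S \<le> card ?U" using fin card_mono by blast
    then show False using invaded_props[OF v S(1)] by simp
  qed
  moreover have S0p: "finite S0" "S0 \<subseteq> V" using invaded_props[OF v S0(1)] by auto
  ultimately obtain z where "z \<in> S0" "infinite (cluster (below \<xi> t) z)" by auto
  then have "z \<in> S0 \<inter> inf_verts \<xi> t" using S0p by (auto simp: inf_verts_def)
  then show False using av S0(1) unfolding avoids_def by blast
qed

lemma pred_avoids: "v \<in> V \<Longrightarrow> Measurable.pred labels (\<lambda>\<xi>. avoids \<xi> v t)"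
proof -
  assume v: "v \<in> V"
  have "avoids \<xi> v t \<longleftrightarrow> \<not> (\<exists>k. \<exists>S\<in>invaded \<xi> v k. \<exists>x\<in>V. x \<in> S \<and> x \<in> inf_verts \<xi> t)" for \<xi>
    using inf_verts_subset[of \<xi> t] unfolding avoids_def by blast
  moreover have "Measurable.pred labels (\<lambda>\<xi>. \<not> (\<exists>k. \<exists>S\<in>invaded \<xi> v k. \<exists>x\<in>V. x \<in> S \<and> x \<in> inf_verts \<xi> t))"
    by (intro pred_intros_logic pred_intros_countable pred_bex_invaded v pred_countable_bounded countable_V pred_inf_verts) simp
  ultimately show ?thesis by presburger
qed

lemma pred_chance: "v \<in> V \<Longrightarrow> Measurable.pred labels (\<lambda>\<xi>. chance \<xi> v s g)"
proof -
  assume v: "v \<in> V"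
  have "Measurable.pred labels (\<lambda>\<xi>. \<exists>x\<in>S. \<exists>w\<in>V. w \<notin> S \<and> g = {x, w} \<and> g \<in> E \<and> w \<in> inf_verts \<xi> s)" if "S \<subseteq> V" for S
    by (intro pred_countable_bounded pred_intros_logic countable_V countable_subset[OF that countable_V] pred_inf_verts) simp_all
  then show ?thesis unfolding chance_def by (intro pred_intros_countable pred_bex_invaded v)
qed

lemma pred_first_hit: "v \<in> V \<Longrightarrow> Measurable.pred labels (\<lambda>\<xi>. first_hit \<xi> v s g)"
proof -
  assume v: "v \<in> V"
  have "(S \<inter> inf_verts \<xi> s = {} \<and> min_bd \<xi> S g \<and> g \<inter> inf_verts \<xi> s \<noteq> {}) \<longleftrightarrow>
    ((\<forall>x\<in>V. x \<in> S \<longrightarrow> x \<notin> inf_verts \<xi> s) \<and> min_bd \<xi> S g \<and> (\<exists>x\<in>V. x \<in> g \<and> x \<in> inf_verts \<xi> s))" for S \<xi>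
    using inf_verts_subset[of \<xi> s] by blast
  moreover have "Measurable.pred labels (\<lambda>\<xi>. (\<forall>x\<in>V. x \<in> S \<longrightarrow> x \<notin> inf_verts \<xi> s) \<and> min_bd \<xi> S g \<and> (\<exists>x\<in>V. x \<in> g \<and> x \<in> inf_verts \<xi> s))" for S
    by (intro pred_intros_logic pred_countable_bounded countable_V pred_inf_verts pred_min_bd) simp_all
  ultimately have "Measurable.pred labels (\<lambda>\<xi>. S \<inter> inf_verts \<xi> s = {} \<and> min_bd \<xi> S g \<and> g \<inter> inf_verts \<xi> s \<noteq> {})" for S
    by presburger
  then show ?thesis unfolding first_hit_def by (intro pred_intros_countable pred_bex_invaded v)
qed

lemma pred_inj: "Measurable.pred labels (\<lambda>\<xi>. inj_on \<xi> E)"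
proof -
  have "Measurable.pred labels (\<lambda>\<xi>. \<xi> e = \<xi> f)" if "e \<in> E" "f \<in> E" for e f
    unfolding pred_def by (intro borel_measurable_eq measurable_label that)
  then show ?thesis unfolding inj_on_def
    by (intro pred_countable_bounded pred_intros_logic countable_E) auto
qed

lemma AE_inj: "AE \<xi> in labels. inj_on \<xi> E"
proof -
  have "AE \<xi> in labels. \<forall>e\<in>E. \<forall>f\<in>E. e \<noteq> f \<longrightarrow> \<xi> e \<noteq> \<xi> f"
  proof (intro AE_ball_countable'[OF _ countable_E])
    fix e f assume ef: "e \<in> E" "f \<in> E"
    show "AE \<xi> in labels. e \<noteq> f \<longrightarrow> \<xi> e \<noteq> \<xi> f"
    proof (cases "e = f")
      case False
      have "AE \<xi> in labels. \<xi> e \<noteq> \<xi> f"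
      proof (rule AE_resample_rev[OF _ ef(1)])
        show "Measurable.pred labels (\<lambda>\<xi>. \<xi> e \<noteq> \<xi> f)"
          unfolding pred_def by (intro borel_measurable_neq measurable_label ef)
        show "AE \<xi> in labels. AE u in unif. (\<xi>(e := u)) e \<noteq> (\<xi>(e := u)) f"
          using False AE_unif_neq by simp
      qed
      then show ?thesis by eventually_elim simp
    qed simp
  qed
  then show ?thesis by eventually_elim (auto simp: inj_on_def)
qed

text \<open>Resampling \<open>g\<close> within the interval leads from the left event to a first hit
  at \<open>g\<close>, and resampling preserves the measure. Distinctness of labels is recorded
  because it makes first hits at different edges disjoint.\<close>

lemma prob_chance_le:
  assumes v: "v \<in> V" and g: "g \<in> E" and st: "0 \<le> s" "s < t" "t \<le> 1"
  shows "emeasure labels (event (\<lambda>\<xi>. avoids \<xi> v t \<and> chance \<xi> v s g)) * ennreal (t - s) \<le>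
    emeasure labels (event (\<lambda>\<xi>. first_hit \<xi> v s g \<and> inj_on \<xi> E))"
proof -
  interpret P: pair_sigma_finite labels unif ..
  let ?A = "event (\<lambda>\<xi>. avoids \<xi> v t \<and> chance \<xi> v s g)"
  let ?H = "event (\<lambda>\<xi>. first_hit \<xi> v s g)"
  let ?T = "\<lambda>(\<xi>, u). \<xi>(g := u :: real)"
  have A: "?A \<in> sets labels" using pred_intros_logic(3)[OF pred_avoids[OF v] pred_chance[OF v]] by (simp add: pred_def)
  have H: "?H \<in> sets labels" using pred_first_hit[OF v] by (simp add: pred_def)
  have I: "{s<..<t} \<in> sets unif" using sets_unif by simp
  have "emeasure labels ?A * ennreal (t - s) = emeasure labels ?A * emeasure unif {s<..<t}"
    using st by (simp add: emeasure_unif_interval)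
  also have "\<dots> = emeasure (labels \<Otimes>\<^sub>M unif) (?A \<times> {s<..<t})"
    by (rule unif.emeasure_pair_measure_Times[OF A I, symmetric])
  also have "\<dots> \<le> emeasure (labels \<Otimes>\<^sub>M unif) (?T -` ?H \<inter> space (labels \<Otimes>\<^sub>M unif))"
  proof (rule emeasure_mono)
    show "?A \<times> {s<..<t} \<subseteq> ?T -` ?H \<inter> space (labels \<Otimes>\<^sub>M unif)"
    proof
      fix z assume "z \<in> ?A \<times> {s<..<t}"
      then obtain \<xi> u where z: "z = (\<xi>, u)" "\<xi> \<in> space labels" "avoids \<xi> v t" "chance \<xi> v s g" "s < u" "u < t" by auto
      have "first_hit (\<xi>(g := u)) v s g" by (rule first_hit_of_chance[OF v z(3,4,5,6)])
      then show "z \<in> ?T -` ?H \<inter> space (labels \<Otimes>\<^sub>M unif)"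
        using z label_upd_in_space[OF z(2) g] by (simp add: space_pair_measure)
    qed
    show "?T -` ?H \<inter> space (labels \<Otimes>\<^sub>M unif) \<in> sets (labels \<Otimes>\<^sub>M unif)"
      by (rule measurable_sets[OF measurable_resample[OF g] H])
  qed
  also have "\<dots> = emeasure (distr (labels \<Otimes>\<^sub>M unif) labels ?T) ?H"
    by (rule emeasure_distr[OF measurable_resample[OF g] H, symmetric])
  also have "\<dots> = emeasure labels ?H" unfolding distr_resample[OF g] ..
  also have "\<dots> = emeasure labels (event (\<lambda>\<xi>. first_hit \<xi> v s g \<and> inj_on \<xi> E))"
    using AE_inj pred_intros_logic(3)[OF pred_first_hit[OF v] pred_inj] H
    by (intro emeasure_eq_AE) (auto simp: pred_def)
  finally show ?thesis .
qed

text \<open>Summing \<open>prob_chance_le\<close> over the disjoint first hits bounds the expected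
  number of chances by \<open>1 / (t - s)\<close>.\<close>

lemma AE_finite_chances:
  assumes v: "v \<in> V" and st: "0 \<le> s" "s < t" "t \<le> 1"
  shows "AE \<xi> in labels. avoids \<xi> v t \<longrightarrow> finite {g\<in>E. chance \<xi> v s g}"
proof -
  let ?A = "\<lambda>g. event (\<lambda>\<xi>. avoids \<xi> v t \<and> chance \<xi> v s g)"
  let ?H = "\<lambda>g. event (\<lambda>\<xi>. first_hit \<xi> v s g \<and> inj_on \<xi> E)"
  have H: "?H g \<in> sets labels" for g
    using pred_intros_logic(3)[OF pred_first_hit[OF v] pred_inj] by (simp add: pred_def)
  have "(\<integral>\<^sup>+g. emeasure labels (?A g) \<partial>count_space E) * ennreal (t - s) =
      (\<integral>\<^sup>+g. emeasure labels (?A g) * ennreal (t - s) \<partial>count_space E)"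
    by (rule nn_integral_multc[symmetric]) simp
  also have "\<dots> \<le> (\<integral>\<^sup>+g. emeasure labels (?H g) \<partial>count_space E)"
    using prob_chance_le[OF v _ st] by (intro nn_integral_mono) simp
  also have "\<dots> = emeasure labels (\<Union>g\<in>E. ?H g)"
  proof (rule emeasure_UN_countable[symmetric])
    show "disjoint_family_on ?H E"
      unfolding disjoint_family_on_def
    proof (intro ballI impI)
      fix g g' :: "'a set" assume "g \<noteq> g'"
      then have "\<not> (first_hit \<xi> v s g \<and> inj_on \<xi> E \<and> first_hit \<xi> v s g')" for \<xi>
        using first_hit_unique[of \<xi> v s g g'] by argo
      then show "?H g \<inter> ?H g' = {}" by auto
    qed
  qed (use H countable_E in auto)
  also have "\<dots> \<le> 1" by (rule labels.measure_le_1)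
  finally have "(\<integral>\<^sup>+g. emeasure labels (?A g) \<partial>count_space E) * ennreal (t - s) < \<infinity>"
    by (rule le_less_trans) simp
  then have "(\<integral>\<^sup>+g. emeasure labels (?A g) \<partial>count_space E) < \<infinity>"
    using st by (auto simp: ennreal_mult_less_top ennreal_eq_0_iff)
  then have "AE \<xi> in labels. finite {g\<in>E. avoids \<xi> v t \<and> chance \<xi> v s g}"
    by (intro AE_finite_of_summable countable_E pred_intros_logic pred_avoids pred_chance v)
  then show ?thesis by eventually_elim auto
qed

end

context utgraph
begin

text \<open>A late stage \<open>S\<close> has many points outside \<open>B\<close>, so with high
  probability one of them has an infinite cluster off \<open>B\<close>. Where that cluster finally
  leaves \<open>S\<close> there is a chance, and the labels beyond are independent of the
  stage.\<close>

lemma AE_chance_outside: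
  assumes v: "v \<in> V" and B: "finite B" "B \<subseteq> V" and inf: "AE \<xi> in labels. inf_verts \<xi> s \<noteq> {}"
    and st: "s < t"
  shows "AE \<xi> in labels. avoids \<xi> v t \<longrightarrow> (\<exists>g\<in>E. chance \<xi> v s g \<and> \<not> g \<subseteq> B \<union> inf_verts \<xi> s)"
proof -
  \<comment> \<open>The label of \<open>{x, w}\<close> is left free and the cluster avoids
    \<open>S\<close>, so \<open>D S\<close> reads no edge touching \<open>S\<close> and is
    independent of \<open>S\<close> being invaded.\<close>
  define D where "D S \<xi> \<longleftrightarrow> (\<exists>x\<in>S - B. \<exists>w\<in>V. w \<notin> S \<union> B \<and> {x, w} \<in> E \<and>
      infinite (cluster (avoiding (below \<xi> s) (S \<union> B)) w))" for S \<xi>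
  have pred_D: "Measurable.pred labels (D S)" if "S \<subseteq> V" for S
    unfolding D_def
    by (intro pred_countable_bounded pred_intros_logic countable_V pred_infinite_cluster random_avoiding random_below
      countable_subset[OF _ countable_V]) (use that in auto)
  have dep_D: "depends_on (D S) {e. e \<inter> S = {}}" for S
  proof -
    have eq: "avoiding (below \<xi> s) (S \<union> B) = avoiding (below \<xi>' s) (S \<union> B)"
      if "\<forall>e\<in>{e. e \<inter> S = {}} \<inter> E. \<xi> e = \<xi>' e" for \<xi> \<xi>' :: "'a set \<Rightarrow> real"
    proof (intro set_eqI)
      fix e
      show "e \<in> avoiding (below \<xi> s) (S \<union> B) \<longleftrightarrow> e \<in> avoiding (below \<xi>' s) (S \<union> B)"
      proof (cases "e \<in> E \<and> e \<inter> S = {}")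
        case True
        then have "\<xi> e = \<xi>' e" using that by blast
        then show ?thesis by (simp add: avoiding_def below_def)
      qed (auto simp: avoiding_def below_def)
    qed
    show ?thesis unfolding depends_on_def
    proof (intro ballI impI)
      fix \<xi> \<xi>' :: "'a set \<Rightarrow> real" assume "\<forall>e\<in>{e. e \<inter> S = {}} \<inter> E. \<xi> e = \<xi>' e"
      then show "D S \<xi> = D S \<xi>'" unfolding D_def using eq[of \<xi> \<xi>'] by simp
    qed
  qed
  have exit: "\<exists>y\<in>S - B. infinite (cluster (avoiding (below \<xi> s) B) y) \<Longrightarrow> D S \<xi>" if S: "finite S" for S \<xi>
  proof -
    assume "\<exists>y\<in>S - B. infinite (cluster (avoiding (below \<xi> s) B) y)"
    then obtain y where y: "y \<in> S" "infinite (cluster (avoiding (below \<xi> s) B) y)" by blast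
    have sub: "avoiding (below \<xi> s) B \<subseteq> E" using avoiding_subset below_subset by blast
    from infinite_cluster_avoiding[OF sub S y] obtain x w where
      xw: "x \<in> S" "w \<notin> S" "{x, w} \<in> avoiding (below \<xi> s) B"
        "infinite (cluster (avoiding (avoiding (below \<xi> s) B) S) w)" by blast
    have "avoiding (avoiding (below \<xi> s) B) S = avoiding (below \<xi> s) (S \<union> B)" by (auto simp: avoiding_def)
    moreover have "x \<notin> B" "w \<notin> B" "{x, w} \<in> E" using xw(3) by (auto simp: avoiding_def below_def)
    moreover have "w \<in> V" using \<open>{x, w} \<in> E\<close> edge_verts by blast
    ultimately show ?thesis unfolding D_def using xw by (intro bexI[of _ x] bexI[of _ w]) auto
  qed
  define C where "C \<xi> \<longleftrightarrow> inj_on \<xi> E \<and> avoids \<xi> v t \<and> (\<forall>k. \<forall>S\<in>invaded \<xi> v k. \<not> D S \<xi>)" for \<xi>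
  have C_meas: "Measurable.pred labels C"
  proof -
    have "C \<xi> \<longleftrightarrow> inj_on \<xi> E \<and> avoids \<xi> v t \<and> \<not> (\<exists>k. \<exists>S\<in>invaded \<xi> v k. D S \<xi>)" for \<xi> by (simp add: C_def)
    moreover have "Measurable.pred labels (\<lambda>\<xi>. inj_on \<xi> E \<and> avoids \<xi> v t \<and> \<not> (\<exists>k. \<exists>S\<in>invaded \<xi> v k. D S \<xi>))"
      by (intro pred_intros_logic pred_inj pred_avoids v pred_intros_countable pred_bex_invaded pred_D)
    ultimately show ?thesis by presburger
  qed
  let ?Fin = "{S. finite S \<and> S \<subseteq> V}"
  have small: "emeasure labels (event C) \<le> ennreal \<epsilon>" if \<epsilon>: "\<epsilon> > 0" for \<epsilon>
  proof -
    obtain n where n: "\<And>X. finite X \<Longrightarrow> X \<subseteq> V \<Longrightarrow> n \<le> card X \<Longrightarrow>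
        labels.prob (event (\<lambda>\<xi>. \<forall>y\<in>X. finite (cluster (avoiding (below \<xi> s) B) y))) \<le> \<epsilon>"
      using hit_infinite_cluster[OF inf B(1) \<epsilon>] by blast
    \<comment> \<open>A stage has \<open>k + 1\<close> points, so at least \<open>n\<close> of them
      lie outside \<open>B\<close>.\<close>
    define k where "k = n + card B"
    let ?I = "\<lambda>S. event (\<lambda>\<xi>. S \<in> invaded \<xi> v k \<and> inj_on \<xi> E)"
    let ?N = "\<lambda>S. event (\<lambda>\<xi>. S \<in> invaded \<xi> v k \<and> \<not> D S \<xi> \<and> inj_on \<xi> E)"
    have I: "?I S \<in> sets labels" for S
      using pred_intros_logic(3)[OF pred_invaded[OF v] pred_inj] by (simp add: pred_def)
    have N: "?N S \<in> sets labels" if "S \<subseteq> V" for S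
    proof -
      have "Measurable.pred labels (\<lambda>\<xi>. S \<in> invaded \<xi> v k \<and> \<not> D S \<xi> \<and> inj_on \<xi> E)"
        by (intro pred_intros_logic pred_invaded v pred_D pred_inj that)
      then show ?thesis by (simp add: pred_def)
    qed
    have bound: "emeasure labels (?N S) \<le> ennreal \<epsilon> * emeasure labels (?I S)" if S: "S \<in> ?Fin" for S
    proof (cases "card S = Suc k")
      case False
      then have "?N S = {}" using invaded_props[OF v] by blast
      then have "emeasure labels (?N S) = 0" by (simp only: emeasure_empty)
      then show ?thesis by (simp only: zero_le)
    next
      case True
      have SV: "finite S" "S \<subseteq> V" using S by auto
      have "card S - card B \<le> card (S - B)" by (rule diff_card_le_card_Diff[OF B(1)])
      then have "n \<le> card (S - B)" using True k_def by linarith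
      then have hit: "labels.prob (event (\<lambda>\<xi>. \<forall>y\<in>S - B. finite (cluster (avoiding (below \<xi> s) B) y))) \<le> \<epsilon>"
        using SV by (intro n) auto
      have predf: "Measurable.pred labels (\<lambda>\<xi>. \<forall>y\<in>S - B. finite (cluster (avoiding (below \<xi> s) B) y))"
      proof -
        have "Measurable.pred labels (\<lambda>\<xi>. \<forall>y\<in>S - B. \<not> infinite (cluster (avoiding (below \<xi> s) B) y))"
          by (intro pred_countable_bounded pred_intros_logic pred_infinite_cluster random_avoiding random_below
            countable_finite) (use SV in auto)
        then show ?thesis by simp
      qed
      have "labels.prob (event (\<lambda>\<xi>. \<not> D S \<xi>)) \<le> labels.prob (event (\<lambda>\<xi>. \<forall>y\<in>S - B. finite (cluster (avoiding (below \<xi> s) B) y)))"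
        using exit[OF SV(1)] predf by (intro labels.finite_measure_mono) (auto simp: pred_def)
      then have nD: "labels.prob (event (\<lambda>\<xi>. \<not> D S \<xi>)) \<le> \<epsilon>" using hit by linarith
      have "emeasure labels (?N S) \<le> emeasure labels (event (\<lambda>\<xi>. S \<in> invaded \<xi> v k \<and> \<not> D S \<xi>))"
        using pred_intros_logic(3)[OF pred_invaded[OF v, of S k] pred_intros_logic(2)[OF pred_D[OF SV(2)]]]
        by (intro emeasure_mono) (auto simp: pred_def)
      also have "\<dots> = ennreal (labels.prob (event (\<lambda>\<xi>. S \<in> invaded \<xi> v k)) * labels.prob (event (\<lambda>\<xi>. \<not> D S \<xi>)))"
        unfolding labels.emeasure_eq_measure
        by (subst prob_indep2[OF pred_invaded[OF v] pred_intros_logic(2)[OF pred_D[OF SV(2)]]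
            depends_on_invaded depends_on_not[OF dep_D]]) auto
      also have "\<dots> \<le> ennreal (labels.prob (event (\<lambda>\<xi>. S \<in> invaded \<xi> v k)) * \<epsilon>)"
        using nD by (intro ennreal_leI mult_left_mono) auto
      also have "\<dots> = ennreal \<epsilon> * emeasure labels (event (\<lambda>\<xi>. S \<in> invaded \<xi> v k))"
        using \<epsilon> by (simp add: labels.emeasure_eq_measure ennreal_mult mult.commute)
      also have "emeasure labels (event (\<lambda>\<xi>. S \<in> invaded \<xi> v k)) = emeasure labels (?I S)"
        using AE_inj I pred_invaded[OF v] by (intro emeasure_eq_AE) (auto simp: pred_def)
      finally show ?thesis .
    qed
    have disj: "disjoint_family_on ?I ?Fin"
      unfolding disjoint_family_on_def
    proof (intro ballI impI)
      fix S S' :: "'a set" assume "S \<noteq> S'"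
      then have "\<not> (S \<in> invaded \<xi> v k \<and> inj_on \<xi> E \<and> S' \<in> invaded \<xi> v k)" for \<xi>
        using invaded_unique[of \<xi> S v k S'] by argo
      then show "?I S \<inter> ?I S' = {}" by auto
    qed
    then have disjN: "disjoint_family_on ?N ?Fin" by (rule disjoint_family_on_bisimulation) auto
    have subC: "event C \<subseteq> (\<Union>S\<in>?Fin. ?N S)"
    proof
      fix \<xi> assume \<xi>: "\<xi> \<in> event C"
      obtain S where S: "S \<in> invaded \<xi> v k" using invaded_nonempty[OF v] by blast
      then have "S \<in> ?Fin" using invaded_props[OF v S] by simp
      then show "\<xi> \<in> (\<Union>S\<in>?Fin. ?N S)" using \<xi> S unfolding C_def by blast
    qed
    have "(\<Union>S\<in>?Fin. ?N S) \<in> sets labels"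
      using N countable_finite_subsets by (intro sets.countable_UN'') auto
    then have "emeasure labels (event C) \<le> emeasure labels (\<Union>S\<in>?Fin. ?N S)"
      by (rule emeasure_mono[OF subC])
    also have "\<dots> = (\<integral>\<^sup>+S. emeasure labels (?N S) \<partial>count_space ?Fin)"
      by (rule emeasure_UN_countable[OF _ countable_finite_subsets disjN]) (use N in auto)
    also have "\<dots> \<le> (\<integral>\<^sup>+S. ennreal \<epsilon> * emeasure labels (?I S) \<partial>count_space ?Fin)"
      using bound by (intro nn_integral_mono) simp
    also have "\<dots> = ennreal \<epsilon> * (\<integral>\<^sup>+S. emeasure labels (?I S) \<partial>count_space ?Fin)"
      by (rule nn_integral_cmult) simp
    also have "(\<integral>\<^sup>+S. emeasure labels (?I S) \<partial>count_space ?Fin) = emeasure labels (\<Union>S\<in>?Fin. ?I S)"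
      by (rule emeasure_UN_countable[OF _ countable_finite_subsets disj, symmetric]) (use I in auto)
    also have "ennreal \<epsilon> * \<dots> \<le> ennreal \<epsilon> * 1" by (intro mult_left_mono labels.measure_le_1) simp
    finally show ?thesis by simp
  qed
  have evC: "event C \<in> sets labels" using C_meas by (simp add: pred_def)
  have "labels.prob (event C) = 0"
  proof (rule ccontr)
    assume "labels.prob (event C) \<noteq> 0"
    then have pos: "labels.prob (event C) > 0" by (simp add: zero_less_measure_iff)
    then have "ennreal (labels.prob (event C)) \<le> ennreal (labels.prob (event C) / 2)"
      using small[of "labels.prob (event C) / 2"] by (simp add: labels.emeasure_eq_measure)
    then show False using pos by (simp add: ennreal_le_iff)
  qed
  then have "AE \<xi> in labels. \<xi> \<notin> event C" using labels.prob_eq_0[OF evC] by simp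
  with AE_space AE_inj show ?thesis
  proof eventually_elim
    case (elim \<xi>)
    show ?case
    proof
      assume av: "avoids \<xi> v t"
      then obtain k S where S: "S \<in> invaded \<xi> v k" "D S \<xi>" using elim unfolding C_def by blast
      then obtain x w where xw: "x \<in> S" "x \<notin> B" "w \<in> V" "w \<notin> S" "{x, w} \<in> E"
        "infinite (cluster (avoiding (below \<xi> s) (S \<union> B)) w)" unfolding D_def by blast
      have "infinite (cluster (below \<xi> s) w)"
        using xw(6) finite_subset[OF cluster_mono[OF avoiding_subset[of "below \<xi> s" "S \<union> B"]]] by metis
      then have w: "w \<in> inf_verts \<xi> s" using xw(3) by (simp add: inf_verts_def)
      then have "chance \<xi> v s {x, w}" using S(1) xw unfolding chance_def by blast
      \<comment> \<open>The inner end \<open>x\<close> is outside \<open>B\<close> and, as the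
        invasion avoids level \<open>t\<close>, outside \<open>inf_verts \<xi> s\<close>; it is the
        point that keeps the edge out of the union.\<close>
      moreover have "x \<notin> inf_verts \<xi> s"
        using av S(1) xw(1) inf_verts_mono[of s t \<xi>] st unfolding avoids_def by fastforce
      ultimately show "\<exists>g\<in>E. chance \<xi> v s g \<and> \<not> g \<subseteq> B \<union> inf_verts \<xi> s"
        using xw by (intro bexI[of _ "{x, w}"]) auto
    qed
  qed
qed

text \<open>If level \<open>t\<close> were avoided, the finitely many chances would span a finite
  set, and \<open>AE_chance_outside\<close> would give a chance not contained in it.\<close>

lemma AE_tree_meets_inf_verts:
  assumes inf: "AE \<xi> in labels. inf_verts \<xi> s \<noteq> {}" and st: "0 \<le> s" "s < t" "t \<le> 1"
  shows "AE \<xi> in labels. \<forall>v\<in>V. cluster (forest \<xi>) v \<inter> inf_verts \<xi> t \<noteq> {}"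
proof (rule AE_ball_countable'[OF _ countable_V])
  fix v assume v: "v \<in> V"
  let ?Fin = "{S. finite S \<and> S \<subseteq> V}"
  have "AE \<xi> in labels. \<forall>B\<in>?Fin. avoids \<xi> v t \<longrightarrow> (\<exists>g\<in>E. chance \<xi> v s g \<and> \<not> g \<subseteq> B \<union> inf_verts \<xi> s)"
    using AE_chance_outside[OF v _ _ inf st(2)] by (intro AE_ball_countable'[OF _ countable_finite_subsets]) auto
  with AE_finite_chances[OF v st] show "AE \<xi> in labels. cluster (forest \<xi>) v \<inter> inf_verts \<xi> t \<noteq> {}"
  proof eventually_elim
    case (elim \<xi>)
    have "\<not> avoids \<xi> v t"
    proof
      assume av: "avoids \<xi> v t"
      let ?B = "\<Union> {g\<in>E. chance \<xi> v s g}"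
      have "finite ?B" using elim(1) av finite_edge by auto
      moreover have "?B \<subseteq> V" using edge_subset by blast
      ultimately have "?B \<in> ?Fin" by simp
      then obtain g where g: "g \<in> E" "chance \<xi> v s g" "\<not> g \<subseteq> ?B \<union> inf_verts \<xi> s"
        using bspec[OF elim(2)] av by blast
      then have "g \<in> {g\<in>E. chance \<xi> v s g}" by simp
      then have "g \<subseteq> ?B" by (rule Union_upper)
      then show False using g(3) by (simp add: le_supI1)
    qed
    then obtain k S where "S \<in> invaded \<xi> v k" "S \<inter> inf_verts \<xi> t \<noteq> {}" unfolding avoids_def by blast
    then show ?case using invaded_in_tree by blast
  qed
qed

end

context lf_graph
begin

section \<open>All trees contain bridges\<close>

lemma AE_unif_01: "AE u in unif. 0 < u \<and> u < 1"
proof -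
  have "AE u in lborel. u \<noteq> (0::real)" "AE u in lborel. u \<noteq> (1::real)" by (rule AE_lborel_singleton)+
  then have "AE u in lborel. u \<in> {0..1::real} \<longrightarrow> 0 < u \<and> u < 1" by eventually_elim auto
  then show ?thesis unfolding unif_def by (intro AE_uniform_measureI) auto
qed

lemma AE_label_less_1: "AE \<xi> in labels. \<forall>e\<in>E. \<xi> e < 1"
proof (rule AE_ball_countable'[OF _ countable_E])
  fix e assume e: "e \<in> E"
  show "AE \<xi> in labels. \<xi> e < 1"
  proof (rule AE_resample_rev[OF _ e])
    show "Measurable.pred labels (\<lambda>\<xi>. \<xi> e < 1)"
      unfolding pred_def by (intro borel_measurable_less measurable_label e) simp
    have "AE u in unif. (\<xi>(e := u)) e < 1" for \<xi> :: "'a set \<Rightarrow> real"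
      using AE_unif_01 by eventually_elim simp
    then show "AE \<xi> in labels. AE u in unif. (\<xi>(e := u)) e < 1" by simp
  qed
qed

text \<open>
  Given all other labels, there is at most one value of the label of \<open>e\<close> at which both endpoints of
  \<open>e\<close> are in infinite clusters for the first time.
\<close>

lemma AE_bridge_level:
  "AE \<xi> in labels. \<forall>e\<in>bridges \<xi>. \<exists>s\<in>\<rat>. 0 < s \<and> s < \<xi> e \<and> e \<subseteq> inf_verts \<xi> s"
proof -
  have "AE \<xi> in labels. \<forall>e\<in>E. e \<in> bridges \<xi> \<longrightarrow> (\<exists>s\<in>\<rat>. 0 < s \<and> s < \<xi> e \<and> e \<subseteq> inf_verts \<xi> s)"
  proof (rule AE_ball_countable'[OF _ countable_E])
    fix e assume e: "e \<in> E"
    let ?P = "\<lambda>\<xi>. e \<in> bridges \<xi> \<longrightarrow> (\<exists>s\<in>\<rat>. 0 < s \<and> s < \<xi> e \<and> e \<subseteq> inf_verts \<xi> s)"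
    show "AE \<xi> in labels. ?P \<xi>"
    proof (rule AE_resample_rev[OF _ e])
      have less: "Measurable.pred labels (\<lambda>\<xi>. s < \<xi> e)" for s
        unfolding pred_def by (intro borel_measurable_less measurable_label e) simp
      show "Measurable.pred labels ?P"
        unfolding subset_iff Ball_def[symmetric]
        by (intro pred_intros_logic random_edgesD random_bridges pred_countable_bounded countable_rat
          countable_finite finite_edge e pred_inf_verts less) simp
      have "AE u in unif. ?P (\<xi>(e := u))" for \<xi> :: "'a set \<Rightarrow> real"
      proof -
        \<comment> \<open>Infinite clusters at both ends without the help of \<open>e\<close>; for
          levels up to \<open>u\<close> this is what \<open>inf_verts\<close> says once
          \<open>e\<close> has label \<open>u\<close>.\<close>
        define J where "J s \<longleftrightarrow> e \<subseteq> {x\<in>V. infinite (cluster (below \<xi> s - {e}) x)}" for s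
        have J_mono: "J s'" if "J s" "s \<le> s'" for s s'
        proof -
          have "below \<xi> s - {e} \<subseteq> below \<xi> s' - {e}" using below_mono[OF that(2)] by blast
          from finite_subset[OF cluster_mono[OF this]] show ?thesis using that(1) unfolding J_def by blast
        qed
        have J: "e \<subseteq> inf_verts (\<xi>(e := u)) s \<longleftrightarrow> J s" if "s \<le> u" for s u
        proof -
          have "below (\<xi>(e := u)) s = below \<xi> s - {e}" using that by (auto simp: below_def split: if_splits)
          then show ?thesis by (simp add: inf_verts_def J_def)
        qed
        define bad where "bad u \<longleftrightarrow> 0 < u \<and> J u \<and> (\<forall>s\<in>\<rat>. 0 < s \<and> s < u \<longrightarrow> \<not> J s)" for u
        \<comment> \<open>Hence at most one value is bad: a rational between two of them would be a
          level that is already reached.\<close>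
        have bad_le: "u' \<le> u" if "bad u" "bad u'" for u u'
        proof (rule ccontr)
          assume "\<not> u' \<le> u"
          then obtain s where s: "s \<in> \<rat>" "u < s" "s < u'" using Rats_dense_in_real[of u u'] by auto
          then have "J s" using J_mono[of u s] that(1) by (auto simp: bad_def)
          then show False using that s by (auto simp: bad_def)
        qed
        have "AE u in unif. \<not> bad u"
        proof (cases "\<exists>c. bad c")
          case True
          then obtain c where c: "bad c" by blast
          have "AE u in unif. u \<noteq> c" by (rule AE_unif_neq)
          then show ?thesis
          proof eventually_elim
            case (elim u)
            then show ?case using bad_le[OF c, of u] bad_le[OF _ c, of u] by force
          qed
        qed simp
        with AE_unif_01 show ?thesis
        proof eventually_elim
          case (elim u)
          show ?case
          proof
            assume "e \<in> bridges (\<xi>(e := u))"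
            then have "J u" using J[of u u] by (auto simp: bridges_def)
            then obtain s where "s \<in> \<rat>" "0 < s" "s < u" "J s" using elim by (auto simp: bad_def)
            then show "\<exists>s\<in>\<rat>. 0 < s \<and> s < (\<xi>(e := u)) e \<and> e \<subseteq> inf_verts (\<xi>(e := u)) s"
              using J[of s u] by (intro bexI[of _ s]) auto
          qed
        qed
      qed
      then show "AE \<xi> in labels. AE u in unif. ?P (\<xi>(e := u))" by simp
    qed
  qed
  then show ?thesis
    by eventually_elim (use subset_trans[OF bridges_subset forest_subset] in blast)
qed

end

context utgraph
begin

text \<open>The almost sure facts are collected in one event and closed under resampling; in a
  configuration of the result, a bridge-free tree contradicts
  \<open>no_separate_pure\<close>.\<close>

lemma AE_not_pure:
  assumes "\<not> (AE \<xi> in labels. bridges \<xi> = {})"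
  shows "AE \<xi> in labels. \<forall>v\<in>V. \<not> pure \<xi> v"
proof -
  \<comment> \<open>Levels are rational so that countably many null sets suffice.\<close>
  let ?M = "\<lambda>\<xi>. \<forall>s\<in>\<rat>. \<forall>t\<in>\<rat>. 0 < s \<and> s < t \<and> t \<le> 1 \<longrightarrow> inf_verts \<xi> s \<noteq> {} \<longrightarrow>
    (\<forall>v\<in>V. cluster (forest \<xi>) v \<inter> inf_verts \<xi> t \<noteq> {})"
  define R where "R \<xi> \<longleftrightarrow> inj_on \<xi> E \<and> balanced \<xi> \<and> bridges \<xi> \<noteq> {} \<and> (\<forall>e\<in>E. \<xi> e < 1) \<and>
    (\<forall>e\<in>bridges \<xi>. \<exists>s\<in>\<rat>. 0 < s \<and> s < \<xi> e \<and> e \<subseteq> inf_verts \<xi> s) \<and> ?M \<xi>" for \<xi>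
  have "AE \<xi> in labels. ?M \<xi>"
  proof (intro AE_ball_countable'[OF _ countable_rat])
    fix s t :: real
    show "AE \<xi> in labels. 0 < s \<and> s < t \<and> t \<le> 1 \<longrightarrow> inf_verts \<xi> s \<noteq> {} \<longrightarrow>
      (\<forall>v\<in>V. cluster (forest \<xi>) v \<inter> inf_verts \<xi> t \<noteq> {})"
    proof (cases "0 < s \<and> s < t \<and> t \<le> 1")
      case st: True
      show ?thesis
      proof (cases "AE \<xi> in labels. inf_verts \<xi> s = {}")
        case True
        then show ?thesis by eventually_elim simp
      next
        case False
        have "AE \<xi> in labels. \<forall>v\<in>V. cluster (forest \<xi>) v \<inter> inf_verts \<xi> t \<noteq> {}"
          using st by (intro AE_tree_meets_inf_verts[OF AE_inf_verts[OF False]]) auto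
        then show ?thesis by eventually_elim simp
      qed
    qed (intro AE_I2, blast)
  qed
  with AE_inj AE_balanced AE_bridges[OF assms] AE_label_less_1 AE_bridge_level
  have AE_R: "AE \<xi> in labels. R \<xi>" by eventually_elim (simp add: R_def)
  obtain Q where Q: "AE \<xi> in labels. Q \<xi>" "\<And>\<xi>. Q \<xi> \<Longrightarrow> R \<xi>"
    "\<And>\<xi> e. Q \<xi> \<Longrightarrow> e \<in> E \<Longrightarrow> AE u in unif. Q (\<xi>(e := u))"
    by (rule AE_resampling_closed[OF AE_R]) blast
  interpret resampling V E Q
  proof
    show "\<exists>u. a < u \<and> u < b \<and> Q (\<xi>(e := u))"
      if "Q \<xi>" "e \<in> E" "0 \<le> a" "a < b" "b \<le> 1" for \<xi> e a b
      using AE_unif_ex[OF Q(3)[OF that(1,2)] that(3-5)] .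
    show "inj_on \<xi> E" "balanced \<xi>" if "Q \<xi>" for \<xi> using Q(2)[OF that] by (simp_all add: R_def)
  qed
  show ?thesis
    using Q(1)
  proof eventually_elim
    case (elim \<xi>)
    note props = Q(2)[OF elim, unfolded R_def]
    show ?case
    proof (intro ballI notI)
      fix v0 assume v0: "v0 \<in> V" "pure \<xi> v0"
      obtain h where h: "h \<in> bridges \<xi>" using props by blast
      then have hF: "h \<in> forest \<xi>" "h \<in> E" using bridges_subset forest_subset by blast+
      obtain c d where cd: "h = {c, d}" using hF(2) by (rule edgeE)
      have h1: "\<xi> h < 1" using props hF(2) by blast
      \<comment> \<open>At \<open>s1\<close> both ends of the bridge lie in infinite clusters, at
        \<open>s2\<close> every tree meets such a cluster, and up to \<open>s3\<close> the two ends
        are separated, which leaves the interval from \<open>s2\<close> to \<open>s3\<close> for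
        lowered labels.\<close>
      obtain s1 where s1: "s1 \<in> \<rat>" "0 < s1" "s1 < \<xi> h" "h \<subseteq> inf_verts \<xi> s1" using props h by blast
      obtain s2 where s2: "s2 \<in> \<rat>" "s1 < s2" "s2 < \<xi> h" using Rats_dense_in_real[OF s1(3)] by blast
      obtain s3 where s3: "s2 < s3" "s3 < \<xi> h" using dense[OF s2(3)] by blast
      have "inf_verts \<xi> s1 \<noteq> {}" using s1(4) cd by blast
      moreover have "0 < s1 \<and> s1 < s2 \<and> s2 \<le> 1" using s1 s2 h1 by auto
      ultimately have "cluster (forest \<xi>) v0 \<inter> inf_verts \<xi> s2 \<noteq> {}" using props s1(1) s2(1) v0(1) by blast
      then obtain v where v: "(v0, v) \<in> reachable (forest \<xi>)" "v \<in> inf_verts \<xi> s2" by auto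
      have pv: "pure \<xi> v" using v0(2) cluster_eq[OF v(1)] by (simp add: pure_def)
      have cdi: "c \<in> inf_verts \<xi> s2" "d \<in> inf_verts \<xi> s2"
        using s1(4) inf_verts_mono[of s1 s2 \<xi>] s2(2) cd by auto
      have "(c, d) \<notin> reachable (below \<xi> s3)"
      proof
        assume "(c, d) \<in> reachable (below \<xi> s3)"
        then have "(c, d) \<in> reachable (below \<xi> (\<xi> h))"
          by (rule reachable_mono) (use below_mono[of s3 "\<xi> h" \<xi>] s3 in simp)
        then show False using forestD[of c d \<xi>] hF(1) cd by simp
      qed
      \<comment> \<open>Since the ends of the bridge are separated at level \<open>s3\<close>,
        \<open>v\<close> is separated from at least one of them.\<close>
      then have "(v, c) \<notin> reachable (below \<xi> s3) \<or> (v, d) \<notin> reachable (below \<xi> s3)"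
        using reachable_trans[OF reachable_sym[of v c "below \<xi> s3"], of d] by blast
      then obtain z where z: "z \<in> inf_verts \<xi> s2" "(v, z) \<notin> reachable (below \<xi> s3)" using cdi by blast
      show False
        by (rule no_separate_pure[OF elim v(2) pv z]) (use s1 s2 s3 h1 in auto)
    qed
  qed
qed

lemma AE_infinite_ends:
  assumes "\<not> (AE \<xi> in labels. bridges \<xi> = {})"
  shows "AE \<xi> in labels. \<forall>T\<in>graph_components V (FMSF E \<xi>). infinite (tree_ends (induced_edges (FMSF E \<xi>) T))"
  using AE_not_pure[OF assms] AE_inj AE_balanced
proof eventually_elim
  case (elim \<xi>)
  show ?case unfolding FMSF_eq_forest[OF elim(2)]
  proof
    fix T assume "T \<in> graph_components V (forest \<xi>)"
    then obtain v where v: "v \<in> V" "T = {y\<in>V. (v, y) \<in> reachable (forest \<xi>)}"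
      unfolding graph_components_def by blast
    have "T = cluster (forest \<xi>) v"
      using v cluster_subset_V[OF forest_subset v(1), of \<xi>] by (auto simp: cluster_def)
    then show "infinite (tree_ends (induced_edges (forest \<xi>) T))"
      using infinite_ends[OF elim(2) v(1)] infinite_bridges[OF elim(3) v(1)] elim(1) v(1) by blast
  qed
qed

end

section \<open>Minimal spanning forests of a labelled graph\<close>

lemma FMSF_cong: "(\<And>e. e \<in> E \<Longrightarrow> u e = u' e) \<Longrightarrow> FMSF E u = FMSF E u'"
proof -
  assume eq: "\<And>e. e \<in> E \<Longrightarrow> u e = u' e"
  have "(\<forall>f\<in>C. u f \<le> u e) \<longleftrightarrow> (\<forall>f\<in>C. u' f \<le> u' e)" if "e \<in> E" "is_cycle E C" for e C
    using that eq unfolding is_cycle_def by (intro ball_cong refl) (metis subsetD)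
  then show ?thesis unfolding FMSF_def by blast
qed

lemma WMSF_cong: "(\<And>e. e \<in> E \<Longrightarrow> u e = u' e) \<Longrightarrow> WMSF E u = WMSF E u'"
proof -
  assume eq: "\<And>e. e \<in> E \<Longrightarrow> u e = u' e"
  have "(\<forall>f\<in>C. u f \<le> u e) \<longleftrightarrow> (\<forall>f\<in>C. u' f \<le> u' e)" if "e \<in> E" "is_cycle E C \<or> is_biinf_path E C" for e C
    using that eq unfolding is_cycle_def is_biinf_path_def by (intro ball_cong refl) (metis subsetD)
  then show ?thesis unfolding WMSF_def by blast
qed

theorem theorem1p2:
  fixes V :: "'a set" and E :: "'a set set"
    and M :: "'w measure" and U :: "'a set \<Rightarrow> 'w \<Rightarrow> real"
  assumes "simple_graph V E"
    and "infinite V"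
    and "connected_graph V E"
    and "locally_finite_graph V E"
    and "transitive_graph V E"
    and "unimodular_graph V E"
    and "prob_space M"
    and "iid_uniform_labels M E U"
    and "\<not> (AE \<omega> in M. FMSF E (\<lambda>e. U e \<omega>) = WMSF E (\<lambda>e. U e \<omega>))"
  shows "AE \<omega> in M. \<forall>T \<in> graph_components V (FMSF E (\<lambda>e. U e \<omega>)).
           infinite (tree_ends (induced_edges (FMSF E (\<lambda>e. U e \<omega>)) T))"
proof -
  interpret utgraph V E
    by unfold_locales (use assms in auto)
  interpret M: prob_space M by fact
  \<comment> \<open>The restriction to \<open>E\<close> puts the labels into the product space; both
    forests read labels on \<open>E\<close> only.\<close>
  define X where "X = (\<lambda>\<omega>. \<lambda>e\<in>E. U e \<omega>)"
  have ind: "M.indep_vars (\<lambda>_. borel) U E" and unif: "\<And>e. e \<in> E \<Longrightarrow> distr M borel (U e) = unif"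
    using assms(8) by (auto simp: iid_uniform_labels_def unif_def)
  have rv: "\<And>e. e \<in> E \<Longrightarrow> U e \<in> borel_measurable M" using ind by (auto simp: M.indep_vars_def)
  have X: "X \<in> M \<rightarrow>\<^sub>M PiM E (\<lambda>_. borel)" unfolding X_def by (intro measurable_restrict rv)
  have "distr M (PiM E (\<lambda>_. borel)) X = PiM E (\<lambda>e. distr M borel (U e))"
    using ind M.indep_vars_iff_distr_eq_PiM'[OF E_nonempty, of U "\<lambda>_. borel"] rv by (simp add: X_def)
  also have "\<dots> = labels" unfolding labels_def by (intro PiM_cong refl unif)
  finally have distr: "distr M (PiM E (\<lambda>_. borel)) X = labels" .
  have F: "FMSF E (X \<omega>) = FMSF E (\<lambda>e. U e \<omega>)" for \<omega> by (rule FMSF_cong) (simp add: X_def)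
  have W: "WMSF E (X \<omega>) = WMSF E (\<lambda>e. U e \<omega>)" for \<omega> by (rule WMSF_cong) (simp add: X_def)
  have "\<not> (AE \<xi> in labels. bridges \<xi> = {})"
  proof
    assume "AE \<xi> in labels. bridges \<xi> = {}"
    with AE_inj have "AE \<xi> in labels. FMSF E \<xi> = WMSF E \<xi>"
      by eventually_elim (rule FMSF_eq_WMSF)
    then have "AE \<omega> in M. FMSF E (X \<omega>) = WMSF E (X \<omega>)"
      by (intro AE_distrD[OF X]) (unfold distr)
    then show False using assms(9) by (simp add: F W)
  qed
  then have "AE \<xi> in labels. \<forall>T\<in>graph_components V (FMSF E \<xi>). infinite (tree_ends (induced_edges (FMSF E \<xi>) T))"
    by (rule AE_infinite_ends)
  then have "AE \<omega> in M. \<forall>T\<in>graph_components V (FMSF E (X \<omega>)). infinite (tree_ends (induced_edges (FMSF E (X \<omega>)) T))"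
    by (intro AE_distrD[OF X]) (unfold distr)
  then show ?thesis by (simp add: F)
qed

end
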